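(* Let $G=(V,E,F)$ be a simple planar graph that is connected, locally finite, has empty cut locus for every vertex, and satisfies $\kappa_V(G)<0$. Let $q:=\sup_{f\in F}|f|$ and set $q/(q-1):=1$ if $q=\infty$. Then for all $v\in V$ and $n\ge1$, $$|S_n(v)|\ \ge\ -2\kappa_V(G)\frac{q}{q-1}\,|B_{n-1}(v)|.$$ Moreover, with $\mu:=\limsup_{n\to\infty}\frac1n\log|S_n(v)|$ and $p:=\sup_{w\in V}|w|$, $$\log\Big(1-2\kappa_V(G)\frac{q}{q-1}\Big)\le\mu\le\log(p-1).$$
   Context: Setting: $G=(V,E)$ is a connected graph embedded in $\mathbb R^2$, identified with its image; faces $F$ are the closures of the connected components of $\mathbb R^2\setminus\bigcup E$. Locally finite: every point has a neighbourhood meeting only finitely many edges; simple: no loops, no multiple edges. A walk is a finite or infinite sequence of edges whose curves can be concatenated to a curve; its length is its number of edges; a boundary walk of a face $f$ is a walk meeting all vertices of $f$ that is closed if finite. $|f|$ is the length of a shortest boundary walk if a finite one exists, else $\infty$ ($1/\infty=0$); $|v|$ is the number of edges at $v$ (for simple $G$). Corners are pairs $(v,f)$ with $v\in f$; $C_v(G)$ the corners at $v$; multiplicity $|(v,f)|$ is the minimal number of times a boundary walk of $f$ visits $v$. $\kappa_V^G(v)=1-\frac{|v|}{2}+\sum_{(v,f)\in C_v(G)}\frac{|(v,f)|}{|f|}$, $\kappa_V(G)=\sup_V\kappa_V^G$. $d$ is the combinatorial distance; $B_n(v)=\{w:d(v,w)\le n\}$, $S_n(v)=B_n(v)\setminus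 B_{n-1}(v)$. The cut locus of $v_0$ is the set of vertices $v$ with $d(v_0,w)\le d(v_0,v)$ for all neighbours $w$ of $v$. *)

theory Defs
  imports "HOL-Analysis.Analysis"
begin

type_synonym pt = "real^2"

text \<open>A plane graph: vertices V (points of the plane), edges E (images of arcs).
  Each edge is an arc whose only vertices are its two (distinct) endpoints;
  distinct edges meet only in vertices; no multiple edges (simple).\<close>

definition plane_graph :: "pt set \<Rightarrow> pt set set \<Rightarrow> bool" where
  "plane_graph V E \<longleftrightarrow>
     (\<forall>e\<in>E. \<exists>g. arc g \<and> path_image g = e \<and> pathstart g \<in> V \<and> pathfinish g \<in> V
                 \<and> e \<inter> V = {pathstart g, pathfinish g}) \<and>
     (\<forall>e\<in>E. \<forall>e'\<in>E. e \<noteq> e' \<longrightarrow> e \<inter> e' \<subseteq> V) \<and>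
     (\<forall>e\<in>E. \<forall>e'\<in>E. e \<inter> V = e' \<inter> V \<longrightarrow> e = e')"

definition locally_finite_graph :: "pt set set \<Rightarrow> bool" where
  "locally_finite_graph E \<longleftrightarrow>
     (\<forall>x::pt. \<exists>U. open U \<and> x \<in> U \<and> finite {e\<in>E. e \<inter> U \<noteq> {}})"

definition adj :: "pt set \<Rightarrow> pt set set \<Rightarrow> pt \<Rightarrow> pt \<Rightarrow> bool" where
  "adj V E u v \<longleftrightarrow> (\<exists>e\<in>E. e \<inter> V = {u, v}) \<and> u \<noteq> v"

definition adjrel :: "pt set \<Rightarrow> pt set set \<Rightarrow> (pt \<times> pt) set" where
  "adjrel V E = {(u, v). adj V E u v}"

definition graph_connected :: "pt set \<Rightarrow> pt set set \<Rightarrow> bool" where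
  "graph_connected V E \<longleftrightarrow> V \<noteq> {} \<and> (\<forall>u\<in>V. \<forall>v\<in>V. (u, v) \<in> (adjrel V E)\<^sup>*)"

text \<open>Combinatorial distance, balls and spheres.\<close>
definition gdist :: "pt set \<Rightarrow> pt set set \<Rightarrow> pt \<Rightarrow> pt \<Rightarrow> nat" where
  "gdist V E u v = (LEAST n. (u, v) \<in> (adjrel V E) ^^ n)"

definition ball_n :: "pt set \<Rightarrow> pt set set \<Rightarrow> pt \<Rightarrow> nat \<Rightarrow> pt set" where
  "ball_n V E v n = {w\<in>V. gdist V E v w \<le> n}"

text \<open>S_n(v) = B_n(v) minus B_{n-1}(v) (for n = 0 this is B_0(v)).\<close>
definition sphere_n :: "pt set \<Rightarrow> pt set set \<Rightarrow> pt \<Rightarrow> nat \<Rightarrow> pt set" where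
  "sphere_n V E v n = {w\<in>V. gdist V E v w = n}"

definition degree :: "pt set set \<Rightarrow> pt \<Rightarrow> nat" where
  "degree E v = card {e\<in>E. v \<in> e}"

definition empty_cut_locus :: "pt set \<Rightarrow> pt set set \<Rightarrow> bool" where
  "empty_cut_locus V E \<longleftrightarrow>
     (\<forall>v0\<in>V. \<not> (\<exists>v\<in>V. \<forall>w. adj V E v w \<longrightarrow> gdist V E v0 w \<le> gdist V E v0 v))"

text \<open>Faces: closures of the connected components of the complement of the graph.\<close>
definition faces :: "pt set \<Rightarrow> pt set set \<Rightarrow> pt set set" where
  "faces V E = closure ` components (UNIV - (V \<union> \<Union>E))"

text \<open>A finite closed boundary walk of face f, given by its vertex sequence
  [v0, ..., vk] with vk = v0, consecutive vertices joined by an edge contained in f,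
  meeting all vertices of f. Its length is k.\<close>
definition closed_boundary_walk :: "pt set \<Rightarrow> pt set set \<Rightarrow> pt set \<Rightarrow> pt list \<Rightarrow> bool" where
  "closed_boundary_walk V E f vs \<longleftrightarrow>
     vs \<noteq> [] \<and> hd vs = last vs \<and> set vs \<subseteq> V \<and>
     (\<forall>i. Suc i < length vs \<longrightarrow> (\<exists>e\<in>E. e \<inter> V = {vs ! i, vs ! Suc i} \<and> vs ! i \<noteq> vs ! Suc i \<and> e \<subseteq> f)) \<and>
     V \<inter> f \<subseteq> set vs"

definition walk_len :: "pt list \<Rightarrow> nat" where
  "walk_len vs = length vs - 1"

text \<open>Number of visits of a closed walk to v (the closing vertex counted once).\<close>
definition walk_visits :: "pt list \<Rightarrow> pt \<Rightarrow> nat" where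
  "walk_visits vs v = card {i. i < length vs - 1 \<and> vs ! i = v}"

definition finite_face :: "pt set \<Rightarrow> pt set set \<Rightarrow> pt set \<Rightarrow> bool" where
  "finite_face V E f \<longleftrightarrow> (\<exists>vs. closed_boundary_walk V E f vs)"

text \<open>|f| for faces with a finite boundary walk.\<close>
definition face_len :: "pt set \<Rightarrow> pt set set \<Rightarrow> pt set \<Rightarrow> nat" where
  "face_len V E f = (LEAST k. \<exists>vs. closed_boundary_walk V E f vs \<and> walk_len vs = k)"

text \<open>Multiplicity |(v,f)| of a corner.\<close>
definition corner_mult :: "pt set \<Rightarrow> pt set set \<Rightarrow> pt \<Rightarrow> pt set \<Rightarrow> nat" where
  "corner_mult V E v f = (LEAST m. \<exists>vs. closed_boundary_walk V E f vs \<and> walk_visits vs v = m)"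

text \<open>|(v,f)| / |f|, with 1/\<infinity> = 0.\<close>
definition corner_term :: "pt set \<Rightarrow> pt set set \<Rightarrow> pt \<Rightarrow> pt set \<Rightarrow> real" where
  "corner_term V E v f =
     (if finite_face V E f then real (corner_mult V E v f) / real (face_len V E f) else 0)"

definition vertex_curv :: "pt set \<Rightarrow> pt set set \<Rightarrow> pt \<Rightarrow> real" where
  "vertex_curv V E v = 1 - real (degree E v) / 2 + (\<Sum>f\<in>{f\<in>faces V E. v \<in> f}. corner_term V E v f)"

definition graph_curv :: "pt set \<Rightarrow> pt set set \<Rightarrow> real" where
  "graph_curv V E = (SUP v\<in>V. vertex_curv V E v)"

text \<open>q/(q-1) with q = sup of face lengths, and := 1 if q = \<infinity>.\<close>
definition q_factor :: "pt set \<Rightarrow> pt set set \<Rightarrow> real" where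
  "q_factor V E =
     (if (\<forall>f\<in>faces V E. finite_face V E f) \<and> bdd_above (face_len V E ` faces V E)
      then (let q = real (Sup (face_len V E ` faces V E)) in q / (q - 1))
      else 1)"

text \<open>p = sup of vertex degrees (possibly \<infinity>).\<close>
definition max_degree :: "pt set \<Rightarrow> pt set set \<Rightarrow> ereal" where
  "max_degree V E = (SUP w\<in>V. ereal (real (degree E w)))"

definition ereal_ln :: "ereal \<Rightarrow> ereal" where
  "ereal_ln x = (if x = \<infinity> then \<infinity> else ereal (ln (real_of_ereal x)))"

end

theory Submission
  imports Defs
begin

text \<open>
  Empty cut loci let every vertex escape to infinity, away from any prescribed base vertex. Hence a ball
  \<open>B_n\<close> has no vertices or edges of the graph in its holes, and no cut vertex separates off a finite
  piece. The latter shows that a face that lies inside some cycle, or that has only finitely many vertices,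
  is bounded by a cycle: its length is its number of vertices and its corners have multiplicity one.

  Completing a breadth-first tree of \<open>B_n\<close> edge by edge to the subgraph induced by \<open>B_n\<close>
  produces at least \<open>|E(B_n)| - |B_n| + 1\<close> holes (the inequality of Euler's formula that is needed), all
  of them faces bounded by cycles. A vertex \<open>s\<close> of \<open>S_n\<close> with \<open>D_s\<close> edges in \<open>B_n\<close> lies on at
  most \<open>D_s - 1\<close> of these faces, because one of its edges leaves \<open>B_n\<close>. Summing the
  curvature over \<open>B_(n-1)\<close> yields
  \<open>-2 \<kappa> |B_(n-1)| \<le> |S_n| - (\<Sum>s. D_s - 1) / 3 - 2 X\<close>, where \<open>X\<close> collects the corners at
  \<open>B_(n-1)\<close> of the remaining faces. If \<open>q < \<infinity>\<close>, a vertex \<open>s\<close> with \<open>D_s = 1\<close> forces such a corner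
  at its parent, and each corner is charged at most twice; this gains the missing \<open>|S_n| / q\<close>.
\<close>

subsection \<open>Plane topology on \<open>real^2\<close>\<close>

text \<open>Edges are arbitrary arcs and faces are bare closures of components, so every
  combinatorial fact about faces has to be extracted from plane topology. Besides the Jordan curve
  theorem and its theta-curve version the tool is Janiszewski's theorem: it shows that trees do not
  separate the plane, that an arc has at most two sides locally, and that points enclosed by no
  cycle can be joined.

  One inequality of Euler's formula suffices because corner terms are nonnegative: a face missing
  from the chosen family of holes only enlarges \<open>X\<close>.

  The coefficient 1/3 is \<open>2 * (1/2 - 1/3)\<close>. Handshaking leaves
  \<open>(D_s - 1) / 2\<close> for each \<open>s\<close> in \<open>S_n\<close>; the hole corners at
  \<open>s\<close>, which do not belong to \<open>B_(n-1)\<close>, must be subtracted and cost at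
  most 1/3 each, as a cycle in a simple graph has at least 3 vertices. For finite \<open>q\<close>
  let \<open>S1\<close> be the set of \<open>s\<close> with \<open>D_s = 1\<close> and
  \<open>P\<close> the set of remaining corners at \<open>B_(n-1)\<close>. Then
  \<open>X \<ge> |P| / q\<close> and \<open>|S1| \<le> 2 |P|\<close>, so with
  \<open>q \<ge> 3\<close> the gain \<open>(|S_n| - |S1|) / 3 + 2 X\<close> is at least
  \<open>|S_n| / q\<close>; and \<open>1 - 1/q\<close> is the reciprocal of
  \<open>q / (q - 1)\<close>.\<close>

definition to_complex :: "pt \<Rightarrow> complex" where
  "to_complex x = Complex (x $ 1) (x $ 2)"

definition of_complex :: "complex \<Rightarrow> pt" where
  "of_complex z = vector [Re z, Im z]"

lemma of_complex_to_complex [simp]: "of_complex (to_complex x) = x"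
  by (simp add: of_complex_def to_complex_def vec_eq_iff forall_2)

lemma to_complex_of_complex [simp]: "to_complex (of_complex z) = z"
  by (simp add: of_complex_def to_complex_def)

lemma linear_to_complex: "linear to_complex"
  by (rule linearI) (simp_all add: to_complex_def complex_eq_iff)

lemma linear_of_complex: "linear of_complex"
  by (rule linearI) (simp_all add: of_complex_def vec_eq_iff forall_2)

lemma inj_to_complex: "inj to_complex"
  by (metis injI of_complex_to_complex)

lemma to_complex_image_mem [simp]: "to_complex x \<in> to_complex ` S \<longleftrightarrow> x \<in> S"
  by (simp add: inj_image_mem_iff inj_to_complex)

lemma surj_to_complex: "surj to_complex"
  by (metis surjI to_complex_of_complex)

lemma of_complex_image [simp]: "of_complex ` to_complex ` S = S"
  by (simp add: image_image)

lemma to_complex_image_Compl: "to_complex ` (- S) = - to_complex ` S"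
  by (simp add: bij_def bij_image_Compl_eq inj_to_complex surj_to_complex)

lemma continuous_to_complex: "continuous_on S to_complex"
  by (simp add: linear_continuous_on linear_conv_bounded_linear[symmetric] linear_to_complex)

lemma continuous_of_complex: "continuous_on S of_complex"
  by (simp add: linear_continuous_on linear_conv_bounded_linear[symmetric] linear_of_complex)

lemma connected_to_complex: "connected (to_complex ` S) \<longleftrightarrow> connected S"
  by (metis connected_continuous_image continuous_of_complex continuous_to_complex of_complex_image)

lemma connected_component_to_complex:
  "connected_component (to_complex ` S) (to_complex a) (to_complex b) \<longleftrightarrow> connected_component S a b"
proof
  assume "connected_component (to_complex ` S) (to_complex a) (to_complex b)"
  then obtain T where T: "connected T" "T \<subseteq> to_complex ` S" "to_complex a \<in> T" "to_complex b \<in> T"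
    by (auto simp: connected_component_def)
  have "connected (of_complex ` T)" "of_complex ` T \<subseteq> S"
    using T connected_continuous_image continuous_of_complex by auto
  moreover have "a \<in> of_complex ` T" "b \<in> of_complex ` T"
    using T by (metis imageI of_complex_to_complex)+
  ultimately show "connected_component S a b"
    by (auto simp: connected_component_def)
next
  assume "connected_component S a b"
  then obtain T where T: "connected T" "T \<subseteq> S" "a \<in> T" "b \<in> T"
    by (auto simp: connected_component_def)
  then show "connected_component (to_complex ` S) (to_complex a) (to_complex b)"
    unfolding connected_component_def
    by (intro exI[of _ "to_complex ` T"]) (auto simp: connected_to_complex)
qed

lemma bounded_to_complex: "bounded (to_complex ` S) \<longleftrightarrow> bounded S"
  by (metis bounded_linear_image linear_conv_bounded_linear linear_of_complex linear_to_complex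
      of_complex_image)

lemma closed_to_complex: "closed (to_complex ` S) \<longleftrightarrow> closed S"
  by (meson closed_injective_linear_image_eq inj_to_complex linear_to_complex)

lemma compact_to_complex: "compact (to_complex ` S) \<longleftrightarrow> compact S"
  by (simp add: bounded_to_complex closed_to_complex compact_eq_bounded_closed)

lemma connected_component_set_to_complex:
  "connected_component_set (to_complex ` S) (to_complex a) = to_complex ` connected_component_set S a"
proof (intro set_eqI)
  fix z
  show "z \<in> connected_component_set (to_complex ` S) (to_complex a)
    \<longleftrightarrow> z \<in> to_complex ` connected_component_set S a"
    by (metis connected_component_to_complex mem_Collect_eq to_complex_image_mem to_complex_of_complex)
qed

lemma inside_to_complex: "inside (to_complex ` S) = to_complex ` inside S"
proof (intro set_eqI)
  fix z
  have "to_complex x \<in> inside (to_complex ` S) \<longleftrightarrow> x \<in> inside S" for x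
    by (simp add: inside_def to_complex_image_Compl[symmetric]
        connected_component_set_to_complex bounded_to_complex)
  then show "z \<in> inside (to_complex ` S) \<longleftrightarrow> z \<in> to_complex ` inside S"
    by (metis to_complex_image_mem to_complex_of_complex)
qed

lemma path_image_to_complex: "path_image (to_complex \<circ> g) = to_complex ` path_image g"
  by (simp add: path_image_compose)

lemma simple_path_to_complex: "simple_path (to_complex \<circ> g) \<longleftrightarrow> simple_path g"
  by (simp add: simple_path_linear_image_eq linear_to_complex inj_to_complex)

text \<open>The gluing device of the whole development: two closed sets, one of them compact, that
  meet in a connected set and separately do not separate two points do not separate them jointly
  either.\<close>

lemma plane_Janiszewski:
  fixes a b :: pt
  assumes "compact S" "closed T" "connected (S \<inter> T)"
    and "connected_component (- S) a b" "connected_component (- T) a b"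
  shows "connected_component (- (S \<union> T)) a b"
proof -
  have "connected (to_complex ` S \<inter> to_complex ` T)"
    by (metis assms(3) connected_to_complex image_Int inj_to_complex)
  then have "connected_component (- (to_complex ` S \<union> to_complex ` T)) (to_complex a) (to_complex b)"
    using assms by (intro Janiszewski)
      (auto simp: compact_to_complex closed_to_complex to_complex_image_Compl[symmetric]
        connected_component_to_complex)
  then show ?thesis
    by (metis connected_component_to_complex image_Un to_complex_image_Compl)
qed

lemma closure_to_complex: "closure (to_complex ` S) = to_complex ` closure S"
  by (simp add: closure_injective_linear_image inj_to_complex linear_to_complex)

text \<open>The two closure facts at the end supply points of the inside and of the outside
  arbitrarily close to any given point of the curve.\<close>

lemma plane_Jordan:
  fixes c :: "real \<Rightarrow> pt"
  assumes "simple_path c" "pathfinish c = pathstart c"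
  shows "inside (path_image c) \<noteq> {}" "open (inside (path_image c))" "connected (inside (path_image c))"
    "open (outside (path_image c))" "connected (outside (path_image c))"
    "bounded (inside (path_image c))"
    "closure (inside (path_image c)) = inside (path_image c) \<union> path_image c"
    "path_image c \<subseteq> closure (outside (path_image c))"
proof -
  let ?c = "to_complex \<circ> c"
  have "simple_path ?c" "pathfinish ?c = pathstart ?c"
    using assms by (simp_all add: simple_path_to_complex pathfinish_compose pathstart_compose)
  from Jordan_inside_outside[OF this]
  have J: "inside (to_complex ` path_image c) \<noteq> {}" "connected (inside (to_complex ` path_image c))"
     "frontier (inside (to_complex ` path_image c)) = to_complex ` path_image c"
     "frontier (outside (to_complex ` path_image c)) = to_complex ` path_image c"
    by (auto simp: path_image_to_complex)
  have cl: "closed (path_image c)" and bd: "bounded (path_image c)"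
    using assms by (simp_all add: closed_simple_path_image bounded_simple_path_image)
  show 1: "inside (path_image c) \<noteq> {}" "connected (inside (path_image c))"
    using J by (auto simp: inside_to_complex connected_to_complex)
  show 2: "open (inside (path_image c))" "open (outside (path_image c))"
    using cl by (auto intro: open_inside open_outside)
  show "connected (outside (path_image c))" "bounded (inside (path_image c))"
    using bd by (auto intro!: connected_outside bounded_inside)
  have "closure (inside (to_complex ` path_image c))
      = inside (to_complex ` path_image c) \<union> to_complex ` path_image c"
    using J(3) by (metis closure_Un_frontier)
  then have "to_complex ` closure (inside (path_image c))
    = to_complex ` (inside (path_image c) \<union> path_image c)"
    by (simp add: inside_to_complex closure_to_complex image_Un)
  then show "closure (inside (path_image c)) = inside (path_image c) \<union> path_image c"
    by (simp add: inj_image_eq_iff inj_to_complex)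
  have "outside (to_complex ` S) = to_complex ` outside S" for S
    by (metis outside_inside inside_to_complex image_Un to_complex_image_Compl)
  then have "to_complex ` path_image c \<subseteq> to_complex ` closure (outside (path_image c))"
    using J(4) by (metis closure_to_complex closure_Un_frontier Un_upper2)
  then show "path_image c \<subseteq> closure (outside (path_image c))"
    by (simp add: inj_image_subset_iff inj_to_complex)
qed

text \<open>The theta-curve theorem: a chord \<open>c\<close> cuts the inside of the closed curve
  into the insides of the two closed curves that it forms with either half.\<close>

lemma plane_split_inside:
  fixes c c1 c2 :: "real \<Rightarrow> pt"
  assumes "arc c1" "pathstart c1 = a" "pathfinish c1 = b"
    and "arc c2" "pathstart c2 = a" "pathfinish c2 = b"
    and "arc c" "pathstart c = a" "pathfinish c = b"
    and "path_image c1 \<inter> path_image c2 = {a, b}"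
    and "path_image c1 \<inter> path_image c = {a, b}"
    and "path_image c2 \<inter> path_image c = {a, b}"
    and "path_image c \<inter> inside (path_image c1 \<union> path_image c2) \<noteq> {}"
  shows "inside (path_image c1 \<union> path_image c) \<union> inside (path_image c2 \<union> path_image c) \<union>
           (path_image c - {a, b}) = inside (path_image c1 \<union> path_image c2)"
proof -
  let ?h = to_complex
  have ab: "a \<noteq> b"
    using assms(1-3) arc_distinct_ends by blast
  have img: "?h ` A \<inter> ?h ` B = {?h a, ?h b}" if "A \<inter> B = {a, b}" for A B
    by (metis image_Int inj_to_complex that image_insert image_empty)
  have ne: "path_image (?h \<circ> c) \<inter> inside (path_image (?h \<circ> c1) \<union> path_image (?h \<circ> c2)) \<noteq> {}"
    using assms(13)
    by (simp add: path_image_to_complex image_Un[symmetric] inside_to_complex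
        image_Int[OF inj_to_complex, symmetric])
  have "inside (path_image (?h \<circ> c1) \<union> path_image (?h \<circ> c))
      \<union> inside (path_image (?h \<circ> c2) \<union> path_image (?h \<circ> c))
      \<union> (path_image (?h \<circ> c) - {?h a, ?h b})
      = inside (path_image (?h \<circ> c1) \<union> path_image (?h \<circ> c2))"
    by (rule split_inside_simple_closed_curve[of "?h \<circ> c1" "?h a" "?h b" "?h \<circ> c2" "?h \<circ> c"])
      (use assms ab ne in \<open>auto simp: simple_path_to_complex arc_imp_simple_path pathstart_compose
        pathfinish_compose path_image_to_complex img inj_eq[OF inj_to_complex]\<close>)
  moreover have "?h ` path_image c - {?h a, ?h b} = ?h ` (path_image c - {a, b})"
    by (simp add: image_set_diff inj_to_complex)
  ultimately show ?thesis
    by (simp add: path_image_to_complex image_Un[symmetric] inside_to_complex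
        inj_image_eq_iff inj_to_complex)
qed

section \<open>The two sides of an arc\<close>

text \<open>If \<open>g ty\<close> were not in the closure, a subarc around it would avoid the
  closure too. What remains of the obstacle consists of the initial piece \<open>S\<close> and of
  \<open>T\<close> with the final piece, and these meet in at most \<open>g 0\<close>. Neither
  separates \<open>U\<close> from \<open>g ty\<close>, so by Janiszewski there is a connection
  avoiding both; it has to cross the frontier of \<open>U\<close>, for which only the excluded
  subarc is left.\<close>

lemma component_closure_extends_along_arc:
  fixes g :: "real \<Rightarrow> pt"
  assumes g: "arc g" and T: "closed T" "T \<inter> path_image g \<subseteq> {pathstart g, pathfinish g}"
    and U: "U \<in> components (- (T \<union> path_image g))"
    and t: "0 < tx" "tx < ty" "ty < 1" and x: "g tx \<in> closure U"
  shows "g ty \<in> closure U"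
proof (rule ccontr)
  assume y: "g ty \<notin> closure U"
  have inj: "inj_on g {0..1}" and cont: "continuous_on {0..1} g"
    using g by (auto simp: arc_def path_def)
  have Tg: "g s \<notin> T" if "0 < s" "s < 1" for s
  proof
    assume "g s \<in> T"
    then have "g s = g 0 \<or> g s = g 1"
      using T(2) that by (auto simp: path_image_def pathstart_def pathfinish_def)
    then show False
      using inj_onD[OF inj, of s 0] inj_onD[OF inj, of s 1] that by auto
  qed
  obtain A where A: "open A" "A \<inter> {0..1} = g -` (- closure U) \<inter> {0..1}"
    using continuous_on_open_invariant[THEN iffD1, OF cont, rule_format, OF open_Compl[OF closed_closure]]
    by metis
  have "ty \<in> g -` (- closure U) \<inter> {0..1}" using y t by simp
  then have "ty \<in> A" using A(2) by blast
  then obtain d where d: "d > 0" "ball ty d \<subseteq> A"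
    using A(1) open_contains_ball by blast
  have far: "g s \<notin> closure U" if "\<bar>s - ty\<bar> < d" "0 \<le> s" "s \<le> 1" for s
  proof -
    have "s \<in> A \<inter> {0..1}"
      using that d by (auto simp: subset_iff dist_real_def abs_minus_commute)
    then show ?thesis unfolding A(2) by simp
  qed
  \<comment> \<open>Half the distance \<open>d\<close> keeps the subarc between \<open>t1\<close>
    and \<open>t2\<close> in the range controlled by \<open>far\<close>; since \<open>tx\<close> is
    outside that range, \<open>t1\<close> comes after \<open>tx\<close>. The minimum keeps
    \<open>t2\<close> below 1.\<close>
  define t1 where "t1 = ty - d/2"
  define t2 where "t2 = ty + min (d/2) ((1 - ty)/2)"
  have "\<not> \<bar>tx - ty\<bar> < d"
    using far[of tx] x t by auto
  then have "tx \<le> ty - d"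
    using t by linarith
  then have t12: "0 < t1" "tx < t1" "t1 < ty" "ty < t2" "t2 < 1"
    using d t unfolding t1_def t2_def by (auto simp: min_def field_simps)
  have mid: "g s \<notin> closure U" if "t1 \<le> s" "s \<le> t2" for s
    using that t t12 d by (intro far) (auto simp: t1_def t2_def min_def abs_if split: if_splits)
  define S where "S = g ` {0..t1}"
  define T2 where "T2 = T \<union> g ` {t2..1}"
  have contS: "continuous_on {0..t1} g" and cont2: "continuous_on {t2..1} g"
    and contm: "continuous_on {tx..ty} g"
    using t12 t by (auto intro!: continuous_on_subset[OF cont])
  have cS: "compact S"
    unfolding S_def by (rule compact_continuous_image[OF contS]) simp
  have cT2: "closed T2"
    unfolding T2_def using T(1) compact_imp_closed[OF compact_continuous_image[OF cont2 compact_Icc]]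
    by auto
  have "S \<inter> T2 \<subseteq> {g 0}"
  proof
    fix z assume z: "z \<in> S \<inter> T2"
    then obtain s where s: "z = g s" "0 \<le> s" "s \<le> t1" by (auto simp: S_def)
    have "z \<notin> g ` {t2..1}"
      using s t12 by (auto dest!: inj_onD[OF inj])
    then have "g s \<in> T" using z s by (auto simp: T2_def)
    then have "s = 0" using Tg[of s] s t12 by (cases "0 < s") auto
    then show "z \<in> {g 0}" using s by auto
  qed
  then have con: "connected (S \<inter> T2)"
    by (metis connected_empty connected_sing subset_singletonD)
  have UT: "U \<inter> T = {}" and Ug: "U \<inter> path_image g = {}" and cU: "connected U"
    using U in_components_subset in_components_connected by blast+
  obtain p where p: "p \<in> U" using U in_components_nonempty by blast
  have SU: "S \<subseteq> path_image g" "g ` {t2..1} \<subseteq> path_image g"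
    using t12 t by (auto simp: S_def path_image_def)
  have yS: "g ty \<notin> S"
    using t12 t unfolding S_def by (auto dest!: inj_onD[OF inj])
  have yT2: "g s \<notin> T2" if "tx \<le> s" "s \<le> ty" for s
    using Tg[of s] that t12 t unfolding T2_def by (auto dest!: inj_onD[OF inj])
  have "arc (subpath 0 t1 g)"
    using g t12 t by (intro arc_subpath_arc) (auto dest!: inj_onD[OF inj])
  then have "connected (- path_image (subpath 0 t1 g))"
    by (rule connected_arc_complement) simp
  moreover have "path_image (subpath 0 t1 g) = S"
    using t12 by (simp add: path_image_subpath_gen S_def closed_segment_eq_real_ivl)
  ultimately have "connected_component (- S) p (g ty)"
    unfolding connected_component_def using p Ug SU yS
    by (intro exI[of _ "- S"]) auto
  moreover have "connected_component (- T2) p (g ty)"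
  proof -
    have "connected (insert (g tx) U)"
      using x cU connected_intermediate_closure[of U "insert (g tx) U"] closure_subset by blast
    moreover have "connected (g ` {tx..ty})"
      by (rule connected_continuous_image[OF contm]) simp
    ultimately have "connected (insert (g tx) U \<union> g ` {tx..ty})"
      using t by (intro connected_Un) auto
    moreover have "insert (g tx) U \<union> g ` {tx..ty} \<subseteq> - T2"
    proof -
      have "U \<inter> T2 = {}" using UT Ug SU unfolding T2_def by blast
      then show ?thesis using yT2 t by auto
    qed
    ultimately show ?thesis
      unfolding connected_component_def using p t
      by (intro exI[of _ "insert (g tx) U \<union> g ` {tx..ty}"]) auto
  qed
  ultimately have "connected_component (- (S \<union> T2)) p (g ty)"
    using cS cT2 con by (intro plane_Janiszewski)
  then obtain W where W: "connected W" "W \<subseteq> - (S \<union> T2)" "p \<in> W" "g ty \<in> W"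
    by (auto simp: connected_component_def)
  have "W \<inter> frontier U \<noteq> {}"
    using W p y closure_subset[of U] by (intro connected_Int_frontier) blast+
  then obtain z where z: "z \<in> W" "z \<in> frontier U" by blast
  have "closed (T \<union> path_image g)" using T(1) closed_arc_image[OF g] by auto
  then have "z \<in> T \<union> path_image g"
    using frontier_of_components_closed_complement U z by blast
  moreover have "z \<notin> T" using z W by (auto simp: T2_def)
  ultimately obtain s where s: "z = g s" "0 \<le> s" "s \<le> 1" by (auto simp: path_image_def)
  then have "\<not> s \<le> t1" "\<not> t2 \<le> s" using z W by (auto simp: S_def T2_def)
  then show False using mid[of s] s z by (auto simp: frontier_def)
qed

lemma component_closure_contains_arc:
  fixes g :: "real \<Rightarrow> pt"
  assumes g: "arc g" and T: "closed T" "T \<inter> path_image g \<subseteq> {pathstart g, pathfinish g}"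
    and U: "U \<in> components (- (T \<union> path_image g))"
    and x: "x \<in> closure U" "x \<in> path_image g" "x \<noteq> pathstart g" "x \<noteq> pathfinish g"
  shows "path_image g \<subseteq> closure U"
proof -
  obtain tx where tx: "x = g tx" "0 \<le> tx" "tx \<le> 1" using x(2) by (auto simp: path_image_def)
  with x have tx': "0 < tx" "tx < 1"
    by (auto simp: pathstart_def pathfinish_def order_less_le)
  have open_part: "g s \<in> closure U" if s: "0 < s" "s < 1" for s
  proof -
    consider "tx = s" | "tx < s" | "s < tx" by linarith
    then show ?thesis
    proof cases
      case 2
      then show ?thesis
        using component_closure_extends_along_arc[OF g T U] tx tx' s x by auto
    next
      case 3
      \<comment> \<open>The preceding lemma only moves forward along the arc, so the backward
        direction uses the reversed arc.\<close>
      have "reversepath g (1 - s) \<in> closure U"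
      proof (rule component_closure_extends_along_arc[of "reversepath g" T U "1 - tx"])
        show "T \<inter> path_image (reversepath g) \<subseteq> {pathstart (reversepath g), pathfinish (reversepath g)}"
          using T by auto
      qed (use g T U tx tx' s 3 x in \<open>auto simp: arc_reversepath\<close>, simp add: reversepath_def)
      then show ?thesis by (simp add: reversepath_def)
    qed (use x tx in auto)
  qed
  have "continuous_on (closure {0<..<1}) g"
    using g by (simp add: arc_def path_def)
  then have "g ` closure {0<..<1} \<subseteq> closure (g ` {0<..<1})"
    by (rule image_closure_subset) (auto intro: closure_subset[THEN subsetD])
  also have "\<dots> \<subseteq> closure U"
    using open_part by (intro closure_minimal) auto
  finally show ?thesis by (simp add: path_image_def)
qed

text \<open>An arc has locally at most two sides: the subarc through \<open>y\<close> of the arc inside a small disc,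
  closed up by an arc of the bounding circle, is a Jordan curve, and Janiszewski's theorem
  joins two points on the same side of it without leaving the disc or crossing the arc.\<close>

lemma arc_locally_two_sided:
  fixes g :: "real \<Rightarrow> pt"
  assumes g: "arc g" and y: "y \<in> path_image g" "y \<noteq> pathstart g" "y \<noteq> pathfinish g"
    and "open D0" "y \<in> D0"
  obtains r where "r > 0" "ball y r \<subseteq> D0" "ball y r - path_image g \<noteq> {}"
    "\<And>p q z. {p, q, z} \<subseteq> ball y r - path_image g \<Longrightarrow>
       connected_component (D0 - path_image g) p q \<or> connected_component (D0 - path_image g) q z
       \<or> connected_component (D0 - path_image g) p z"
proof -
  have inj: "inj_on g {0..1}" and cont: "continuous_on {0..1} g"
    using g by (auto simp: arc_def path_def)
  obtain ty where ty: "y = g ty" "0 \<le> ty" "ty \<le> 1" using y(1) by (auto simp: path_image_def)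
  with y have ty': "0 < ty" "ty < 1"
    by (auto simp: pathstart_def pathfinish_def order_less_le)
  have "open (D0 - {g 0, g 1})" "y \<in> D0 - {g 0, g 1}"
    using assms by (auto simp: pathstart_def pathfinish_def)
  then obtain R where R: "R > 0" "ball y R \<subseteq> D0 - {g 0, g 1}"
    using open_contains_ball by meson
  define D where "D = ball y R"
  have g01: "g 0 \<notin> D" "g 1 \<notin> D" using R by (auto simp: D_def)
  \<comment> \<open>First exit from the disc: applied to both halves of the arc starting at
    \<open>y\<close>, it cuts out the subarc through \<open>y\<close> whose ends lie on the bounding
    circle.\<close>
  have exit: "\<exists>u. 0 \<le> u \<and> u \<le> 1 \<and> (\<forall>x. 0 \<le> x \<and> x < u \<longrightarrow> h x \<in> D) \<and> h u \<notin> D \<and> h u \<in> closure D"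
    if h: "path h" "pathstart h = y" "pathfinish h \<notin> D" for h
  proof -
    have "y \<in> D" using R by (simp add: D_def)
    obtain u where u: "0 \<le> u" "u \<le> 1" "\<And>x. 0 \<le> x \<and> x < u \<Longrightarrow> h x \<in> interior D"
                "(h u \<notin> interior D)" "(u = 0 \<or> h u \<in> closure D)"
      using subpath_to_frontier_explicit[OF h(1,3)] by metis
    have "interior D = D" by (simp add: D_def interior_open)
    moreover have "u \<noteq> 0" using u(4) h(2) \<open>y \<in> D\<close> \<open>interior D = D\<close> by (auto simp: pathstart_def)
    ultimately show ?thesis using u by auto
  qed
  have p1: "path (subpath ty 0 g)" and p2: "path (subpath ty 1 g)"
    using g ty by (auto intro!: path_subpath simp: arc_imp_path)
  obtain u1 where u1: "0 \<le> u1" "u1 \<le> 1" "\<And>x. 0 \<le> x \<and> x < u1 \<Longrightarrow> subpath ty 0 g x \<in> D"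
      "subpath ty 0 g u1 \<notin> D" "subpath ty 0 g u1 \<in> closure D"
    using exit[OF p1] ty g01 by (auto simp: pathstart_subpath pathfinish_subpath)
  obtain u2 where u2: "0 \<le> u2" "u2 \<le> 1" "\<And>x. 0 \<le> x \<and> x < u2 \<Longrightarrow> subpath ty 1 g x \<in> D"
      "subpath ty 1 g u2 \<notin> D" "subpath ty 1 g u2 \<in> closure D"
    using exit[OF p2] ty g01 by (auto simp: pathstart_subpath pathfinish_subpath)
  define t1 where "t1 = ty - ty * u1"
  define t2 where "t2 = ty + (1 - ty) * u2"
  have yD: "g ty \<in> D" using R ty by (simp add: D_def)
  have gt12: "g t1 \<in> sphere y R" "g t2 \<in> sphere y R"
    using u1 u2 R by (auto simp: t1_def t2_def subpath_def D_def algebra_simps)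
  have "0 \<le> ty * u1" "ty * u1 \<le> ty * 1" "0 \<le> (1 - ty) * u2" "(1 - ty) * u2 \<le> (1 - ty) * 1"
    using u1 u2 ty' by (auto simp del: mult_1_right intro!: mult_left_mono mult_nonneg_nonneg)
  then have t12: "0 \<le> t1" "t1 \<le> ty" "ty \<le> t2" "t2 \<le> 1"
    unfolding t1_def t2_def by (simp_all add: algebra_simps)
  have "t1 \<noteq> ty" "t2 \<noteq> ty"
    using gt12 R ty by auto
  then have t12': "t1 < ty" "ty < t2" using t12 by auto
  have inD: "g s \<in> D" if s: "t1 < s" "s < t2" for s
  proof (cases "s \<le> ty")
    case True
    then have "subpath ty 0 g ((ty - s) / ty) \<in> D"
      using s ty' by (intro u1(3)) (auto simp: t1_def field_simps)
    moreover have "(0 - ty) * ((ty - s) / ty) + ty = s" using ty' by (simp add: field_simps)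
    ultimately show ?thesis by (simp add: subpath_def)
  next
    case False
    then have "subpath ty 1 g ((s - ty) / (1 - ty)) \<in> D"
      using s ty' by (intro u2(3)) (auto simp: t2_def field_simps)
    moreover have "(1 - ty) * ((s - ty) / (1 - ty)) + ty = s" using ty' by (simp add: field_simps)
    ultimately show ?thesis by (simp add: subpath_def)
  qed
  have g12: "g t1 \<noteq> g t2"
    using t12 t12' by (auto dest!: inj_onD[OF inj])
  have "path_connected (sphere y R)"
    by (rule path_connected_sphere) simp
  then obtain k where k: "arc k" "path_image k \<subseteq> sphere y R" "pathstart k = g t2" "pathfinish k = g t1"
    using path_connected_arcwise gt12 g12 by metis
  define S where "S = g ` {t1..t2}"
  define s0 where "s0 = subpath t1 t2 g"
  have s0: "path_image s0 = S" "pathstart s0 = g t1" "pathfinish s0 = g t2"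
    using t12 by (auto simp: s0_def S_def path_image_subpath pathstart_subpath pathfinish_subpath)
  have "arc s0"
    unfolding s0_def using g t12 g12 by (intro arc_subpath_arc) auto
  have SQ: "S \<inter> path_image k = {g t1, g t2}"
  proof -
    have "z \<in> {g t1, g t2}" if z: "z \<in> S" "z \<in> path_image k" for z
    proof -
      obtain s where s: "z = g s" "t1 \<le> s" "s \<le> t2" using z by (auto simp: S_def)
      have "z \<notin> D" using z k by (auto simp: D_def)
      then show ?thesis using inD[of s] s by (cases "s = t1"; cases "s = t2") auto
    qed
    moreover have "g t1 \<in> S" "g t2 \<in> S" using t12 by (auto simp: S_def)
    moreover have "g t1 \<in> path_image k" "g t2 \<in> path_image k" using k by (metis pathfinish_in_path_image pathstart_in_path_image)+
    ultimately show ?thesis by blast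
  qed
  define c where "c = s0 +++ k"
  have "path_image s0 \<inter> path_image k \<subseteq> {pathstart s0, pathstart k}"
    unfolding s0 k SQ by simp
  then have "simple_path c"
    unfolding c_def by (intro simple_path_join_loop \<open>arc s0\<close> k(1)) (simp_all only: s0 k)
  moreover have "pathfinish c = pathstart c"
    unfolding c_def by (simp only: pathfinish_join pathstart_join s0 k)
  ultimately have cc: "simple_path c" "pathfinish c = pathstart c" .
  note J = plane_Jordan[OF cc]
  have ci: "path_image c = S \<union> path_image k"
    unfolding c_def using s0 k by (simp add: path_image_join)
  define C where "C = path_image c"
  \<comment> \<open>\<open>T\<close> consists of everything outside the disc and of the two
    discarded pieces of the arc. It meets the Jordan curve \<open>C\<close> exactly in the circular
    arc \<open>k\<close>, which is connected as Janiszewski requires, and avoiding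
    \<open>C \<union> T\<close> means staying in the disc and off the arc.\<close>
  define T where "T = - D \<union> g ` {0..t1} \<union> g ` {t2..1}"
  have "compact (g ` {0..t1})" "compact (g ` {t2..1})" "compact S"
    unfolding S_def using t12 t12'
    by (auto intro!: compact_continuous_image continuous_on_subset[OF cont])
  then have cT: "closed T"
    unfolding T_def D_def by (intro closed_Un closed_Compl open_ball compact_imp_closed)
  have cC: "compact C"
    unfolding C_def by (simp add: \<open>simple_path c\<close> compact_simple_path_image)
  have "C \<inter> T = path_image k"
  proof -
    have "path_image k \<subseteq> - D" using k by (auto simp: D_def)
    moreover have "S \<inter> T \<subseteq> path_image k"
    proof
      fix z assume z: "z \<in> S \<inter> T"
      then obtain s where s: "z = g s" "t1 \<le> s" "s \<le> t2" by (auto simp: S_def)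
      have "s = t1 \<or> s = t2"
      proof (rule ccontr)
        assume "\<not> ?thesis"
        then have "g s \<in> D" "t1 < s" "s < t2" using inD[of s] s by auto
        then show False using z s t12 unfolding T_def by (auto dest!: inj_onD[OF inj])
      qed
      then show "z \<in> path_image k" using s SQ by auto
    qed
    ultimately show ?thesis by (auto simp: C_def ci T_def)
  qed
  then have con: "connected (C \<inter> T)" using k by (simp add: connected_arc_image)
  have gU: "path_image g = g ` {0..t1} \<union> S \<union> g ` {t2..1}"
    unfolding path_image_def S_def image_Un[symmetric]
    using t12 t12' by (intro arg_cong[of _ _ "image g"]) auto
  have CT: "- (C \<union> T) \<subseteq> D0 - path_image g"
    using R by (auto simp: T_def C_def ci gU D_def)
  have yT: "y \<notin> T"
    using yD ty t12 t12' unfolding T_def by (auto dest!: inj_onD[OF inj])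
  then obtain r where r: "r > 0" "ball y r \<subseteq> - T"
    using open_Compl[OF cT] open_contains_ball by (metis ComplI)
  have notC: "p \<notin> C" if "p \<in> ball y r - path_image g" for p
  proof -
    have "p \<in> D" using that r(2) by (auto simp: T_def)
    then have "p \<notin> path_image k" using k by (auto simp: D_def)
    then show ?thesis using that by (auto simp: C_def ci gU)
  qed
  have join: "connected_component (D0 - path_image g) p q"
    if pq: "p \<in> ball y r - path_image g" "q \<in> ball y r - path_image g"
      and X: "connected X" "X \<subseteq> - C" "p \<in> X" "q \<in> X" for p q X
  proof -
    have "connected_component (- C) p q" using X by (auto simp: connected_component_def)
    moreover have "connected_component (- T) p q"
      unfolding connected_component_def using r pq by (intro exI[of _ "ball y r"]) auto
    ultimately have "connected_component (- (C \<union> T)) p q"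
      using cC cT con by (intro plane_Janiszewski)
    then show ?thesis
      using CT connected_component_mono by blast
  qed
  have io: "connected (inside C)" "connected (outside C)" "inside C \<subseteq> - C" "outside C \<subseteq> - C"
    using J(3,5) inside_no_overlap[of C] outside_no_overlap[of C] unfolding C_def by blast+
  have "y \<in> closure (inside C)"
    using J(7) ty t12 by (auto simp: C_def ci S_def)
  then obtain p where p: "p \<in> ball y r" "p \<in> inside C"
    using r(1) by (auto simp: closure_approachable dist_commute)
  have "p \<notin> path_image g"
    using p r(2) io(3) unfolding gU T_def C_def ci by blast
  then have "ball y r - path_image g \<noteq> {}" using p by blast
  moreover have "connected_component (D0 - path_image g) p q \<or> connected_component (D0 - path_image g) q z
       \<or> connected_component (D0 - path_image g) p z"
    if "{p, q, z} \<subseteq> ball y r - path_image g" for p q z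
  proof -
    have pqz: "p \<in> ball y r - path_image g" "q \<in> ball y r - path_image g" "z \<in> ball y r - path_image g"
      using that by auto
    then have "p \<in> inside C \<or> p \<in> outside C" "q \<in> inside C \<or> q \<in> outside C"
       "z \<in> inside C \<or> z \<in> outside C"
      using notC inside_Un_outside[of C] by blast+
    then show ?thesis
      using join[OF pqz(1,2) io(1,3)] join[OF pqz(1,2) io(2,4)] join[OF pqz(2,3) io(1,3)]
        join[OF pqz(2,3) io(2,4)] join[OF pqz(1,3) io(1,3)] join[OF pqz(1,3) io(2,4)] by argo
  qed
  moreover have "ball y r \<subseteq> D0" using r(2) R by (auto simp: T_def D_def)
  ultimately show thesis using that[OF r(1)] by blast
qed

section \<open>Edges, their ends and adjacency\<close>

locale planar_graph =
  fixes V :: "pt set" and E :: "pt set set"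
  assumes plane: "plane_graph V E"
    and conn: "graph_connected V E"
    and locfin: "locally_finite_graph E"
    and cut: "empty_cut_locus V E"
begin

abbreviation nb :: "pt \<Rightarrow> pt \<Rightarrow> bool" where "nb \<equiv> adj V E"
abbreviation d :: "pt \<Rightarrow> pt \<Rightarrow> nat" where "d \<equiv> gdist V E"

text \<open>Simplicity makes an edge unique for its two ends, so that edges can be named by pairs of
  adjacent vertices.\<close>

definition ed :: "pt \<Rightarrow> pt \<Rightarrow> pt set" where
  "ed u v = (THE e. e \<in> E \<and> e \<inter> V = {u, v})"

lemma edge_arc:
  assumes "e \<in> E"
  obtains g where "arc g" "path_image g = e" "pathstart g \<in> V" "pathfinish g \<in> V"
    "e \<inter> V = {pathstart g, pathfinish g}"
  using bspec[OF conjunct1[OF plane[unfolded plane_graph_def]] assms] by (elim exE conjE) (rule that)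

lemma edges_meet: "e \<in> E \<Longrightarrow> e' \<in> E \<Longrightarrow> e \<noteq> e' \<Longrightarrow> e \<inter> e' \<subseteq> V"
  using conjunct1[OF conjunct2[OF plane[unfolded plane_graph_def]]] by blast

lemma edge_eqI: "e \<in> E \<Longrightarrow> e' \<in> E \<Longrightarrow> e \<inter> V = e' \<inter> V \<Longrightarrow> e = e'"
  using conjunct2[OF conjunct2[OF plane[unfolded plane_graph_def]]] by simp

lemma edge_eq_if_meet: "e \<in> E \<Longrightarrow> e' \<in> E \<Longrightarrow> x \<in> e \<Longrightarrow> x \<in> e' \<Longrightarrow> x \<notin> V \<Longrightarrow> e = e'"
  using edges_meet by blast

lemma nb_sym: "nb u v \<Longrightarrow> nb v u"
  by (auto simp: adj_def insert_commute)

lemma nb_V: assumes "nb u v" shows "u \<in> V" "v \<in> V" "u \<noteq> v"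
  using assms unfolding adj_def by blast+

lemma edge_ends:
  assumes "e \<in> E"
  obtains a b where "nb a b" "e = ed a b" "e \<inter> V = {a, b}"
proof -
  obtain g where g: "arc g" "path_image g = e" "e \<inter> V = {pathstart g, pathfinish g}"
    using edge_arc[OF assms] by metis
  have "nb (pathstart g) (pathfinish g)"
    using g(3) assms arc_distinct_ends[OF g(1)] unfolding adj_def by metis
  moreover have "e = ed (pathstart g) (pathfinish g)"
    unfolding ed_def using g assms edge_eqI by (intro the_equality[symmetric]) auto
  ultimately show thesis using that g by blast
qed

lemma ed:
  assumes "nb u v" shows "ed u v \<in> E" "ed u v \<inter> V = {u, v}" "u \<in> ed u v" "v \<in> ed u v"
proof -
  obtain e where e: "e \<in> E" "e \<inter> V = {u, v}" using assms by (auto simp: adj_def)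
  have "ed u v = e"
    unfolding ed_def using e edge_eqI by (intro the_equality) auto
  then show "ed u v \<in> E" "ed u v \<inter> V = {u, v}" "u \<in> ed u v" "v \<in> ed u v" using e by auto
qed

lemma ed_sym: "ed u v = ed v u"
  by (simp add: ed_def insert_commute)

lemma edge_at:
  assumes "e \<in> E" "v \<in> e" "v \<in> V"
  obtains w where "nb v w" "e = ed v w"
proof -
  obtain a b where "nb a b" "e = ed a b" "e \<inter> V = {a, b}" using edge_ends[OF assms(1)] .
  moreover from this have "v = a \<or> v = b" using assms(2,3) by blast
  ultimately show thesis using that[of b] that[of a] nb_sym[of a b] ed_sym[of a b] by auto
qed

lemma ed_arc:
  assumes "nb u v"
  obtains g where "arc g" "path_image g = ed u v" "pathstart g = u" "pathfinish g = v"
proof -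
  obtain g where g: "arc g" "path_image g = ed u v" "{u, v} = {pathstart g, pathfinish g}"
    using edge_arc[OF ed(1)[OF assms]] ed(2)[OF assms] by metis
  show thesis
  proof (cases "pathstart g = u")
    case True
    then show ?thesis using g that[of g] by (metis doubleton_eq_iff)
  next
    case False
    then show ?thesis using g that[of "reversepath g"] by (auto simp: arc_reversepath doubleton_eq_iff)
  qed
qed

lemma ed_inj: "nb u v \<Longrightarrow> nb u w \<Longrightarrow> ed u v = ed u w \<Longrightarrow> v = w"
  by (metis doubleton_eq_iff ed(2))

subsection \<open>Distances\<close>

lemma reach: "u \<in> V \<Longrightarrow> w \<in> V \<Longrightarrow> (u, w) \<in> adjrel V E ^^ d u w"
  unfolding gdist_def by (rule LeastI_ex) (use conn in \<open>auto simp: graph_connected_def rtrancl_power\<close>)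

lemma d_le: "(u, w) \<in> adjrel V E ^^ n \<Longrightarrow> d u w \<le> n"
  unfolding gdist_def by (rule Least_le)

lemma d_self [simp]: "d u u = 0"
  using d_le[of u u 0] by auto

lemma d_eq_0: "u \<in> V \<Longrightarrow> w \<in> V \<Longrightarrow> d u w = 0 \<longleftrightarrow> u = w"
  using reach[of u w] by auto

lemma d_step: "v \<in> V \<Longrightarrow> nb u w \<Longrightarrow> d v w \<le> Suc (d v u)"
  using reach[of v u] nb_V(1)[of u w] by (intro d_le) (auto simp: adjrel_def)

lemma d_pred:
  assumes "v \<in> V" "w \<in> V" "d v w = Suc n"
  obtains u where "nb u w" "d v u = n"
proof -
  have "(v, w) \<in> adjrel V E ^^ Suc n" using reach[OF assms(1,2)] assms(3) by simp
  then obtain u where u: "(v, u) \<in> adjrel V E ^^ n" "nb u w"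
    by (auto simp: adjrel_def)
  then have "d v u \<le> n" using d_le by blast
  moreover have "Suc n \<le> Suc (d v u)" using d_step[OF assms(1) u(2)] assms(3) by simp
  ultimately show thesis using that u by simp
qed

lemma d_away:
  assumes "v0 \<in> V" "v \<in> V"
  obtains w where "nb v w" "d v0 w = Suc (d v0 v)"
proof -
  obtain w where w: "nb v w" "\<not> d v0 w \<le> d v0 v"
    using cut assms unfolding empty_cut_locus_def by blast
  then show thesis using that d_step[OF assms(1) w(1)] by fastforce
qed

text \<open>Iterates the choice of a neighbour farther from \<open>v0\<close>, which exists as the
  cut locus of \<open>v0\<close> is empty. The strictly growing distance makes the ray injective, so
  it leaves every finite set of vertices; this is how the cut locus hypothesis enters the
  topological arguments.\<close>

lemma ray:
  assumes "v0 \<in> V" "w \<in> V"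
  obtains r where "r 0 = w" "\<And>i. nb (r i) (r (Suc i))" "\<And>i. d v0 (r i) = d v0 w + i"
proof -
  define f where "f x = (SOME y. nb x y \<and> d v0 y = Suc (d v0 x))" for x
  have f: "nb x (f x) \<and> d v0 (f x) = Suc (d v0 x)" if "x \<in> V" for x
    unfolding f_def by (rule someI_ex) (use d_away[OF assms(1) that] in metis)
  have "(f ^^ i) w \<in> V \<and> d v0 ((f ^^ i) w) = d v0 w + i" for i
  proof (induction i)
    case (Suc i)
    then show ?case using f[of "(f ^^ i) w"] nb_V(2) by auto
  qed (simp add: assms)
  then show thesis using f by (intro that[of "\<lambda>i. (f ^^ i) w"]) auto
qed

lemma vertex_has_nb: "v \<in> V \<Longrightarrow> \<exists>w. nb v w"
  using d_away by metis

subsection \<open>Local finiteness\<close>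

lemma edge_topology: assumes "e \<in> E" shows "compact e" "closed e" "connected e"
  using edge_arc[OF assms] by (metis compact_arc_image closed_arc_image connected_arc_image)+

lemma finite_edges_compact:
  assumes "compact K" shows "finite {e \<in> E. e \<inter> K \<noteq> {}}"
proof -
  obtain N where N: "\<And>x. open (N x) \<and> x \<in> N x \<and> finite {e \<in> E. e \<inter> N x \<noteq> {}}"
    using choice[OF locfin[unfolded locally_finite_graph_def]] by blast
  have "open (N x)" for x using N by blast
  moreover have "K \<subseteq> (\<Union>x\<in>K. N x)" using N by blast
  ultimately obtain C' where C': "C' \<subseteq> K" "finite C'" "K \<subseteq> (\<Union>x\<in>C'. N x)"
    using compactE_image[OF assms, of K N] by metis
  have "{e \<in> E. e \<inter> K \<noteq> {}} \<subseteq> (\<Union>x\<in>C'. {e \<in> E. e \<inter> N x \<noteq> {}})"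
  proof
    fix e assume e: "e \<in> {e \<in> E. e \<inter> K \<noteq> {}}"
    then obtain x where "x \<in> e" "x \<in> K" by auto
    moreover from this obtain c where "c \<in> C'" "x \<in> N c" using C'(3) by auto
    ultimately show "e \<in> (\<Union>x\<in>C'. {e \<in> E. e \<inter> N x \<noteq> {}})" using e by auto
  qed
  moreover have "finite (\<Union>x\<in>C'. {e \<in> E. e \<inter> N x \<noteq> {}})"
    using C'(2) N by simp
  ultimately show ?thesis by (rule finite_subset)
qed

text \<open>Near any point only finitely many of the compact edges matter. Closedness of an
  arbitrary set of edges makes the complementary components open and puts their frontiers on the
  edges.\<close>

lemma closed_Union_edges:
  assumes "F \<subseteq> E" shows "closed (\<Union>F)"
proof -
  have "\<exists>T. open T \<and> x \<in> T \<and> T \<subseteq> - \<Union>F" if "x \<notin> \<Union>F" for x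
  proof -
    obtain N where N: "open N" "x \<in> N" "finite {e \<in> E. e \<inter> N \<noteq> {}}"
      using spec[OF locfin[unfolded locally_finite_graph_def]] by blast
    let ?G = "{e \<in> F. e \<inter> N \<noteq> {}}"
    have "finite ?G" using N(3) assms by (auto elim: finite_subset[rotated])
    then have "closed (\<Union>?G)" using assms edge_topology by (intro closed_Union) auto
    then have "open (N - \<Union>?G)" using N by blast
    then show ?thesis using N that by (intro exI[of _ "N - \<Union>?G"]) auto
  qed
  then show ?thesis unfolding closed_def by (subst open_subopen) auto
qed

lemma V_subset: "V \<subseteq> \<Union>E"
  using vertex_has_nb ed by blast

lemma finite_V_bounded: assumes "bounded K" shows "finite (V \<inter> K)"
proof -
  let ?F = "{e \<in> E. e \<inter> closure K \<noteq> {}}"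
  have "finite ?F" using finite_edges_compact assms compact_closure by blast
  moreover have "finite (e \<inter> V)" if "e \<in> E" for e
    using edge_ends[OF that] by (metis finite.emptyI finite_insert)
  ultimately have "finite (\<Union>e\<in>?F. e \<inter> V)" by blast
  moreover have "V \<inter> K \<subseteq> (\<Union>e\<in>?F. e \<inter> V)"
    using V_subset closure_subset[of K] by blast
  ultimately show ?thesis by (rule finite_subset[rotated])
qed

lemma finite_edges_at: "finite {e \<in> E. v \<in> e}"
  using finite_edges_compact[of "{v}"] by simp

lemma edge_nbhd:
  assumes "e \<in> E" "y \<in> e" "y \<notin> V"
  obtains r where "r > 0" "ball y r \<inter> \<Union>E \<subseteq> e" "ball y r \<inter> V = {}"
proof -
  have "open (- \<Union>(E - {e}))" using closed_Union_edges[of "E - {e}"] by blast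
  moreover have "y \<in> - \<Union>(E - {e})" using assms edge_eq_if_meet by blast
  moreover have "finite (e \<inter> V)" using edge_ends[OF assms(1)] by (metis finite.emptyI finite_insert)
  ultimately have "open (- \<Union>(E - {e}) - (e \<inter> V))" "y \<in> - \<Union>(E - {e}) - (e \<inter> V)"
    using assms by (auto intro: open_Diff finite_imp_closed)
  then obtain r where "r > 0" "ball y r \<subseteq> - \<Union>(E - {e}) - (e \<inter> V)"
    using open_contains_ball by meson
  then show thesis using that[of r] V_subset by blast
qed

lemma vertex_nbhd:
  assumes "v \<in> V"
  obtains r where "r > 0" "ball v r \<inter> V = {v}" "\<And>e. e \<in> E \<Longrightarrow> e \<inter> ball v r \<noteq> {} \<Longrightarrow> v \<in> e"
proof -
  have "closed (\<Union>{e \<in> E. v \<notin> e})" by (rule closed_Union_edges) blast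
  moreover have "finite (V \<inter> ball v 1 - {v})" using finite_V_bounded by blast
  ultimately have "open (ball v 1 - \<Union>{e \<in> E. v \<notin> e} - (V \<inter> ball v 1 - {v}))"
     "v \<in> ball v 1 - \<Union>{e \<in> E. v \<notin> e} - (V \<inter> ball v 1 - {v})"
    by (auto intro!: open_Diff finite_imp_closed)
  then obtain r where r: "r > 0" "ball v r \<subseteq> ball v 1 - \<Union>{e \<in> E. v \<notin> e} - (V \<inter> ball v 1 - {v})"
    using open_contains_ball by meson
  show thesis
  proof (rule that[OF r(1)])
    have "v \<in> ball v r" using r(1) by simp
    then show "ball v r \<inter> V = {v}" using r(2) assms by blast
    show "v \<in> e" if "e \<in> E" "e \<inter> ball v r \<noteq> {}" for e using r(2) that by blast
  qed
qed

lemma edge_parts: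
  assumes "nb u v"
  shows "connected (ed u v - {v})" "connected (ed u v - {u, v})" "ed u v \<subseteq> closure (ed u v - {u, v})"
    "ed u v - {u, v} \<noteq> {}"
proof -
  obtain g where g: "arc g" "path_image g = ed u v" "pathstart g = u" "pathfinish g = v"
    using ed_arc[OF assms] .
  have inj: "inj_on g {0..1}" and cont: "continuous_on {0..1} g"
    using g by (auto simp: arc_def path_def)
  have e: "ed u v = g ` {0..1}" "u = g 0" "v = g 1"
    using g by (auto simp: path_image_def pathstart_def pathfinish_def)
  have img: "g ` {0..1} - g ` B = g ` ({0..1} - B)" if "B \<subseteq> {0..1}" for B
    using inj_on_image_set_diff[OF inj, of "{0..1}" B] that by auto
  have "{0..1} - {1} = {0..<1::real}" by auto
  then have 1: "ed u v - {v} = g ` {0..<1}"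
    using img[of "{1}"] e by simp
  show "connected (ed u v - {v})"
    unfolding 1 by (auto intro!: connected_continuous_image continuous_on_subset[OF cont])
  have "{0..1} - {0, 1} = {0<..<1::real}" by auto
  then have 2: "ed u v - {u, v} = g ` {0<..<1}"
    using img[of "{0, 1}"] e by simp
  show "connected (ed u v - {u, v})" "ed u v - {u, v} \<noteq> {}"
    unfolding 2 by (auto intro!: connected_continuous_image continuous_on_subset[OF cont])
  have "continuous_on (closure {0<..<1}) g" using cont by simp
  then have "g ` closure {0<..<1} \<subseteq> closure (g ` {0<..<1})"
    by (rule image_closure_subset) (auto intro: closure_subset[THEN subsetD])
  then show "ed u v \<subseteq> closure (ed u v - {u, v})"
    unfolding 2 using e(1) by simp
qed

lemma ed_interior_not_V: "nb u v \<Longrightarrow> x \<in> ed u v - {u, v} \<Longrightarrow> x \<notin> V"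
  using ed(2) by blast

end

text \<open>Whenever the next vertex already occurs, the path is cut back to that occurrence. The
  final clause keeps the path within whatever set the relation cannot leave.\<close>

lemma rtrancl_distinct_path:
  assumes "(x, y) \<in> R\<^sup>*"
  obtains ps where "ps \<noteq> []" "hd ps = x" "last ps = y" "distinct ps"
    "successively (\<lambda>u v. (u, v) \<in> R) ps" "\<And>z. z \<in> set ps \<Longrightarrow> (x, z) \<in> R\<^sup>*"
proof -
  have "\<exists>ps. ps \<noteq> [] \<and> hd ps = x \<and> last ps = y \<and> distinct ps \<and>
    successively (\<lambda>u v. (u, v) \<in> R) ps \<and> (\<forall>z\<in>set ps. (x, z) \<in> R\<^sup>*)"
    using assms
  proof (induction rule: rtrancl_induct)
    case base
    show ?case by (rule exI[of _ "[x]"]) simp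
  next
    case (step y z)
    then obtain ps where ps: "ps \<noteq> []" "hd ps = x" "last ps = y" "distinct ps"
      "successively (\<lambda>u v. (u, v) \<in> R) ps" "\<forall>z\<in>set ps. (x, z) \<in> R\<^sup>*" by blast
    show ?case
    proof (cases "z \<in> set ps")
      case True
      then obtain as bs where as: "ps = as @ z # bs" by (meson split_list)
      then show ?thesis
        using ps by (intro exI[of _ "as @ [z]"]) (auto simp: successively_append_iff hd_append)
    next
      case False
      then show ?thesis
        using ps step.hyps
        by (intro exI[of _ "ps @ [z]"]) (auto simp: successively_append_iff)
    qed
  qed
  then show thesis using that by blast
qed

context planar_graph
begin

lemmas walk_simps = successively_append_iff successively_Cons hd_append

subsection \<open>Paths and cycles\<close>

fun pedges :: "pt list \<Rightarrow> pt set set" where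
  "pedges (x # y # r) = insert (ed x y) (pedges (y # r))"
| "pedges _ = {}"

definition pimg :: "pt list \<Rightarrow> pt set" where
  "pimg vs = set vs \<union> \<Union>(pedges vs)"

abbreviation walk :: "pt list \<Rightarrow> bool" where "walk \<equiv> successively nb"

lemma pedges_append: "pedges (xs @ x # ys) = pedges (xs @ [x]) \<union> pedges (x # ys)"
  by (induction xs rule: induct_list012) auto

lemma pedges_rev: "pedges (rev vs) = pedges vs"
proof (induction vs rule: induct_list012)
  case (3 x y zs)
  have "pedges (rev (x # y # zs)) = pedges (rev zs @ [y]) \<union> pedges [y, x]"
    using pedges_append[of "rev zs" y "[x]"] by simp
  then show ?case using 3 ed_sym[of x y] by auto
qed auto

lemma pedges_E: "walk vs \<Longrightarrow> pedges vs \<subseteq> E"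
  by (induction vs rule: induct_list012) (auto simp: ed)

lemma pedges_ends: "walk vs \<Longrightarrow> e \<in> pedges vs \<Longrightarrow> e \<inter> V \<subseteq> set vs"
proof (induction vs rule: induct_list012)
  case (3 x y zs)
  then show ?case using ed(2)[of x y] by auto
qed auto

lemma pedges_hd:
  assumes "distinct (x # y # r)" "walk (x # y # r)" "e \<in> pedges (x # y # r)" "x \<in> e"
  shows "e = ed x y"
proof (rule ccontr)
  assume "e \<noteq> ed x y"
  then have "e \<in> pedges (y # r)" using assms by auto
  moreover have "x \<in> V" using assms(2) nb_V(1)[of x y] by simp
  ultimately have "x \<in> set (y # r)" using pedges_ends[of "y # r" e] assms by auto
  then show False using assms by simp
qed

text \<open>The only edge of a simple path at its start is the first one. Hence two paths between
  the same ends can share the edge joining these ends only if both consist of it.\<close>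

lemma pedges_short:
  assumes "distinct (x # zs @ [y])" "walk (x # zs @ [y])" "ed x y \<in> pedges (x # zs @ [y])" "nb x y"
  shows "zs = []"
proof (rule ccontr)
  assume "zs \<noteq> []"
  then obtain w r where zs: "zs = w # r" by (cases zs) auto
  then have "ed x y = ed x w"
    using pedges_hd[of x w "r @ [y]" "ed x y"] assms ed(3) by auto
  then have "y = w" using ed_inj[of x y w] assms zs by auto
  then show False using assms zs by auto
qed

lemma walk_V: "walk vs \<Longrightarrow> length vs \<ge> 2 \<Longrightarrow> set vs \<subseteq> V"
proof (induction vs rule: induct_list012)
  case (3 x y zs)
  then show ?case using nb_V[of x y] by (cases zs) auto
qed auto

lemma set_subset_pedges: "walk vs \<Longrightarrow> length vs \<ge> 2 \<Longrightarrow> set vs \<subseteq> \<Union>(pedges vs)"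
proof (induction vs rule: induct_list012)
  case (3 x y zs)
  then show ?case using ed[of x y] by (cases zs) auto
qed auto

lemma pimg_V: "walk vs \<Longrightarrow> set vs \<subseteq> V \<Longrightarrow> pimg vs \<inter> V = set vs"
  unfolding pimg_def using pedges_ends by blast

lemma pimg_eq: "walk vs \<Longrightarrow> length vs \<ge> 2 \<Longrightarrow> pimg vs = \<Union>(pedges vs)"
  unfolding pimg_def using set_subset_pedges by blast

text \<open>A common point that is not a vertex would lie on an edge of each path, and these edges
  would have to coincide.\<close>

lemma pimg_Int:
  assumes "walk xs" "walk ys" "set xs \<subseteq> V" "set ys \<subseteq> V" "pedges xs \<inter> pedges ys = {}"
  shows "pimg xs \<inter> pimg ys = set xs \<inter> set ys"
proof -
  have "z \<in> set xs \<inter> set ys" if z: "z \<in> pimg xs" "z \<in> pimg ys" for z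
  proof (cases "z \<in> V")
    case True
    then show ?thesis using pimg_V assms z by blast
  next
    case False
    then obtain e e' where "e \<in> pedges xs" "z \<in> e" "e' \<in> pedges ys" "z \<in> e'"
      using z assms(3,4) unfolding pimg_def by blast
    then show ?thesis
      using edge_eq_if_meet[of e e' z] False pedges_E assms by blast
  qed
  then show ?thesis unfolding pimg_def by blast
qed

lemma pimg_arc:
  assumes "distinct vs" "walk vs" "length vs \<ge> 2"
  obtains g where "arc g" "path_image g = pimg vs" "pathstart g = hd vs" "pathfinish g = last vs"
proof -
  have "\<exists>g. arc g \<and> path_image g = pimg vs \<and> pathstart g = hd vs \<and> pathfinish g = last vs"
    using assms
  proof (induction vs rule: induct_list012)
    case (3 x y zs)
    have nb: "nb x y" using 3 by simp
    obtain g where g: "arc g" "path_image g = ed x y" "pathstart g = x" "pathfinish g = y"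
      using ed_arc[OF nb] .
    show ?case
    proof (cases "zs = []")
      case True
      then show ?thesis using g ed[OF nb] by (intro exI[of _ g]) (auto simp: pimg_def)
    next
      case False
      obtain h where h: "arc h" "path_image h = pimg (y # zs)" "pathstart h = y" "pathfinish h = last (y # zs)"
        using 3 False by (cases zs) auto
      have "ed x y \<notin> pedges (y # zs)"
        using pedges_ends[of "y # zs" "ed x y"] 3 ed[OF nb] by auto
      then have "pimg [x, y] \<inter> pimg (y # zs) = set [x, y] \<inter> set (y # zs)"
        using 3 False walk_V[of "x # y # zs"] by (intro pimg_Int) auto
      moreover have "pimg [x, y] = ed x y"
        using ed[OF nb] by (auto simp: pimg_def)
      ultimately have int: "ed x y \<inter> pimg (y # zs) \<subseteq> {y}" using 3 by auto
      have "pimg (x # y # zs) = ed x y \<union> pimg (y # zs)"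
        using ed[OF nb] by (auto simp: pimg_def)
      moreover have "arc (g +++ h)"
        using g h int by (intro arc_join) simp_all
      ultimately show ?thesis
        using g h by (intro exI[of _ "g +++ h"]) (simp add: path_image_join)
    qed
  qed auto
  then show thesis using that by blast
qed

text \<open>The closing vertex is not repeated in the list; length at least 3 excludes running back
  and forth along one edge.\<close>

definition cyc :: "pt list \<Rightarrow> bool" where
  "cyc vs \<longleftrightarrow> distinct vs \<and> length vs \<ge> 3 \<and> walk (vs @ [hd vs])"

definition cedges :: "pt list \<Rightarrow> pt set set" where
  "cedges vs = pedges (vs @ [hd vs])"

definition cimg :: "pt list \<Rightarrow> pt set" where
  "cimg vs = \<Union>(cedges vs)"

text \<open>A shared edge would have both ends in \<open>{c, c'}\<close>, so by
  \<open>pedges_short\<close> both halves would be this single edge, leaving only two vertices on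
  the cycle.\<close>

lemma cyc_split_disjoint:
  assumes "cyc (c # xs @ c' # ys)"
  shows "pedges (c # xs @ [c']) \<inter> pedges (c' # ys @ [c]) = {}"
proof (rule ccontr)
  assume "\<not> ?thesis"
  then obtain e where e: "e \<in> pedges (c # xs @ [c'])" "e \<in> pedges (c' # ys @ [c])" by blast
  have w: "walk (c # xs @ [c'])" "walk (c' # ys @ [c])" "distinct (c # xs @ c' # ys)"
    "length (xs @ ys) \<ge> 1"
    using assms by (auto simp: cyc_def walk_simps)
  have "e \<inter> V \<subseteq> set (c # xs @ [c']) \<inter> set (c' # ys @ [c])"
    using pedges_ends[OF w(1) e(1)] pedges_ends[OF w(2) e(2)] by blast
  also have "\<dots> = {c, c'}" using w by auto
  finally have sub: "e \<inter> V \<subseteq> {c, c'}" .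
  have "e \<in> E" using pedges_E[OF w(1)] e by blast
  then obtain a b where ab: "nb a b" "e = ed a b" "e \<inter> V = {a, b}" by (rule edge_ends)
  then have "a \<noteq> b" "{a, b} \<subseteq> {c, c'}" using sub nb_V by auto
  then have "a = c \<and> b = c' \<or> a = c' \<and> b = c" by auto
  then have e': "nb c c'" "e = ed c c'" "e = ed c' c" "nb c' c"
    using ab nb_sym[of a b] ed_sym[of a b] by auto
  have "xs = []" using pedges_short[of c xs c'] w e e' by auto
  moreover have "ys = []" using pedges_short[of c' ys c] w e e' by auto
  ultimately show False using w by simp
qed

lemma curve_of_two_paths:
  assumes "distinct (c # xs @ [c'])" "walk (c # xs @ [c'])"
    "distinct (c' # ys @ [c])" "walk (c' # ys @ [c])"
    "pedges (c # xs @ [c']) \<inter> pedges (c' # ys @ [c]) = {}" "set xs \<inter> set ys = {}"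
  obtains g where "simple_path g" "pathfinish g = pathstart g"
    "path_image g = pimg (c # xs @ [c']) \<union> pimg (c' # ys @ [c])"
proof -
  obtain g where g: "arc g" "path_image g = pimg (c # xs @ [c'])" "pathstart g = c" "pathfinish g = c'"
    using pimg_arc[of "c # xs @ [c']"] assms by auto
  obtain h where h: "arc h" "path_image h = pimg (c' # ys @ [c])" "pathstart h = c'" "pathfinish h = c"
    using pimg_arc[of "c' # ys @ [c]"] assms by auto
  have "pimg (c # xs @ [c']) \<inter> pimg (c' # ys @ [c]) = set (c # xs @ [c']) \<inter> set (c' # ys @ [c])"
    using assms walk_V[of "c # xs @ [c']"] walk_V[of "c' # ys @ [c]"] by (intro pimg_Int) auto
  also have "\<dots> = {c, c'}" using assms by auto
  finally have "path_image g \<inter> path_image h \<subseteq> {pathstart g, pathstart h}" using g h by auto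
  then have "simple_path (g +++ h)" using g h by (intro simple_path_join_loop) simp_all
  then show thesis using that[of "g +++ h"] g h by (simp add: path_image_join)
qed

lemma cyc_walk: "cyc vs \<Longrightarrow> walk (vs @ [hd vs])"
  and cyc_V: "cyc vs \<Longrightarrow> set vs \<subseteq> V"
  and cyc_ne: "cyc vs \<Longrightarrow> vs \<noteq> []"
  using walk_V[of "vs @ [hd vs]"] by (auto simp: cyc_def)

lemma cimg_eq: "cyc vs \<Longrightarrow> cimg vs = pimg (vs @ [hd vs])"
  unfolding cimg_def cedges_def by (rule pimg_eq[symmetric]) (auto simp: cyc_def)

lemma cedges_E: "cyc vs \<Longrightarrow> cedges vs \<subseteq> E"
  unfolding cedges_def using pedges_E cyc_walk by blast

lemma cimg_E: "cyc vs \<Longrightarrow> cimg vs \<subseteq> \<Union>E"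
  unfolding cimg_def using cedges_E by blast

lemma cimg_V: "cyc vs \<Longrightarrow> cimg vs \<inter> V = set vs"
proof -
  assume cy: "cyc vs"
  then have "set (vs @ [hd vs]) = set vs" using cyc_ne[of vs] by (cases vs) auto
  then show ?thesis
    using pimg_V[OF cyc_walk[OF cy]] cyc_V[OF cy] cimg_eq[OF cy] by simp
qed

lemma cedges_split: "cedges (c # xs @ c' # ys) = pedges (c # xs @ [c']) \<union> pedges (c' # ys @ [c])"
  unfolding cedges_def using pedges_append[of "c # xs" c' "ys @ [c]"] by simp

lemma cyc_curve:
  assumes "cyc vs"
  obtains g where "simple_path g" "pathfinish g = pathstart g" "path_image g = cimg vs"
proof -
  have l: "length vs \<ge> 3" using assms by (simp add: cyc_def)
  then obtain c ws where vs: "vs = c # ws" "ws \<noteq> []" by (cases vs) fastforce+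
  then obtain xs c' where ws: "ws = xs @ [c']" by (meson rev_exhaust)
  have cy: "cyc (c # xs @ c' # [])" using assms vs ws by simp
  have "pedges (c # xs @ [c']) \<inter> pedges (c' # [] @ [c]) = {}"
    using cyc_split_disjoint[OF cy] by simp
  moreover have w: "distinct (c # xs @ [c'])" "walk (c # xs @ [c'])"
    "distinct (c' # [] @ [c])" "walk (c' # [] @ [c])"
    using cy by (auto simp: cyc_def walk_simps)
  ultimately obtain g where g: "simple_path g" "pathfinish g = pathstart g"
      "path_image g = pimg (c # xs @ [c']) \<union> pimg (c' # [] @ [c])"
    using curve_of_two_paths[of c xs c' "[]"] by auto
  have "cimg vs = \<Union>(pedges (c # xs @ [c'])) \<union> \<Union>(pedges (c' # [] @ [c]))"
    unfolding cimg_def vs ws using cedges_split[of c xs c' "[]"] by auto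
  also have "\<dots> = pimg (c # xs @ [c']) \<union> pimg (c' # [] @ [c])"
    using pimg_eq[OF w(2)] pimg_eq[OF w(4)] by simp
  finally show thesis using that g by simp
qed

lemma cyc_Jordan:
  assumes "cyc vs"
  shows "inside (cimg vs) \<noteq> {}" "open (inside (cimg vs))" "connected (inside (cimg vs))"
    "connected (outside (cimg vs))" "open (outside (cimg vs))" "bounded (inside (cimg vs))"
    "closure (inside (cimg vs)) = inside (cimg vs) \<union> cimg vs"
    "cimg vs \<subseteq> closure (outside (cimg vs))" "compact (cimg vs)"
proof -
  obtain g where g: "simple_path g" "pathfinish g = pathstart g" "path_image g = cimg vs"
    using cyc_curve[OF assms] .
  show "inside (cimg vs) \<noteq> {}" "open (inside (cimg vs))" "connected (inside (cimg vs))"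
    "connected (outside (cimg vs))" "open (outside (cimg vs))" "bounded (inside (cimg vs))"
    "closure (inside (cimg vs)) = inside (cimg vs) \<union> cimg vs"
    "cimg vs \<subseteq> closure (outside (cimg vs))"
    using plane_Jordan[OF g(1,2)] unfolding g(3) by blast+
  show "compact (cimg vs)" using g(1,3) compact_simple_path_image by metis
qed

lemma connected_meets_inside:
  assumes "cyc vs" "connected X" "X \<inter> cimg vs = {}" "X \<inter> inside (cimg vs) \<noteq> {}"
  shows "X \<subseteq> inside (cimg vs)"
proof -
  have "X \<subseteq> inside (cimg vs) \<union> outside (cimg vs)"
    using assms(3) inside_Un_outside[of "cimg vs"] by blast
  moreover have "inside (cimg vs) \<inter> outside (cimg vs) \<inter> X = {}"
    using inside_Int_outside[of "cimg vs"] by blast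
  ultimately have "inside (cimg vs) \<inter> X = {} \<or> outside (cimg vs) \<inter> X = {}"
    using connectedD[OF assms(2) cyc_Jordan(2,5)[OF assms(1)]] by blast
  then show ?thesis using assms(4) \<open>X \<subseteq> inside (cimg vs) \<union> outside (cimg vs)\<close> by blast
qed

lemma cyc_rotate:
  assumes "cyc vs" "c \<in> set vs"
  obtains ws where "cyc (c # ws)" "set (c # ws) = set vs" "cedges (c # ws) = cedges vs"
    "length (c # ws) = length vs"
proof -
  obtain xs ys where vs: "vs = xs @ c # ys" using assms(2) by (meson split_list)
  show thesis
  proof (cases xs)
    case Nil
    then show ?thesis using that vs assms by simp
  next
    case (Cons x zs)
    have "cedges (c # ys @ x # zs) = cedges vs"
      using cedges_split[of c ys x zs] cedges_split[of x zs c ys] vs Cons by auto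
    moreover have "cyc (c # ys @ x # zs)"
      using assms(1) vs Cons by (auto simp: cyc_def walk_simps)
    ultimately show ?thesis using that[of "ys @ x # zs"] vs Cons by auto
  qed
qed

text \<open>The edge without its ends is connected and disjoint from the cycle, hence entirely
  inside; its ends are limits of inside points and so lie inside or on the cycle.\<close>

lemma edge_meets_inside:
  assumes "cyc vs" "e \<in> E" "e \<inter> inside (cimg vs) \<noteq> {}"
  shows "e \<inter> V \<subseteq> inside (cimg vs) \<union> set vs" "e - V \<subseteq> inside (cimg vs)" "e \<notin> cedges vs"
proof -
  show notin: "e \<notin> cedges vs"
    using assms(3) inside_no_overlap[of "cimg vs"] unfolding cimg_def by blast
  obtain a b where ab: "nb a b" "e = ed a b" "e \<inter> V = {a, b}" using edge_ends[OF assms(2)] .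
  have dis: "(e - {a, b}) \<inter> cimg vs = {}"
  proof -
    have "x \<notin> cimg vs" if "x \<in> e - {a, b}" for x
    proof
      assume "x \<in> cimg vs"
      then obtain e' where "e' \<in> cedges vs" "x \<in> e'" by (auto simp: cimg_def)
      moreover have "x \<notin> V" using that ab by blast
      ultimately show False
        using edge_eq_if_meet[of e e' x] that notin assms cedges_E by blast
    qed
    then show ?thesis by blast
  qed
  obtain z where z: "z \<in> e" "z \<in> inside (cimg vs)" using assms(3) by blast
  have "z \<in> closure (e - {a, b})" using edge_parts(3)[OF ab(1)] ab z by blast
  then have "inside (cimg vs) \<inter> (e - {a, b}) \<noteq> {}"
    using z cyc_Jordan(2)[OF assms(1)] open_Int_closure_eq_empty by blast
  then have sub: "e - {a, b} \<subseteq> inside (cimg vs)"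
    using connected_meets_inside[OF assms(1) _ dis] edge_parts(2)[OF ab(1)] ab by blast
  then show "e - V \<subseteq> inside (cimg vs)" using ab by blast
  have "e \<subseteq> closure (inside (cimg vs))"
    using edge_parts(3)[OF ab(1)] ab closure_mono[OF sub] by blast
  then show "e \<inter> V \<subseteq> inside (cimg vs) \<union> set vs"
    using cyc_Jordan(7)[OF assms(1)] cimg_V[OF assms(1)] by blast
qed

text \<open>A cut vertex cannot hide a finite piece of the graph: walking away from it leads to infinitely
  many vertices. So whatever part of the graph lies inside a cycle is attached to the cycle at two
  different vertices, which yields a path across the inside.\<close>

lemma path_across_inside:
  assumes cy: "cyc vs" and e: "e \<in> E" "e \<inter> inside (cimg vs) \<noteq> {}"
  obtains c c' ps where "c \<in> set vs" "c' \<in> set vs" "walk (c # ps @ [c'])" "distinct (c # ps @ [c'])"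
    "set ps \<subseteq> inside (cimg vs)" "\<exists>e\<in>pedges (c # ps @ [c']). e \<inter> inside (cimg vs) \<noteq> {}"
proof -
  define I where "I = inside (cimg vs) \<inter> V"
  have Idis: "I \<inter> set vs = {}"
    using cimg_V[OF cy] inside_no_overlap[of "cimg vs"] unfolding I_def by blast
  have step: "w \<in> I \<union> set vs" if "nb u w" "u \<in> I" for u w
  proof -
    have "ed u w \<inter> inside (cimg vs) \<noteq> {}" using ed(3)[OF that(1)] that(2) unfolding I_def by blast
    then show ?thesis
      using edge_meets_inside(1)[OF cy ed(1)[OF that(1)]] ed(2)[OF that(1)] nb_V[OF that(1)]
      unfolding I_def by blast
  qed
  obtain a b where ab: "nb a b" "e = ed a b" "e \<inter> V = {a, b}" using edge_ends[OF e(1)] .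
  show thesis
  proof (cases "a \<in> set vs \<and> b \<in> set vs")
    case True
    then show ?thesis using that[of a b "[]"] ab e nb_V[OF ab(1)] by auto
  next
    case False
    moreover have "a \<in> I \<union> set vs" "b \<in> I \<union> set vs"
      using edge_meets_inside(1)[OF cy e] ab(3) unfolding I_def by auto
    ultimately obtain u where u: "u \<in> I" by auto
    define R where "R = {(x, y). nb x y \<and> x \<in> I \<and> y \<in> I}"
    have RI: "y \<in> I" if "(x, y) \<in> R\<^sup>*" "x \<in> I" for x y
      using that by (induction rule: rtrancl_induct) (auto simp: R_def)
    have exit: "\<exists>x y. (u, x) \<in> R\<^sup>* \<and> nb x y \<and> y \<in> set vs"
      if "(u, z) \<in> (adjrel V E)\<^sup>*" "u \<in> I" "z \<notin> I" for u z
      using that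
    proof (induction rule: converse_rtrancl_induct)
      case (step p q)
      have pq: "nb p q" using step by (simp add: adjrel_def)
      show ?case
      proof (cases "q \<in> I")
        case True
        then obtain x y where "(q, x) \<in> R\<^sup>*" "nb x y" "y \<in> set vs" using step by blast
        moreover have "(p, q) \<in> R" using pq step True by (simp add: R_def)
        ultimately show ?thesis by (meson converse_rtrancl_into_rtrancl)
      next
        case False
        then have "q \<in> set vs" using \<open>\<And>w u. nb u w \<Longrightarrow> u \<in> I \<Longrightarrow> w \<in> I \<union> set vs\<close>[OF pq] step by blast
        then show ?thesis using pq by blast
      qed
    qed simp
    obtain c0 where c0: "c0 \<in> set vs" using cyc_ne[OF cy] by (cases vs) auto
    then have "c0 \<in> V" "c0 \<notin> I" using cyc_V[OF cy] Idis by auto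
    moreover have "u \<in> V" using u by (simp add: I_def)
    ultimately have "(u, c0) \<in> (adjrel V E)\<^sup>*" using conn by (simp add: graph_connected_def)
    then obtain x1 c where x1: "(u, x1) \<in> R\<^sup>*" "nb x1 c" "c \<in> set vs"
      using exit u \<open>c0 \<notin> I\<close> by blast
    have "c \<in> V" using x1 nb_V by blast
    \<comment> \<open>Choosing the base point of the ray to be \<open>c\<close>, the attachment
      vertex already found, is the crux: the ray leaves the finite set \<open>I\<close> through a
      vertex of the cycle at positive distance from \<open>c\<close>, which is therefore a second
      attachment vertex.\<close>
    obtain r where r: "r 0 = u" "\<And>i. nb (r i) (r (Suc i))" "\<And>i. d c (r i) = d c u + i"
      using ray[OF \<open>c \<in> V\<close> \<open>u \<in> V\<close>] by metis
    have "inj r" by (rule injI) (metis add_left_cancel r(3))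
    moreover have "finite I"
      using finite_V_bounded[OF cyc_Jordan(6)[OF cy]] by (simp add: I_def Int_commute)
    ultimately have "\<exists>i. r i \<notin> I"
      by (metis finite_subset image_subsetI range_inj_infinite)
    define k where "k = (LEAST i. r i \<notin> I)"
    have rk: "r k \<notin> I" unfolding k_def using \<open>\<exists>i. r i \<notin> I\<close> by (rule LeastI_ex)
    have rlt: "r j \<in> I" if "j < k" for j using that not_less_Least unfolding k_def by blast
    have "k \<noteq> 0" using rk r(1) u by (metis)
    then obtain m where m: "k = Suc m" by (cases k) auto
    have "(u, r j) \<in> R\<^sup>*" if "j < k" for j
      using that
    proof (induction j)
      case (Suc j)
      then have "(r j, r (Suc j)) \<in> R" using rlt r(2) by (simp add: R_def)
      then show ?case using Suc by (meson Suc_lessD rtrancl.rtrancl_into_rtrancl)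
    qed (simp add: r)
    then have x2: "(u, r m) \<in> R\<^sup>*" using m by simp
    have "r k \<in> set vs" using step[of "r m" "r k"] r(2)[of m] rlt[of m] m rk by auto
    have "d c (r k) > 0" using r(3)[of k] m by simp
    then have "c \<noteq> r k" using d_self by (metis less_irrefl)
    have "sym R" unfolding R_def sym_def using nb_sym by blast
    then have "(x1, u) \<in> R\<^sup>*" using x1(1) by (meson sym_rtrancl symD)
    then have "(x1, r m) \<in> R\<^sup>*" using x2 by simp
    then obtain ps where ps: "ps \<noteq> []" "hd ps = x1" "last ps = r m" "distinct ps"
      "successively (\<lambda>u v. (u, v) \<in> R) ps" "\<And>z. z \<in> set ps \<Longrightarrow> (x1, z) \<in> R\<^sup>*"
      by (rule rtrancl_distinct_path) blast
    have "x1 \<in> I" using RI x1(1) u by blast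
    then have psI: "set ps \<subseteq> I" using ps(6) RI by blast
    have "walk ps" using ps(5) by (rule successively_mono) (simp add: R_def)
    then have w: "walk (c # ps @ [r k])"
      using ps nb_sym[OF x1(2)] r(2)[of m] m by (auto simp: walk_simps)
    have dist: "distinct (c # ps @ [r k])"
      using ps(4) psI Idis x1(3) \<open>r k \<in> set vs\<close> \<open>c \<noteq> r k\<close> by auto
    obtain qs where "ps = x1 # qs" using ps by (cases ps) auto
    then have "ed c x1 \<in> pedges (c # ps @ [r k])" by simp
    moreover have "x1 \<in> ed c x1" using ed(4)[OF nb_sym[OF x1(2)]] .
    ultimately have "\<exists>e\<in>pedges (c # ps @ [r k]). e \<inter> inside (cimg vs) \<noteq> {}"
      using \<open>x1 \<in> I\<close> unfolding I_def by blast
    then show ?thesis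
      using that[OF x1(3) \<open>r k \<in> set vs\<close> w dist] psI unfolding I_def by blast
  qed
qed

section \<open>Shrinking a cycle to the boundary of a face\<close>

text \<open>The path across the inside forms a theta curve with the cycle, and the connected set
  \<open>U\<close>, being disjoint from the graph, lies in one of the two smaller insides. An edge
  of the path that met the old inside now lies on the new cycle, so strictly fewer edges meet the
  new inside.\<close>

lemma smaller_cycle:
  assumes cy: "cyc vs" and e: "e \<in> E" "e \<inter> inside (cimg vs) \<noteq> {}"
    and U: "connected U" "U \<noteq> {}" "U \<inter> \<Union>E = {}" "U \<subseteq> inside (cimg vs)"
  obtains ws where "cyc ws" "U \<subseteq> inside (cimg ws)"
    "{e \<in> E. e \<inter> inside (cimg ws) \<noteq> {}} \<subset> {e \<in> E. e \<inter> inside (cimg vs) \<noteq> {}}"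
proof -
  note found = that
  obtain c c' ps where P: "c \<in> set vs" "c' \<in> set vs" "walk (c # ps @ [c'])" "distinct (c # ps @ [c'])"
    "set ps \<subseteq> inside (cimg vs)" "\<exists>e\<in>pedges (c # ps @ [c']). e \<inter> inside (cimg vs) \<noteq> {}"
    using path_across_inside[OF cy e] .
  obtain ws0 where ws0: "cyc (c # ws0)" "set (c # ws0) = set vs" "cedges (c # ws0) = cedges vs"
    using cyc_rotate[OF cy P(1)] by metis
  have "c' \<in> set ws0" using P ws0(2) by auto
  then obtain xs ys where ws0': "ws0 = xs @ c' # ys" by (meson split_list)
  define P1 where "P1 = c # xs @ [c']"
  define P2 where "P2 = c' # ys @ [c]"
  define Q where "Q = c # ps @ [c']"
  have cy': "cyc (c # xs @ c' # ys)" using ws0 ws0' by simp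
  have ce: "cedges vs = pedges P1 \<union> pedges P2"
    using cedges_split[of c xs c' ys] ws0 ws0' unfolding P1_def P2_def by simp
  have w: "walk P1" "walk P2" "walk Q" "distinct P1" "distinct P2" "distinct Q"
    using cy' P unfolding P1_def P2_def Q_def
    by (auto simp: cyc_def walk_simps)
  have disj12: "pedges P1 \<inter> pedges P2 = {}"
    using cyc_split_disjoint[OF cy'] unfolding P1_def P2_def .
  have psd: "set ps \<inter> set vs = {}"
    using P(5) cimg_V[OF cy] inside_no_overlap[of "cimg vs"] by blast
  have sets: "set P1 \<inter> set P2 = {c, c'}" "set P1 \<inter> set Q = {c, c'}" "set P2 \<inter> set Q = {c, c'}"
    "set P1 \<union> set P2 = set vs"
    using cy' psd ws0(2) ws0' unfolding P1_def P2_def Q_def by (auto simp: cyc_def)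
  \<comment> \<open>A shared edge would join \<open>c\<close> and \<open>c'\<close>, forcing the
    path \<open>Q\<close> to be that one edge; but some edge of \<open>Q\<close> meets the inside,
    which no edge of the cycle does.\<close>
  have disjQ: "pedges Q \<inter> cedges vs = {}"
  proof (rule ccontr)
    assume "\<not> ?thesis"
    then obtain e where e: "e \<in> pedges Q" "e \<in> cedges vs" by blast
    have "e \<inter> V \<subseteq> set Q" using pedges_ends[OF w(3) e(1)] .
    moreover have "e \<inter> V \<subseteq> set vs" using cimg_V[OF cy] e(2) unfolding cimg_def by blast
    moreover have "set Q \<inter> set vs = {c, c'}" using sets by blast
    ultimately have sub: "e \<inter> V \<subseteq> {c, c'}" by blast
    have "e \<in> E" using pedges_E[OF w(3)] e by blast
    then obtain a b where ab: "nb a b" "e = ed a b" "e \<inter> V = {a, b}" by (rule edge_ends)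
    then have "a \<noteq> b" "{a, b} \<subseteq> {c, c'}" using sub nb_V by auto
    then have "a = c \<and> b = c' \<or> a = c' \<and> b = c" by auto
    then have e': "nb c c'" "e = ed c c'" using ab nb_sym[of a b] ed_sym[of a b] by auto
    then have "ps = []" using pedges_short[of c ps c'] w e unfolding Q_def by auto
    then have "pedges Q = {e}" using e' unfolding Q_def by simp
    then have "e \<inter> inside (cimg vs) \<noteq> {}" using P(6) unfolding Q_def by simp
    then show False using e(2) inside_no_overlap[of "cimg vs"] unfolding cimg_def by blast
  qed
  have V: "set P1 \<subseteq> V" "set P2 \<subseteq> V" "set Q \<subseteq> V"
    using walk_V[OF w(1)] walk_V[OF w(2)] walk_V[OF w(3)] unfolding P1_def P2_def Q_def by auto
  obtain g1 where g1: "arc g1" "path_image g1 = pimg P1" "pathstart g1 = c" "pathfinish g1 = c'"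
    using pimg_arc[OF w(4,1)] unfolding P1_def by auto
  obtain g2 where g2: "arc g2" "path_image g2 = pimg P2" "pathstart g2 = c'" "pathfinish g2 = c"
    using pimg_arc[OF w(5,2)] unfolding P2_def by auto
  obtain g where g: "arc g" "path_image g = pimg Q" "pathstart g = c" "pathfinish g = c'"
    using pimg_arc[OF w(6,3)] unfolding Q_def by auto
  have i12: "pimg P1 \<inter> pimg P2 = {c, c'}" using pimg_Int[OF w(1,2) V(1,2) disj12] sets by simp
  have i1: "pimg P1 \<inter> pimg Q = {c, c'}"
    using pimg_Int[OF w(1,3) V(1,3)] disjQ ce sets by auto
  have i2: "pimg P2 \<inter> pimg Q = {c, c'}"
    using pimg_Int[OF w(2,3) V(2,3)] disjQ ce sets by auto
  have u: "pimg P1 = \<Union>(pedges P1)" "pimg P2 = \<Union>(pedges P2)" "pimg Q = \<Union>(pedges Q)"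
    using pimg_eq w by (auto simp: P1_def P2_def Q_def)
  have cim: "cimg vs = pimg P1 \<union> pimg P2" unfolding cimg_def ce u by blast
  have ne: "pimg Q \<inter> inside (cimg vs) \<noteq> {}" using P(6) u unfolding Q_def by blast
  have "inside (pimg P1 \<union> pimg Q) \<union> inside (pimg P2 \<union> pimg Q) \<union> (pimg Q - {c, c'})
      = inside (pimg P1 \<union> pimg P2)"
    using plane_split_inside[of g1 c c' "reversepath g2" g] g1 g2 g i12 i1 i2 ne cim
    by (simp add: arc_reversepath)
  then have split: "inside (cimg vs) = inside (pimg P1 \<union> pimg Q) \<union> inside (pimg P2 \<union> pimg Q) \<union> (pimg Q - {c, c'})"
    using cim by simp
  \<comment> \<open>Common to both halves: any cycle made of \<open>Q\<close> and one half of the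
    old cycle that encloses a point of \<open>U\<close> is as required.\<close>
  have *: thesis if D: "cyc D" "cimg D = pimg P' \<union> pimg Q" "inside (pimg P' \<union> pimg Q) \<subseteq> inside (cimg vs)"
      "U \<inter> inside (cimg D) \<noteq> {}" for D P'
  proof (rule found[OF D(1)])
    have "U \<inter> cimg D = {}" using cimg_E[OF D(1)] U by blast
    then show "U \<subseteq> inside (cimg D)" using connected_meets_inside[OF D(1) U(1) _ D(4)] by blast
    obtain e0 where e0: "e0 \<in> pedges Q" "e0 \<inter> inside (cimg vs) \<noteq> {}" using P(6) unfolding Q_def by blast
    then have "e0 \<in> E" "e0 \<subseteq> cimg D" using pedges_E[OF w(3)] u D(2) by blast+
    then have "e0 \<inter> inside (cimg D) = {}" using inside_no_overlap[of "cimg D"] by blast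
    then show "{e \<in> E. e \<inter> inside (cimg D) \<noteq> {}} \<subset> {e \<in> E. e \<inter> inside (cimg vs) \<noteq> {}}"
    proof (intro psubsetI)
      have "inside (cimg D) \<subseteq> inside (cimg vs)" using D(2,3) by simp
      then show "{e \<in> E. e \<inter> inside (cimg D) \<noteq> {}} \<subseteq> {e \<in> E. e \<inter> inside (cimg vs) \<noteq> {}}"
        by auto
      show "{e \<in> E. e \<inter> inside (cimg D) \<noteq> {}} \<noteq> {e \<in> E. e \<inter> inside (cimg vs) \<noteq> {}}"
        using \<open>e0 \<inter> inside (cimg D) = {}\<close> e0(2) \<open>e0 \<in> E\<close> by auto
    qed
  qed
  have "pimg Q \<subseteq> \<Union>E" using pedges_E[OF w(3)] unfolding u(3) by (rule Union_mono)
  then have "U \<inter> pimg Q = {}" using U(3) by auto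
  then have "U \<subseteq> inside (pimg P1 \<union> pimg Q) \<union> inside (pimg P2 \<union> pimg Q)"
    using U(4) unfolding split by auto
  then have "U \<inter> inside (pimg P1 \<union> pimg Q) \<noteq> {} \<or> U \<inter> inside (pimg P2 \<union> pimg Q) \<noteq> {}"
    using U(2) by blast
  then show thesis
  proof
    assume h: "U \<inter> inside (pimg P1 \<union> pimg Q) \<noteq> {}"
    define D where "D = c # xs @ c' # rev ps"
    have "\<not> (xs = [] \<and> ps = [])"
      using disjQ ce unfolding P1_def Q_def by auto
    then have "length D \<ge> 3" unfolding D_def by (cases xs; cases ps) auto
    moreover have "walk (c' # rev ps @ [c])"
    proof -
      have "walk (rev Q)" using w(3) nb_sym by (simp add: successively_rev) (metis (no_types, lifting) successively_mono)
      then show ?thesis unfolding Q_def by simp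
    qed
    then have "walk (D @ [hd D])"
      using w(1) unfolding D_def P1_def by (auto simp: walk_simps)
    moreover have "distinct D"
      using w(4,6) psd sets(4) unfolding D_def P1_def Q_def by auto
    ultimately have "cyc D" by (simp add: cyc_def)
    moreover have "cimg D = pimg P1 \<union> pimg Q"
    proof -
      have "cedges D = pedges P1 \<union> pedges (rev Q)"
        unfolding D_def cedges_split P1_def Q_def by simp
      then show ?thesis unfolding cimg_def u pedges_rev by blast
    qed
    ultimately show thesis using *[of D P1] split h by auto
  next
    assume h: "U \<inter> inside (pimg P2 \<union> pimg Q) \<noteq> {}"
    define D where "D = c' # ys @ c # ps"
    have "\<not> (ys = [] \<and> ps = [])"
      using disjQ ce ed_sym[of c c'] unfolding P2_def Q_def by auto
    then have "length D \<ge> 3" unfolding D_def by (cases ys; cases ps) auto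
    moreover have "walk (D @ [hd D])"
      using w(2,3) unfolding D_def P2_def Q_def by (auto simp: walk_simps)
    moreover have "distinct D"
      using w(5,6) psd sets(4) unfolding D_def P2_def Q_def by auto
    ultimately have "cyc D" by (simp add: cyc_def)
    moreover have "cimg D = pimg P2 \<union> pimg Q"
    proof -
      have "cedges D = pedges P2 \<union> pedges Q"
        unfolding D_def cedges_split P2_def Q_def by simp
      then show ?thesis unfolding cimg_def u by blast
    qed
    ultimately show thesis using *[of D P2] split h by auto
  qed
qed

lemma finite_edges_inside: "cyc vs \<Longrightarrow> finite {e \<in> E. e \<inter> inside (cimg vs) \<noteq> {}}"
proof -
  assume cy: "cyc vs"
  have "finite {e \<in> E. e \<inter> closure (inside (cimg vs)) \<noteq> {}}"
    using cyc_Jordan(6)[OF cy] by (intro finite_edges_compact) (simp add: compact_closure)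
  moreover have "{e \<in> E. e \<inter> inside (cimg vs) \<noteq> {}} \<subseteq> {e \<in> E. e \<inter> closure (inside (cimg vs)) \<noteq> {}}"
    using closure_subset[of "inside (cimg vs)"] by auto
  ultimately show ?thesis by (rule finite_subset[rotated])
qed

lemma enclosing_face_cycle:
  assumes "cyc vs" "connected U" "U \<noteq> {}" "U \<inter> \<Union>E = {}" "U \<subseteq> inside (cimg vs)"
  obtains ws where "cyc ws" "U \<subseteq> inside (cimg ws)" "inside (cimg ws) \<inter> \<Union>E = {}"
proof -
  have "\<exists>ws. cyc ws \<and> U \<subseteq> inside (cimg ws) \<and> inside (cimg ws) \<inter> \<Union>E = {}"
    using assms(1,5)
  proof (induction "card {e \<in> E. e \<inter> inside (cimg vs) \<noteq> {}}" arbitrary: vs rule: less_induct)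
    case less
    show ?case
    proof (cases "inside (cimg vs) \<inter> \<Union>E = {}")
      case False
      then obtain e where "e \<in> E" "e \<inter> inside (cimg vs) \<noteq> {}" by blast
      then obtain ws where ws: "cyc ws" "U \<subseteq> inside (cimg ws)"
        "{e \<in> E. e \<inter> inside (cimg ws) \<noteq> {}} \<subset> {e \<in> E. e \<inter> inside (cimg vs) \<noteq> {}}"
        using smaller_cycle[OF less(2) _ _ assms(2-4) less(3)] by blast
      then show ?thesis
        using less(1)[of ws] psubset_card_mono[OF finite_edges_inside[OF less(2)] ws(3)] by blast
    qed (use less in blast)
  qed
  then show thesis using that by blast
qed

end

lemma ball_meets_if_closure:
  fixes x :: "'a :: metric_space"
  assumes "x \<in> closure S" "r > 0" shows "ball x r \<inter> S \<noteq> {}"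
proof -
  obtain y where "y \<in> S" "dist y x < r" using assms closure_approachable by blast
  then show ?thesis by (auto simp: dist_commute)
qed

context planar_graph
begin

subsection \<open>Faces\<close>

lemma faces_eq: "faces V E = closure ` components (- \<Union>E)"
proof -
  have "V \<union> \<Union>E = \<Union>E" using V_subset by blast
  then show ?thesis by (simp add: faces_def Compl_eq_Diff_UNIV)
qed

lemma open_component: "F \<subseteq> E \<Longrightarrow> U \<in> components (- \<Union>F) \<Longrightarrow> open U"
  by (meson closed_Union_edges open_Compl open_components)

lemma frontier_component: "F \<subseteq> E \<Longrightarrow> U \<in> components (- \<Union>F) \<Longrightarrow> frontier U \<subseteq> \<Union>F"
  by (meson closed_Union_edges frontier_of_components_closed_complement)

lemma component_disjoint: "U \<in> components (- \<Union>F) \<Longrightarrow> U \<inter> \<Union>F = {}"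
  using in_components_subset by fastforce

text \<open>An open component that meets the closure of another one meets that component itself.
  Thus counting components of the complement is the same as counting faces.\<close>

lemma closure_component_inj:
  assumes "U \<in> components (- \<Union>E)" "W \<in> components (- \<Union>E)" "closure U = closure W"
  shows "U = W"
proof -
  have "U \<noteq> {}" "U \<subseteq> closure W" using assms in_components_nonempty closure_subset by blast+
  then have "U \<inter> closure W \<noteq> {}" by blast
  then have "U \<inter> W \<noteq> {}"
    using open_Int_closure_eq_empty[OF open_component[OF order_refl assms(1)]] by blast
  then show ?thesis using components_eq assms by blast
qed

text \<open>The arc lemma, with all the other edges in the role of the closed set \<open>T\<close>.
  It makes the relation between edges and faces combinatorial: one interior point decides for the
  whole edge.\<close>

lemma closure_contains_edge:
  assumes "U \<in> components (- \<Union>E)" "e \<in> E" "x \<in> e" "x \<notin> V" "x \<in> closure U"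
  shows "e \<subseteq> closure U"
proof -
  obtain g where g: "arc g" "path_image g = e" "pathstart g \<in> V" "pathfinish g \<in> V"
    "e \<inter> V = {pathstart g, pathfinish g}"
    using edge_arc[OF assms(2)] .
  have "\<Union>(E - {e}) \<inter> path_image g \<subseteq> {pathstart g, pathfinish g}"
  proof
    fix z assume z: "z \<in> \<Union>(E - {e}) \<inter> path_image g"
    then obtain e' where "e' \<in> E" "e' \<noteq> e" "z \<in> e'" by blast
    then have "z \<in> V" using edges_meet[OF assms(2), of e'] z g(2) by blast
    then show "z \<in> {pathstart g, pathfinish g}" using g z by blast
  qed
  moreover have "\<Union>(E - {e}) \<union> path_image g = \<Union>E" using g(2) assms(2) by blast
  ultimately have "path_image g \<subseteq> closure U"
    using component_closure_contains_arc[of g "\<Union>(E - {e})" U x] g assms closed_Union_edges[of "E - {e}"]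
    by auto
  then show ?thesis using g by simp
qed

lemma edge_two_sided:
  assumes "e \<in> E" "y \<in> e" "y \<notin> V"
  obtains r where "r > 0" "ball y r \<inter> \<Union>E \<subseteq> e" "ball y r \<inter> V = {}" "ball y r - e \<noteq> {}"
    "\<And>p q z. {p, q, z} \<subseteq> ball y r - e \<Longrightarrow> connected_component (- \<Union>E) p q
       \<or> connected_component (- \<Union>E) q z \<or> connected_component (- \<Union>E) p z"
proof -
  obtain r0 where r0: "r0 > 0" "ball y r0 \<inter> \<Union>E \<subseteq> e" "ball y r0 \<inter> V = {}"
    using edge_nbhd[OF assms] .
  obtain g where g: "arc g" "path_image g = e" "pathstart g \<in> V" "pathfinish g \<in> V"
    using edge_arc[OF assms(1)] by metis
  have y: "y \<in> path_image g" "y \<noteq> pathstart g" "y \<noteq> pathfinish g" "y \<in> ball y r0"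
    using assms g r0 by auto
  obtain r where r: "r > 0" "ball y r \<subseteq> ball y r0" "ball y r - path_image g \<noteq> {}"
    "\<And>p q z. {p, q, z} \<subseteq> ball y r - path_image g \<Longrightarrow>
       connected_component (ball y r0 - path_image g) p q \<or> connected_component (ball y r0 - path_image g) q z
       \<or> connected_component (ball y r0 - path_image g) p z"
    using arc_locally_two_sided[OF g(1) y(1-3) open_ball y(4)] by blast
  have sub: "ball y r0 - path_image g \<subseteq> - \<Union>E" using r0 g(2) by blast
  show thesis
  proof (rule that[OF r(1)])
    show "ball y r \<inter> \<Union>E \<subseteq> e" "ball y r \<inter> V = {}" "ball y r - e \<noteq> {}"
      using r r0 g(2) by blast+
    fix p q z assume "{p, q, z} \<subseteq> ball y r - e"
    then show "connected_component (- \<Union>E) p q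
       \<or> connected_component (- \<Union>E) q z \<or> connected_component (- \<Union>E) p z"
      using r(4)[of p q z] g(2) connected_component_mono[OF sub] by blast
  qed
qed

lemma edge_in_some_face:
  assumes "e \<in> E" obtains f where "f \<in> faces V E" "e \<subseteq> f"
proof -
  obtain a b where ab: "nb a b" "e = ed a b" "e \<inter> V = {a, b}" using edge_ends[OF assms] .
  then obtain y where y: "y \<in> e" "y \<notin> V" using edge_parts(4)[OF ab(1)] by blast
  obtain r where r: "r > 0" "ball y r \<inter> \<Union>E \<subseteq> e" "ball y r \<inter> V = {}" "ball y r - e \<noteq> {}"
    using edge_two_sided[OF assms y] by metis
  obtain p where p: "p \<in> ball y r" "p \<notin> e" using r(4) by blast
  then have "p \<in> - \<Union>E" using r(2) by blast
  then obtain U where U: "U \<in> components (- \<Union>E)" "p \<in> U" by (metis UnionE Union_components)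
  have "y \<notin> U" using component_disjoint[OF U(1)] y assms by blast
  \<comment> \<open>The disc contains \<open>p\<close> in \<open>U\<close> and \<open>y\<close>
    outside it, so it meets the frontier of \<open>U\<close>; within this disc that frontier can
    only be on \<open>e\<close>.\<close>
  then have "ball y r \<inter> frontier U \<noteq> {}"
    using p U(2) r(1) by (intro connected_Int_frontier) (auto dest: subsetD[of "ball y r" U y])
  then obtain x where x: "x \<in> ball y r" "x \<in> frontier U" by blast
  then have "x \<in> e" "x \<notin> V" "x \<in> closure U"
    using frontier_component[OF order_refl U(1)] r by (auto simp: frontier_def)
  then have "e \<subseteq> closure U" using closure_contains_edge[OF U(1) assms] by blast
  moreover have "closure U \<in> faces V E" using U(1) by (simp add: faces_eq)
  ultimately show thesis using that by blast
qed

text \<open>Each of three faces has a point of its component in the two-sided disc; two of these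
  points are joined off the graph, so two components agree.\<close>

lemma three_faces_at_edge:
  assumes "e \<in> E" "y \<in> e" "y \<notin> V" "{f, g, h} \<subseteq> faces V E" "y \<in> f" "y \<in> g" "y \<in> h"
  shows "f = g \<or> g = h \<or> f = h"
proof -
  obtain r where r: "r > 0" "ball y r \<inter> \<Union>E \<subseteq> e"
    "\<And>p q z. {p, q, z} \<subseteq> ball y r - e \<Longrightarrow> connected_component (- \<Union>E) p q
       \<or> connected_component (- \<Union>E) q z \<or> connected_component (- \<Union>E) p z"
    using edge_two_sided[OF assms(1-3)] by metis
  have *: "\<exists>U p. U \<in> components (- \<Union>E) \<and> k = closure U \<and> p \<in> U \<and> p \<in> ball y r - e"
    if k: "k \<in> faces V E" "y \<in> k" for k
  proof -
    obtain U where U: "U \<in> components (- \<Union>E)" "k = closure U" using k by (auto simp: faces_eq)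
    then have "ball y r \<inter> U \<noteq> {}"
      using k r(1) ball_meets_if_closure by blast
    then obtain p where "p \<in> ball y r" "p \<in> U" by blast
    then show ?thesis using U component_disjoint[OF U(1)] assms(1) by blast
  qed
  obtain U1 p1 where 1: "U1 \<in> components (- \<Union>E)" "f = closure U1" "p1 \<in> U1" "p1 \<in> ball y r - e"
    using *[of f] assms by blast
  obtain U2 p2 where 2: "U2 \<in> components (- \<Union>E)" "g = closure U2" "p2 \<in> U2" "p2 \<in> ball y r - e"
    using *[of g] assms by blast
  obtain U3 p3 where 3: "U3 \<in> components (- \<Union>E)" "h = closure U3" "p3 \<in> U3" "p3 \<in> ball y r - e"
    using *[of h] assms by blast
  have same: "closure W = closure W'" if W: "W \<in> components (- \<Union>E)" "W' \<in> components (- \<Union>E)" "p \<in> W" "q \<in> W'"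
      "connected_component (- \<Union>E) p q" for W W' p q
  proof -
    obtain X where X: "connected X" "X \<subseteq> - \<Union>E" "p \<in> X" "q \<in> X"
      using W(5) by (auto simp: connected_component_def)
    have "X \<subseteq> W" using components_maximal[OF W(1) X(1,2)] X(3) W(3) by auto
    then have "W \<inter> W' \<noteq> {}" using X(4) W(4) by auto
    then show ?thesis using components_eq[OF W(1,2)] by simp
  qed
  show ?thesis
    using r(3)[of p1 p2 p3] 1(4) 2(4) 3(4) same[OF 1(1) 2(1) 1(3) 2(3)] same[OF 2(1) 3(1) 2(3) 3(3)]
      same[OF 1(1) 3(1) 1(3) 3(3)] unfolding 1(2) 2(2) 3(2) by auto
qed

lemma edge_two_faces:
  assumes "e \<in> E" shows "finite {f \<in> faces V E. e \<subseteq> f}" "card {f \<in> faces V E. e \<subseteq> f} \<le> 2"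
proof -
  let ?A = "{f \<in> faces V E. e \<subseteq> f}"
  obtain a b where ab: "nb a b" "e = ed a b" "e \<inter> V = {a, b}" using edge_ends[OF assms] .
  then obtain y where y: "y \<in> e" "y \<notin> V" using edge_parts(4)[OF ab(1)] by blast
  have no3: "f = g \<or> g = h \<or> f = h" if "f \<in> ?A" "g \<in> ?A" "h \<in> ?A" for f g h
    using three_faces_at_edge[OF assms y, of f g h] that y by auto
  have "\<exists>f g. ?A \<subseteq> {f, g}"
  proof (cases "\<exists>f g. f \<in> ?A \<and> g \<in> ?A \<and> f \<noteq> g")
    case True
    then obtain f g where fg: "f \<in> ?A" "g \<in> ?A" "f \<noteq> g" by blast
    have "h = f \<or> h = g" if "h \<in> ?A" for h using no3[OF fg(1,2) that] fg(3) by auto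
    then show ?thesis by blast
  next
    case False
    then have all_eq: "h = f" if "h \<in> ?A" "f \<in> ?A" for h f using that by meson
    show ?thesis
    proof (cases "?A = {}")
      case True
      then show ?thesis by (metis empty_subsetI)
    next
      case False
      then obtain f where "f \<in> ?A" by auto
      then have "?A \<subseteq> {f, f}" using all_eq by auto
      then show ?thesis by meson
    qed
  qed
  then obtain f g where "?A \<subseteq> {f, g}" by blast
  then show "finite ?A" "card ?A \<le> 2"
    using card_mono[of "{f, g}" ?A] card_insert_le_m1[of 2 "{g}" f] by (auto intro: finite_subset)
qed

text \<open>Any component that reaches the disc has a frontier point on \<open>e\<close> there, so
  its closure is a face at \<open>e\<close>, and there is no third one besides \<open>f\<close> and
  \<open>g\<close>.\<close>

lemma two_faces_cover_nbhd:
  assumes "e \<in> E" "y \<in> e" "y \<notin> V" "f \<in> faces V E" "g \<in> faces V E" "f \<noteq> g" "e \<subseteq> f" "e \<subseteq> g"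
  obtains r where "r > 0" "ball y r \<subseteq> f \<union> g"
proof -
  obtain r where r: "r > 0" "ball y r \<inter> \<Union>E \<subseteq> e" "ball y r \<inter> V = {}"
    using edge_nbhd[OF assms(1-3)] .
  have "p \<in> f \<union> g" if p: "p \<in> ball y r" for p
  proof (cases "p \<in> e")
    case False
    then have "p \<in> - \<Union>E" using r(2) p by blast
    then obtain U where U: "U \<in> components (- \<Union>E)" "p \<in> U" by (metis UnionE Union_components)
    have "y \<notin> U" using component_disjoint[OF U(1)] assms by blast
    then have "ball y r \<inter> frontier U \<noteq> {}"
      using p U(2) r(1) by (intro connected_Int_frontier) (auto dest: subsetD[of "ball y r" U y])
    then obtain x where x: "x \<in> ball y r" "x \<in> frontier U" by blast
    then have x': "x \<in> e" "x \<notin> V" "x \<in> closure U"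
      using frontier_component[OF order_refl U(1)] r by (auto simp: frontier_def)
    have "closure U \<in> faces V E" using U by (simp add: faces_eq)
    then have "closure U = f \<or> closure U = g"
      using three_faces_at_edge[OF assms(1) x'(1,2), of f g "closure U"] assms x' by auto
    then show ?thesis using U(2) closure_subset[of U] by blast
  qed (use assms in blast)
  then show thesis using that r(1) by blast
qed

lemma punctured_disc_meets_edge:
  assumes "nb s w" "r > 0" shows "\<exists>x \<in> ed s w. x \<in> ball s r - {s} \<and> x \<notin> V"
proof -
  have "s \<in> closure (ed s w - {s, w})" using edge_parts(3)[OF assms(1)] ed(3)[OF assms(1)] by blast
  then have "ball s r \<inter> (ed s w - {s, w}) \<noteq> {}"
    using assms(2) ball_meets_if_closure by blast
  then show ?thesis using ed_interior_not_V[OF assms(1)] by blast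
qed

lemma connected_punctured_disc: "connected (ball (s::pt) r - {s})"
  by (rule connected_open_delete) auto

text \<open>A punctured disc around \<open>v\<close> is connected and contains points of the
  component as well as of an edge, so it meets the frontier of the component, at an interior point
  of some edge at \<open>v\<close>.\<close>

lemma face_edge_at_vertex:
  assumes "f \<in> faces V E" "v \<in> V" "v \<in> f"
  obtains e where "e \<in> E" "v \<in> e" "e \<subseteq> f"
proof -
  obtain U where U: "U \<in> components (- \<Union>E)" "f = closure U" using assms by (auto simp: faces_eq)
  obtain r where r: "r > 0" "ball v r \<inter> V = {v}" "\<And>e. e \<in> E \<Longrightarrow> e \<inter> ball v r \<noteq> {} \<Longrightarrow> v \<in> e"
    using vertex_nbhd[OF assms(2)] by metis
  obtain w where w: "nb v w" using vertex_has_nb assms by blast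
  obtain x where x: "x \<in> ed v w" "x \<in> ball v r - {v}" "x \<notin> V"
    using punctured_disc_meets_edge[OF w r(1)] by blast
  have "x \<notin> U" using component_disjoint[OF U(1)] x ed(1)[OF w] by blast
  moreover have "(ball v r - {v}) \<inter> U \<noteq> {}"
  proof -
    have "ball v r \<inter> U \<noteq> {}"
      using assms U r(1) ball_meets_if_closure by blast
    moreover have "v \<notin> U" using component_disjoint[OF U(1)] V_subset assms by blast
    ultimately show ?thesis by blast
  qed
  ultimately have "(ball v r - {v}) \<inter> frontier U \<noteq> {}"
    using x by (intro connected_Int_frontier connected_punctured_disc) blast+
  then obtain z where z: "z \<in> ball v r" "z \<noteq> v" "z \<in> frontier U" by blast
  then obtain e where e: "e \<in> E" "z \<in> e" using frontier_component[OF order_refl U(1)] by blast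
  moreover have "z \<notin> V" using z r(2) by blast
  ultimately have "e \<subseteq> f" using closure_contains_edge[OF U(1)] z U(2) by (auto simp: frontier_def)
  moreover have "v \<in> e" using r(3) e z by blast
  ultimately show thesis using that e by blast
qed

lemma finite_faces_at: assumes "v \<in> V" shows "finite {f \<in> faces V E. v \<in> f}"
proof -
  have "{f \<in> faces V E. v \<in> f} \<subseteq> (\<Union>e\<in>{e \<in> E. v \<in> e}. {f \<in> faces V E. e \<subseteq> f})"
    using face_edge_at_vertex[OF _ assms] by blast
  moreover have "finite (\<Union>e\<in>{e \<in> E. v \<in> e}. {f \<in> faces V E. e \<subseteq> f})"
    using finite_edges_at edge_two_faces(1) by simp
  ultimately show ?thesis by (rule finite_subset)
qed

subsection \<open>Faces bounded by cycles\<close>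

text \<open>The face \<open>f\<close> is the closed region bounded by the cycle \<open>vs\<close>,
  whose inside is a single component of the complement by \<open>fcyc_component\<close>. For such
  faces the minima in \<open>face_len\<close> and \<open>corner_mult\<close> can be
  computed.\<close>

definition fcyc :: "pt set \<Rightarrow> pt list \<Rightarrow> bool" where
  "fcyc f vs \<longleftrightarrow> cyc vs \<and> inside (cimg vs) \<inter> \<Union>E = {} \<and> f = closure (inside (cimg vs))"

lemma fcyc_eq: "fcyc f vs \<Longrightarrow> f = inside (cimg vs) \<union> cimg vs"
  using cyc_Jordan(7) by (simp add: fcyc_def)

lemma fcyc_component:
  assumes "fcyc f vs" shows "inside (cimg vs) \<in> components (- \<Union>E)"
proof -
  have cy: "cyc vs" and dis: "inside (cimg vs) \<inter> \<Union>E = {}" using assms by (auto simp: fcyc_def)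
  obtain p where p: "p \<in> inside (cimg vs)" using cyc_Jordan(1)[OF cy] by blast
  have "p \<in> - \<Union>E" using dis p by blast
  then obtain U where U: "U \<in> components (- \<Union>E)" "p \<in> U" by (metis UnionE Union_components)
  have "inside (cimg vs) \<subseteq> U"
    using components_maximal[OF U(1) cyc_Jordan(3)[OF cy]] dis U(2) p by blast
  moreover have "U \<subseteq> inside (cimg vs)"
    using connected_meets_inside[OF cy in_components_connected[OF U(1)]] component_disjoint[OF U(1)]
      cimg_E[OF cy] p U(2) by blast
  ultimately show ?thesis using U by simp
qed

lemma fcyc_face: "fcyc f vs \<Longrightarrow> f \<in> faces V E"
  using fcyc_component by (auto simp: fcyc_def faces_eq)

text \<open>Shrink the enclosing cycle until no edge meets its inside. This inside is then connected
  in the complement of the graph and contains \<open>U\<close>, hence equals \<open>U\<close> by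
  maximality.\<close>

lemma enclosed_fcyc:
  assumes "U \<in> components (- \<Union>E)" "cyc vs" "U \<subseteq> inside (cimg vs)"
  obtains ws where "fcyc (closure U) ws"
proof -
  have "U \<inter> \<Union>E = {}" using component_disjoint assms by blast
  then obtain ws where ws: "cyc ws" "U \<subseteq> inside (cimg ws)" "inside (cimg ws) \<inter> \<Union>E = {}"
    using enclosing_face_cycle[OF assms(2) in_components_connected[OF assms(1)]
        in_components_nonempty[OF assms(1)] _ assms(3)] by blast
  have "U \<noteq> {}" using assms in_components_nonempty by blast
  moreover have "inside (cimg ws) \<subseteq> U"
    using components_maximal[OF assms(1) cyc_Jordan(3)[OF ws(1)]] ws \<open>U \<noteq> {}\<close> by blast
  ultimately show thesis using that[of ws] ws by (auto simp: fcyc_def)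
qed

lemma fcyc_V: assumes "fcyc f vs" shows "V \<inter> f = set vs"
proof -
  have "V \<inter> inside (cimg vs) = {}" using assms V_subset by (auto simp: fcyc_def)
  then show ?thesis using fcyc_eq[OF assms] cimg_V[of vs] assms by (auto simp: fcyc_def)
qed

lemma fcyc_edges: assumes "fcyc f vs" shows "{e \<in> E. e \<subseteq> f} = cedges vs"
proof -
  have cy: "cyc vs" and dis: "inside (cimg vs) \<inter> \<Union>E = {}" using assms by (auto simp: fcyc_def)
  have "e \<in> cedges vs" if e: "e \<in> E" "e \<subseteq> f" for e
  proof -
    obtain a b where ab: "nb a b" "e = ed a b" "e \<inter> V = {a, b}" using edge_ends[OF e(1)] .
    then obtain y where y: "y \<in> e" "y \<notin> V" using edge_parts(4)[OF ab(1)] by blast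
    then have "y \<in> cimg vs" using e dis fcyc_eq[OF assms] by blast
    then obtain e' where "e' \<in> cedges vs" "y \<in> e'" by (auto simp: cimg_def)
    then show ?thesis using edge_eq_if_meet[OF e(1) _ y(1)] y cedges_E[OF cy] by blast
  qed
  moreover have "e \<in> E \<and> e \<subseteq> f" if "e \<in> cedges vs" for e
    using that cedges_E[OF cy] fcyc_eq[OF assms] by (auto simp: cimg_def)
  ultimately show ?thesis by blast
qed

lemma fcyc_two_edges:
  assumes "fcyc f vs" "v \<in> V" "v \<in> f"
  shows "card {e \<in> E. v \<in> e \<and> e \<subseteq> f} = 2"
proof -
  have cy: "cyc vs" using assms by (auto simp: fcyc_def)
  have "v \<in> set vs" using fcyc_V[OF assms(1)] assms by blast
  then obtain ws where ws: "cyc (v # ws)" "cedges (v # ws) = cedges vs"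
    using cyc_rotate[OF cy] by metis
  have l: "length ws \<ge> 2" using ws by (simp add: cyc_def)
  then obtain x zs where "ws = x # zs" "zs \<noteq> []" by (cases ws) fastforce+
  then obtain ys y where ys: "ws = x # ys @ [y]" by (metis rev_exhaust)
  have cy': "cyc (v # (x # ys) @ y # [])" using ws ys by simp
  have w: "walk (v # x # ys @ [y])" "nb y v" "nb v x" "distinct (v # x # ys @ [y])"
    using cy' by (auto simp: cyc_def walk_simps)
  have ce: "cedges vs = insert (ed y v) (pedges (v # x # ys @ [y]))"
    using cedges_split[of v "x # ys" y "[]"] ws ys by auto
  have "{e \<in> E. v \<in> e \<and> e \<subseteq> f} = {e \<in> cedges vs. v \<in> e}"
    using fcyc_edges[OF assms(1)] by blast
  also have "\<dots> = {ed v x, ed y v}"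
  proof -
    have "ed v x \<in> cedges vs" "ed y v \<in> cedges vs" unfolding ce by auto
    moreover have "v \<in> ed v x" "v \<in> ed y v" using ed w by auto
    moreover have "e = ed v x \<or> e = ed y v" if "e \<in> cedges vs" "v \<in> e" for e
      using pedges_hd[OF w(4,1), of e] that unfolding ce by blast
    ultimately show ?thesis by blast
  qed
  also have "card \<dots> = 2"
  proof -
    have "ed v x \<noteq> ed v y" using ed_inj[OF w(3) nb_sym[OF w(2)]] w(4) by auto
    then show ?thesis using ed_sym[of y v] by simp
  qed
  finally show ?thesis .
qed

lemma fcyc_card: assumes "fcyc f vs" shows "card (V \<inter> f) = length vs" "length vs \<ge> 3" "finite (V \<inter> f)"
  using fcyc_V[OF assms] assms distinct_card[of vs] by (auto simp: fcyc_def cyc_def)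

lemma walk_nth: "walk ws \<Longrightarrow> Suc i < length ws \<Longrightarrow> nb (ws ! i) (ws ! Suc i) \<and> ed (ws ! i) (ws ! Suc i) \<in> pedges ws"
proof (induction ws arbitrary: i rule: induct_list012)
  case (3 x y zs)
  then show ?case by (cases i) auto
qed auto

lemma fcyc_walk:
  assumes "fcyc f vs" shows "closed_boundary_walk V E f (vs @ [hd vs])"
proof -
  have cy: "cyc vs" using assms by (auto simp: fcyc_def)
  have "\<exists>e\<in>E. e \<inter> V = {(vs @ [hd vs]) ! i, (vs @ [hd vs]) ! Suc i}
      \<and> (vs @ [hd vs]) ! i \<noteq> (vs @ [hd vs]) ! Suc i \<and> e \<subseteq> f" if "Suc i < length (vs @ [hd vs])" for i
  proof -
    let ?a = "(vs @ [hd vs]) ! i" and ?b = "(vs @ [hd vs]) ! Suc i"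
    have n: "nb ?a ?b" "ed ?a ?b \<in> cedges vs"
      using walk_nth[OF cyc_walk[OF cy] that] by (auto simp: cedges_def)
    then have "ed ?a ?b \<in> E \<and> ed ?a ?b \<subseteq> f" using fcyc_edges[OF assms] by blast
    then show ?thesis using ed(2)[OF n(1)] nb_V(3)[OF n(1)] by blast
  qed
  moreover have "hd (vs @ [hd vs]) = last (vs @ [hd vs])" using cyc_ne[OF cy] by simp
  moreover have "set (vs @ [hd vs]) \<subseteq> V" using cyc_V[OF cy] cyc_ne[OF cy] by auto
  ultimately show ?thesis
    unfolding closed_boundary_walk_def using fcyc_V[OF assms] by auto
qed

text \<open>Deleting the closing vertex loses no vertex, because it is also the first one. Two
  vertices on the face rule out the one-vertex walk of length 0, for which this fails.\<close>

lemma closed_walk_visits: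
  assumes "closed_boundary_walk V E f ws" "card (V \<inter> f) \<ge> 2"
  shows "card (V \<inter> f) \<le> walk_len ws" "v \<in> V \<inter> f \<Longrightarrow> walk_visits ws v \<ge> 1"
proof -
  have ws: "ws \<noteq> []" "hd ws = last ws" "V \<inter> f \<subseteq> set ws"
    using assms(1) by (auto simp: closed_boundary_walk_def)
  have "card (V \<inter> f) \<le> card (set ws)" using ws(3) by (intro card_mono) auto
  then have "length ws \<ge> 2" using assms(2) card_length[of ws] by linarith
  then have ne: "butlast ws \<noteq> []" using ws(1) by (cases ws rule: rev_cases) auto
  have "last ws \<in> set (butlast ws)"
  proof -
    have "hd ws = hd (butlast ws)" using ne by (cases ws) (auto split: if_splits)
    then show ?thesis using ws(2) ne hd_in_set by metis
  qed
  then have st: "set ws = set (butlast ws)"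
    using ws(1) append_butlast_last_id[OF ws(1)] by (metis Un_insert_right append_Nil2 insert_absorb list.simps(15) set_append)
  have "card (V \<inter> f) \<le> card (set (butlast ws))" using \<open>card (V \<inter> f) \<le> card (set ws)\<close> st by simp
  also have "\<dots> \<le> length (butlast ws)" by (rule card_length)
  finally show "card (V \<inter> f) \<le> walk_len ws" by (simp add: walk_len_def)
  assume "v \<in> V \<inter> f"
  then have "v \<in> set (butlast ws)" using ws(3) st by blast
  then obtain i where "i < length (butlast ws)" "butlast ws ! i = v" by (meson in_set_conv_nth)
  then have "i \<in> {i. i < length ws - 1 \<and> ws ! i = v}" by (auto simp: nth_butlast)
  moreover have "finite {i. i < length ws - 1 \<and> ws ! i = v}" by simp
  ultimately have "card {i. i < length ws - 1 \<and> ws ! i = v} > 0" by (metis card_gt_0_iff empty_iff)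
  then show "walk_visits ws v \<ge> 1" by (simp add: walk_visits_def)
qed

text \<open>The bounding cycle attains both minima at once: every boundary walk visits each vertex
  of the face at least once, and the cycle does so exactly once.\<close>

lemma fcyc_corner:
  assumes "fcyc f vs"
  shows "finite_face V E f" "face_len V E f = card (V \<inter> f)"
    "v \<in> V \<Longrightarrow> v \<in> f \<Longrightarrow> corner_term V E v f = 1 / real (card (V \<inter> f))"
proof -
  note W = fcyc_walk[OF assms]
  have c2: "card (V \<inter> f) \<ge> 2" using fcyc_card[OF assms] by simp
  show fin: "finite_face V E f" using W by (auto simp: finite_face_def)
  show len: "face_len V E f = card (V \<inter> f)"
    unfolding face_len_def
  proof (rule Least_equality)
    show "\<exists>ws. closed_boundary_walk V E f ws \<and> walk_len ws = card (V \<inter> f)"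
      using W fcyc_card[OF assms] by (intro exI[of _ "vs @ [hd vs]"]) (simp add: walk_len_def)
  qed (use closed_walk_visits(1)[OF _ c2] in blast)
  assume v: "v \<in> V" "v \<in> f"
  have "corner_mult V E v f = 1"
    unfolding corner_mult_def
  proof (rule Least_equality)
    have "v \<in> set vs" using v fcyc_V[OF assms] by blast
    then obtain i where i: "i < length vs" "vs ! i = v" by (meson in_set_conv_nth)
    have "distinct vs" using assms by (auto simp: fcyc_def cyc_def)
    then have "{j. j < length vs \<and> (vs @ [hd vs]) ! j = v} = {i}"
      using i by (auto simp: nth_append nth_eq_iff_index_eq)
    then have "walk_visits (vs @ [hd vs]) v = 1" by (simp add: walk_visits_def)
    then show "\<exists>ws. closed_boundary_walk V E f ws \<and> walk_visits ws v = 1" using W by blast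
  qed (use closed_walk_visits(2)[OF _ c2] v in blast)
  then show "corner_term V E v f = 1 / real (card (V \<inter> f))"
    by (simp add: corner_term_def fin len)
qed

text \<open>If every edge at \<open>s\<close> that occurs on a face of \<open>F\<close> has a face of \<open>F\<close> on both sides, then the faces of
  \<open>F\<close> fill a neighbourhood of \<open>s\<close>, since the boundary of their union would have to
  pass through the punctured disc around \<open>s\<close>.\<close>

lemma faces_around_vertex:
  assumes s: "s \<in> V" and A: "A \<subseteq> {e \<in> E. s \<in> e}" "A \<noteq> {}" and F: "finite F" "\<And>f. f \<in> F \<Longrightarrow> \<exists>vs. fcyc f vs"
    and two: "\<And>e. e \<in> A \<Longrightarrow> \<exists>f\<in>F. \<exists>g\<in>F. f \<noteq> g \<and> e \<subseteq> f \<and> e \<subseteq> g"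
    and FA: "\<And>f e. f \<in> F \<Longrightarrow> e \<in> E \<Longrightarrow> s \<in> e \<Longrightarrow> e \<subseteq> f \<Longrightarrow> e \<in> A"
    and e0: "e0 \<in> E" "s \<in> e0"
  shows "e0 \<in> A"
proof -
  obtain r where r: "r > 0" "ball s r \<inter> V = {s}" "\<And>e. e \<in> E \<Longrightarrow> e \<inter> ball s r \<noteq> {} \<Longrightarrow> s \<in> e"
    using vertex_nbhd[OF s] by metis
  have onface: "\<exists>e\<in>A. x \<in> e \<and> e \<subseteq> f" if x: "x \<in> ball s r - {s}" and f: "f \<in> F" "fcyc f vs" "x \<in> cimg vs" for x f vs
  proof -
    obtain e where e: "e \<in> cedges vs" "x \<in> e" using f by (auto simp: cimg_def)
    then have "e \<in> E" "e \<subseteq> f" using fcyc_edges[OF f(2)] by blast+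
    moreover have "s \<in> e" using r(3)[OF \<open>e \<in> E\<close>] e x by blast
    ultimately show ?thesis using FA f e by blast
  qed
  define K where "K = \<Union>F"
  have "closed K"
    unfolding K_def using F by (intro closed_Union) (auto simp: fcyc_def)
  have sub: "ball s r - {s} \<subseteq> K"
  proof (rule ccontr)
    assume "\<not> ?thesis"
    moreover have "(ball s r - {s}) \<inter> K \<noteq> {}"
    proof -
      obtain e where e: "e \<in> A" using A by blast
      then have "e \<in> E" "s \<in> e" using A by auto
      then obtain w where w: "nb s w" "e = ed s w" using edge_at[of e s] s by metis
      obtain f where "f \<in> F" "e \<subseteq> f" using two[OF e] by blast
      then show ?thesis using punctured_disc_meets_edge[OF w(1) r(1)] w(2) unfolding K_def by blast
    qed
    ultimately have "(ball s r - {s}) \<inter> frontier K \<noteq> {}"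
      by (intro connected_Int_frontier connected_punctured_disc) blast+
    then obtain x where x: "x \<in> ball s r - {s}" "x \<in> frontier K" by blast
    then have xK: "x \<in> K" "x \<notin> interior K"
      using \<open>closed K\<close> by (auto simp: frontier_def)
    then obtain f where f: "f \<in> F" "x \<in> f" by (auto simp: K_def)
    then obtain vs where vs: "fcyc f vs" using F by blast
    have "x \<notin> inside (cimg vs)"
    proof
      assume "x \<in> inside (cimg vs)"
      moreover have "inside (cimg vs) \<subseteq> K" using fcyc_eq[OF vs] f by (auto simp: K_def)
      moreover have "open (inside (cimg vs))" using vs cyc_Jordan(2) by (auto simp: fcyc_def)
      ultimately show False using xK interior_maximal by blast
    qed
    then have "x \<in> cimg vs" using f fcyc_eq[OF vs] by blast
    then obtain e where e: "e \<in> A" "x \<in> e" using onface[OF x(1) f(1) vs] by blast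
    obtain f1 f2 where f12: "f1 \<in> F" "f2 \<in> F" "f1 \<noteq> f2" "e \<subseteq> f1" "e \<subseteq> f2" using two[OF e(1)] by blast
    have "x \<notin> V" using x r(2) by blast
    moreover have "f1 \<in> faces V E" "f2 \<in> faces V E" using f12 F(2) fcyc_face by blast+
    moreover have "e \<in> E" using e A by blast
    ultimately obtain r' where "r' > 0" "ball x r' \<subseteq> f1 \<union> f2"
      using two_faces_cover_nbhd[of e x f1 f2] f12 e by blast
    then have "ball x r' \<subseteq> K" using f12 by (auto simp: K_def)
    then have "x \<in> interior K" using \<open>r' > 0\<close> by (meson centre_in_ball interior_maximal open_ball subsetD)
    then show False using xK by blast
  qed
  \<comment> \<open>A point of \<open>e0\<close> near \<open>s\<close> is now covered by a face of
    \<open>F\<close>; since insides contain no points of the graph, it lies on the bounding cycle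
    and thus on an edge of \<open>A\<close>, which must be \<open>e0\<close>.\<close>
  obtain w where w: "nb s w" "e0 = ed s w" using edge_at[OF e0] s by metis
  obtain x where x: "x \<in> e0" "x \<in> ball s r - {s}" "x \<notin> V"
    using punctured_disc_meets_edge[OF w(1) r(1)] w(2) by blast
  then obtain f where f: "f \<in> F" "x \<in> f" using sub by (auto simp: K_def)
  then obtain vs where vs: "fcyc f vs" using F by blast
  have "x \<notin> inside (cimg vs)" using vs x e0 by (auto simp: fcyc_def)
  then have "x \<in> cimg vs" using f fcyc_eq[OF vs] by blast
  then obtain e where e: "e \<in> A" "x \<in> e" using onface[OF x(2) f(1) vs] by blast
  then have "e = e0" using edge_eq_if_meet[of e e0 x] x e0 A by blast
  then show ?thesis using e by simp
qed

text \<open>Double counting: a face bounded by a cycle has exactly two edges at \<open>s\<close>,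
  and an edge lies on at most two faces. Equality would put two faces of \<open>F\<close> at every
  edge of \<open>A\<close>, and then \<open>faces_around_vertex\<close> leaves no edge at
  \<open>s\<close> outside \<open>A\<close>.\<close>

lemma count_faces_around_vertex:
  assumes s: "s \<in> V" and A: "A \<subseteq> {e \<in> E. s \<in> e}"
    and F: "\<And>f. f \<in> F \<Longrightarrow> s \<in> f \<and> (\<exists>vs. fcyc f vs)"
    and FA: "\<And>f e. f \<in> F \<Longrightarrow> e \<in> E \<Longrightarrow> s \<in> e \<Longrightarrow> e \<subseteq> f \<Longrightarrow> e \<in> A"
  shows "finite F" "card F \<le> card A" "A \<noteq> {} \<Longrightarrow> e0 \<in> E \<Longrightarrow> s \<in> e0 \<Longrightarrow> e0 \<notin> A \<Longrightarrow> card F < card A"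
proof -
  have "F \<subseteq> {f \<in> faces V E. s \<in> f}" using F fcyc_face by blast
  then show finF: "finite F" using finite_faces_at[OF s] finite_subset by blast
  have finA: "finite A" using A finite_edges_at finite_subset by blast
  have "card {e \<in> A. e \<subseteq> f} = 2" if "f \<in> F" for f
  proof -
    have "{e \<in> A. e \<subseteq> f} = {e \<in> E. s \<in> e \<and> e \<subseteq> f}" using A FA that by blast
    then show ?thesis using fcyc_two_edges F[OF that] s by auto
  qed
  then have "\<forall>f\<in>F. card {e \<in> A. e \<subseteq> f} = 2" by blast
  then have sum: "(\<Sum>e\<in>A. card {f \<in> F. e \<subseteq> f}) = 2 * card F"
    using sum_multicount_gen[OF finA finF, of "(\<subseteq>)" "\<lambda>_. 2"] by simp
  have le2: "card {f \<in> F. e \<subseteq> f} \<le> 2" if "e \<in> A" for e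
  proof -
    have "e \<in> E" using that A by blast
    have "card {f \<in> F. e \<subseteq> f} \<le> card {f \<in> faces V E. e \<subseteq> f}"
      using F fcyc_face by (intro card_mono edge_two_faces(1) \<open>e \<in> E\<close>) blast
    then show ?thesis using edge_two_faces(2)[OF \<open>e \<in> E\<close>] by linarith
  qed
  have "(\<Sum>e\<in>A. card {f \<in> F. e \<subseteq> f}) \<le> (\<Sum>e\<in>A. 2)" using le2 by (rule sum_mono)
  then show "card F \<le> card A" using sum by simp
  assume h: "A \<noteq> {}" "e0 \<in> E" "s \<in> e0" "e0 \<notin> A"
  obtain e where e: "e \<in> A" "\<not> (\<exists>f\<in>F. \<exists>g\<in>F. f \<noteq> g \<and> e \<subseteq> f \<and> e \<subseteq> g)"
  proof (rule ccontr)
    assume "\<not> thesis"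
    then have "\<exists>f\<in>F. \<exists>g\<in>F. f \<noteq> g \<and> e \<subseteq> f \<and> e \<subseteq> g" if "e \<in> A" for e
      using that \<open>\<And>e. \<lbrakk>e \<in> A; \<not> (\<exists>f\<in>F. \<exists>g\<in>F. f \<noteq> g \<and> e \<subseteq> f \<and> e \<subseteq> g)\<rbrakk> \<Longrightarrow> thesis\<close> by meson
    then have "e0 \<in> A"
      using F FA by (intro faces_around_vertex[OF s A h(1) finF _ _ _ h(2,3)]) auto
    then show False using h(4) by blast
  qed
  have "card {f \<in> F. e \<subseteq> f} < 2"
  proof (rule ccontr)
    assume "\<not> ?thesis"
    then have "2 \<le> card {f \<in> F. e \<subseteq> f}" by simp
    then obtain f g where "f \<in> {f \<in> F. e \<subseteq> f}" "g \<in> {f \<in> F. e \<subseteq> f}" "f \<noteq> g"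
      by (meson card_2_iff' ex_card subsetD)
    then show False using e by blast
  qed
  then have "(\<Sum>e\<in>A. card {f \<in> F. e \<subseteq> f}) < (\<Sum>e\<in>A. 2)"
    using le2 e(1) finA by (intro sum_strict_mono_ex1) auto
  then show "card F < card A" using sum by simp
qed

subsection \<open>Balls and their breadth-first trees\<close>

definition Eb :: "pt \<Rightarrow> nat \<Rightarrow> pt set set" where
  "Eb v n = {e \<in> E. e \<inter> V \<subseteq> ball_n V E v n}"

lemma degree_eq: "v \<in> V \<Longrightarrow> bij_betw (ed v) {w. nb v w} {e \<in> E. v \<in> e}"
  unfolding bij_betw_def
proof
  assume v: "v \<in> V"
  show "inj_on (ed v) {w. nb v w}" using ed_inj by (auto simp: inj_on_def)
  show "ed v ` {w. nb v w} = {e \<in> E. v \<in> e}"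
  proof
    show "{e \<in> E. v \<in> e} \<subseteq> ed v ` {w. nb v w}"
    proof
      fix e assume "e \<in> {e \<in> E. v \<in> e}"
      then obtain w where "nb v w" "e = ed v w" using edge_at[of e v] v by auto
      then show "e \<in> ed v ` {w. nb v w}" by auto
    qed
  qed (auto simp: ed)
qed

lemma card_nb: "v \<in> V \<Longrightarrow> card {w. nb v w} = degree E v"
  using bij_betw_same_card[OF degree_eq] by (simp add: degree_def)

lemma finite_nb: "v \<in> V \<Longrightarrow> finite {w. nb v w}"
  using bij_betw_finite[OF degree_eq] finite_edges_at by blast

lemma finite_ball: assumes "v \<in> V" shows "finite (ball_n V E v n)"
proof (induction n)
  case 0
  have "ball_n V E v 0 \<subseteq> {v}" using d_eq_0[OF assms] by (auto simp: ball_n_def)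
  then show ?case by (rule finite_subset) simp
next
  case (Suc n)
  have "ball_n V E v (Suc n) \<subseteq> ball_n V E v n \<union> (\<Union>u\<in>ball_n V E v n. {w. nb u w})"
  proof
    fix w assume w: "w \<in> ball_n V E v (Suc n)"
    show "w \<in> ball_n V E v n \<union> (\<Union>u\<in>ball_n V E v n. {w. nb u w})"
    proof (cases "d v w = Suc n")
      case True
      then obtain u where "nb u w" "d v u = n" using d_pred[OF assms] w by (auto simp: ball_n_def)
      then show ?thesis using nb_V[of u w] by (auto simp: ball_n_def)
    qed (use w in \<open>auto simp: ball_n_def\<close>)
  qed
  moreover have "finite (\<Union>u\<in>ball_n V E v n. {w. nb u w})"
    using Suc finite_nb by (auto simp: ball_n_def)
  ultimately show ?case using Suc by (meson finite_UnI finite_subset)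
qed

lemma ball_V: "ball_n V E v n \<subseteq> V"
  by (auto simp: ball_n_def)

lemma Eb_E: "Eb v n \<subseteq> E"
  by (auto simp: Eb_def)

lemma finite_Eb: assumes "v \<in> V" shows "finite (Eb v n)"
proof -
  have "Eb v n \<subseteq> (\<Union>u\<in>ball_n V E v n. {e \<in> E. u \<in> e})"
  proof
    fix e assume e: "e \<in> Eb v n"
    then have "e \<in> E" by (simp add: Eb_def)
    then obtain a b where "nb a b" "e = ed a b" "e \<inter> V = {a, b}" by (rule edge_ends)
    then show "e \<in> (\<Union>u\<in>ball_n V E v n. {e \<in> E. u \<in> e})"
      using e \<open>e \<in> E\<close> ed(3)[of a b] by (auto simp: Eb_def)
  qed
  moreover have "finite (\<Union>u\<in>ball_n V E v n. {e \<in> E. u \<in> e})"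
    using finite_ball[OF assms] finite_edges_at by auto
  ultimately show ?thesis by (rule finite_subset)
qed

lemma ed_Eb: "nb a b \<Longrightarrow> ed a b \<in> Eb v n \<longleftrightarrow> d v a \<le> n \<and> d v b \<le> n"
  using ed[of a b] nb_V[of a b] by (auto simp: Eb_def ball_n_def)

lemma Eb_V: "V \<inter> \<Union>(Eb v n) \<subseteq> ball_n V E v n"
  by (auto simp: Eb_def)

lemma ball_Eb: assumes "v \<in> V" "n \<ge> 1" shows "ball_n V E v n \<subseteq> \<Union>(Eb v n)"
proof
  fix w assume w: "w \<in> ball_n V E v n"
  then have wV: "w \<in> V" "d v w \<le> n" by (auto simp: ball_n_def)
  show "w \<in> \<Union>(Eb v n)"
  proof (cases "d v w")
    case 0
    then have "w = v" using d_eq_0 assms wV by auto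
    obtain x where "nb v x" "d v x = Suc (d v v)" using d_away[OF assms(1) assms(1)] .
    then show ?thesis using \<open>w = v\<close> ed_Eb[of v x v n] ed(3)[of v x] assms(2) by auto
  next
    case (Suc k)
    then obtain u where "nb u w" "d v u = k" using d_pred[OF assms(1) wV(1)] by metis
    then show ?thesis using ed_Eb[of u w v n] ed(4)[of u w] wV Suc by auto
  qed
qed

lemma outer_edge_meets_Eb:
  assumes "nb a b" "d v b > n" shows "(ed a b - {a}) \<inter> \<Union>(Eb v n) = {}"
proof -
  have "z \<notin> e'" if z: "z \<in> ed a b" "z \<noteq> a" and e': "e' \<in> Eb v n" for z e'
  proof
    assume "z \<in> e'"
    have "ed a b \<notin> Eb v n" using ed_Eb[OF assms(1)] assms(2) by simp
    then have "ed a b \<noteq> e'" using e' by auto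
    then have "z \<in> V" using edges_meet[OF ed(1)[OF assms(1)], of e'] e' z \<open>z \<in> e'\<close> by (auto simp: Eb_def)
    then have "z = b" using ed(2)[OF assms(1)] z by auto
    then show False using e' \<open>z \<in> e'\<close> \<open>z \<in> V\<close> assms(2) by (auto simp: Eb_def ball_n_def)
  qed
  then show ?thesis by auto
qed

text \<open>From a vertex in \<open>U\<close> a ray leading away from \<open>v\<close> uses only
  edges that avoid the ball, so it never leaves \<open>U\<close>; but a bounded set has only
  finitely many vertices.\<close>

lemma bounded_component_no_vertex:
  assumes v: "v \<in> V" "n \<ge> 1" and U: "U \<in> components (- \<Union>(Eb v n))" "bounded U"
  shows "V \<inter> U = {}"
proof (rule ccontr)
  assume "V \<inter> U \<noteq> {}"
  then obtain w where w: "w \<in> V" "w \<in> U" by auto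
  then have "w \<notin> ball_n V E v n" using ball_Eb[OF v] component_disjoint[OF U(1)] by auto
  then have far: "d v w > n" using w by (auto simp: ball_n_def)
  obtain r where r: "r 0 = w" "\<And>i. nb (r i) (r (Suc i))" "\<And>i. d v (r i) = d v w + i"
    using ray[OF v(1) w(1)] by metis
  have "r i \<in> U" for i
  proof (induction i)
    case (Suc i)
    have n: "nb (r (Suc i)) (r i)" using nb_sym r(2) by blast
    have "(ed (r i) (r (Suc i)) - {r i}) \<inter> \<Union>(Eb v n) = {}"
      using r(3)[of "Suc i"] far by (intro outer_edge_meets_Eb r(2)) simp
    moreover have "r i \<notin> \<Union>(Eb v n)" using Suc component_disjoint[OF U(1)] by auto
    ultimately have "ed (r i) (r (Suc i)) \<subseteq> - \<Union>(Eb v n)" by auto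
    moreover have "connected (ed (r i) (r (Suc i)))" using edge_topology ed(1)[OF r(2)] by blast
    moreover have "U \<inter> ed (r i) (r (Suc i)) \<noteq> {}" using Suc ed(3)[OF r(2)[of i]] by auto
    ultimately have "ed (r i) (r (Suc i)) \<subseteq> U" using components_maximal[OF U(1)] by simp
    then show ?case using ed(4)[OF r(2)[of i]] by auto
  qed (simp add: r w)
  moreover have "r i \<in> V" for i using nb_V(1)[OF r(2)] .
  ultimately have "range r \<subseteq> V \<inter> U" by auto
  moreover have "inj r" by (rule injI) (metis add_left_cancel r(3))
  ultimately show False
    using finite_V_bounded[OF U(2)] by (meson finite_subset range_inj_infinite)
qed

text \<open>Every vertex escapes to infinity away from \<open>v\<close> without meeting the ball again, hence the holes
  of a ball contain no further vertices or edges.\<close>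

lemma bounded_component_face:
  assumes v: "v \<in> V" "n \<ge> 1" and U: "U \<in> components (- \<Union>(Eb v n))" "bounded U"
  shows "U \<in> components (- \<Union>E)"
proof -
  have noV: "V \<inter> U = {}" using bounded_component_no_vertex[OF assms] .
  have "x \<notin> e" if x: "x \<in> U" and e: "e \<in> E" for x e
  proof
    assume "x \<in> e"
    have "e \<notin> Eb v n" using component_disjoint[OF U(1)] x \<open>x \<in> e\<close> by auto
    obtain a' b' where ab': "nb a' b'" "e = ed a' b'" using edge_ends[OF e] by metis
    then have "d v a' > n \<or> d v b' > n" using \<open>e \<notin> Eb v n\<close> ed_Eb[of a' b'] by auto
    then obtain a b where ab: "nb a b" "e = ed a b" "d v b > n"
      using ab' nb_sym[of a' b'] ed_sym[of a' b'] by auto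
    have "e - {a} \<subseteq> - \<Union>(Eb v n)" using outer_edge_meets_Eb[OF ab(1,3)] ab(2) by auto
    moreover have "connected (e - {a})" using edge_parts(1)[OF nb_sym[OF ab(1)]] ab(2) ed_sym[of a b] by simp
    moreover have "x \<noteq> a" using noV x nb_V[OF ab(1)] by auto
    then have "U \<inter> (e - {a}) \<noteq> {}" using x \<open>x \<in> e\<close> by auto
    ultimately have "e - {a} \<subseteq> U" using components_maximal[OF U(1)] by simp
    then have "b \<in> U" using ed(4)[OF ab(1)] ab(2) nb_V[OF ab(1)] by auto
    then show False using noV nb_V[OF ab(1)] by auto
  qed
  then have "U \<subseteq> - \<Union>E" by auto
  moreover have "- \<Union>E \<subseteq> - \<Union>(Eb v n)" using Eb_E by auto
  ultimately show ?thesis using U(1) unfolding in_components_maximal by (meson order_trans)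
qed

section \<open>The breadth-first tree and its complement\<close>

definition par :: "pt \<Rightarrow> pt \<Rightarrow> pt" where
  "par v w = (SOME u. nb u w \<and> Suc (d v u) = d v w)"

lemma par:
  assumes "v \<in> V" "w \<in> V" "w \<noteq> v"
  shows "nb (par v w) w" "Suc (d v (par v w)) = d v w"
proof -
  have "d v w \<noteq> 0" using d_eq_0 assms by auto
  then obtain k where "d v w = Suc k" by (cases "d v w") auto
  then obtain u where "nb u w" "d v u = k" using d_pred[OF assms(1,2)] by metis
  then have "\<exists>u. nb u w \<and> Suc (d v u) = d v w" using \<open>d v w = Suc k\<close> by auto
  then have "nb (par v w) w \<and> Suc (d v (par v w)) = d v w" unfolding par_def by (rule someI_ex)
  then show "nb (par v w) w" "Suc (d v (par v w)) = d v w" by auto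
qed

definition ped :: "pt \<Rightarrow> pt \<Rightarrow> pt set" where
  "ped v w = ed (par v w) w"

definition tree :: "pt \<Rightarrow> nat \<Rightarrow> pt set set" where
  "tree v n = ped v ` (ball_n V E v n - {v})"

lemma ped_inj: assumes "v \<in> V" shows "inj_on (ped v) (V - {v})"
proof (rule inj_onI)
  fix w w' assume w: "w \<in> V - {v}" "w' \<in> V - {v}" "ped v w = ped v w'"
  have p: "nb (par v w) w" "Suc (d v (par v w)) = d v w" "nb (par v w') w'" "Suc (d v (par v w')) = d v w'"
    using par[OF assms] w by auto
  have "{par v w, w} = {par v w', w'}"
    using ed(2)[OF p(1)] ed(2)[OF p(3)] w(3) unfolding ped_def by simp
  then show "w = w'" using p by (auto simp: doubleton_eq_iff)
qed

lemma tree_Eb: assumes "v \<in> V" shows "tree v n \<subseteq> Eb v n"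
proof
  fix e assume "e \<in> tree v n"
  then obtain w where w: "w \<in> V" "w \<noteq> v" "d v w \<le> n" "e = ed (par v w) w"
    by (auto simp: tree_def ped_def ball_n_def)
  then show "e \<in> Eb v n" using par[OF assms w(1,2)] ed_Eb[of "par v w" w v n] by auto
qed

lemma card_tree: assumes "v \<in> V" shows "Suc (card (tree v n)) = card (ball_n V E v n)"
proof -
  have "inj_on (ped v) (ball_n V E v n - {v})"
    by (rule inj_on_subset[OF ped_inj[OF assms]]) (use ball_V in auto)
  then have "card (tree v n) = card (ball_n V E v n - {v})"
    unfolding tree_def by (rule card_image)
  moreover have "v \<in> ball_n V E v n" using assms by (simp add: ball_n_def)
  ultimately show ?thesis using card_Suc_Diff1[OF finite_ball[OF assms]] by simp
qed

definition TR :: "pt set set \<Rightarrow> (pt \<times> pt) set" where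
  "TR T = {(a, b). nb a b \<and> ed a b \<in> T}"

lemma sym_TR: "sym (TR T)"
  unfolding TR_def sym_def using nb_sym ed_sym by auto

lemma tree_connects:
  assumes "v \<in> V" "a \<in> ball_n V E v n" "b \<in> ball_n V E v n"
  shows "(a, b) \<in> (TR (tree v n))\<^sup>*"
proof -
  have *: "(v, w) \<in> (TR (tree v n))\<^sup>*" if "w \<in> ball_n V E v n" for w
    using that
  proof (induction "d v w" arbitrary: w rule: less_induct)
    case less
    then have w: "w \<in> V" "d v w \<le> n" by (auto simp: ball_n_def)
    show ?case
    proof (cases "w = v")
      case False
      note p = par[OF assms(1) w(1) False]
      have "par v w \<in> ball_n V E v n" using p w nb_V[OF p(1)] by (auto simp: ball_n_def)
      then have "(v, par v w) \<in> (TR (tree v n))\<^sup>*" using less(1) p(2) by simp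
      moreover have "(par v w, w) \<in> TR (tree v n)"
        using p(1) less(2) False by (auto simp: TR_def tree_def ped_def)
      ultimately show ?thesis by (rule rtrancl_into_rtrancl)
    qed simp
  qed
  have "(a, v) \<in> (TR (tree v n))\<^sup>*" using *[OF assms(2)] sym_rtrancl[OF sym_TR] by (meson symD)
  then show ?thesis using *[OF assms(3)] by simp
qed

text \<open>Induction over parent-closed sets, removing a vertex \<open>w\<close> farthest from
  \<open>v\<close>. No vertex has \<open>w\<close> as its parent, so the edge of \<open>w\<close>
  meets the rest at most in the parent; an arc does not separate the plane, and Janiszewski combines
  the two. Inserting \<open>v\<close> makes the base case a single point.\<close>

lemma tree_complement_connected_aux:
  assumes v: "v \<in> V" and "finite R" "R \<subseteq> V - {v}" "\<And>w. w \<in> R \<Longrightarrow> par v w \<in> insert v R"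
  shows "connected (- insert v (\<Union>(ped v ` R))) \<and> closed (insert v (\<Union>(ped v ` R)))"
  using assms(2-4)
proof (induction "card R" arbitrary: R)
  case 0
  then have "R = {}" by simp
  then show ?case using connected_punctured_universe[of v] by (simp add: Compl_eq_Diff_UNIV)
next
  case (Suc k)
  then have "R \<noteq> {}" by auto
  obtain w where w: "w \<in> R" "\<And>u. u \<in> R \<Longrightarrow> d v u \<le> d v w"
  proof -
    have fin: "finite (d v ` R)" using Suc.prems(1) by simp
    then have "Max (d v ` R) \<in> d v ` R" using \<open>R \<noteq> {}\<close> by (intro Max_in) auto
    then obtain w where "w \<in> R" "d v w = Max (d v ` R)" by auto
    then show thesis using that[of w] Max_ge[OF fin] by auto
  qed
  define Q where "Q = R - {w}"
  have R: "R = insert w Q" "w \<notin> Q" using w by (auto simp: Q_def)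
  have pR: "nb (par v u) u" "Suc (d v (par v u)) = d v u" if "u \<in> R" for u
    using par[OF v] that Suc.prems by auto
  have "par v u \<noteq> w" if "u \<in> R" for u using pR[OF that] w(2)[OF that] by auto
  then have "connected (- insert v (\<Union>(ped v ` Q))) \<and> closed (insert v (\<Union>(ped v ` Q)))"
  proof (intro Suc.hyps(1))
    show "k = card Q" using Suc.hyps(2) R Suc.prems(1) by auto
    show "finite Q" "Q \<subseteq> V - {v}" using Suc.prems(1,2) by (auto simp: Q_def)
    show "par v u \<in> insert v Q" if "u \<in> Q" for u
      using Suc.prems(3)[of u] that \<open>\<And>u. u \<in> R \<Longrightarrow> par v u \<noteq> w\<close>[of u] by (simp add: Q_def)
  qed
  then have IH: "connected (- insert v (\<Union>(ped v ` Q)))" "closed (insert v (\<Union>(ped v ` Q)))" by auto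
  let ?H = "insert v (\<Union>(ped v ` Q))" and ?e = "ped v w"
  have e: "?e \<in> E" "?e \<inter> V = {par v w, w}" using ed[OF pR(1)[OF w(1)]] by (auto simp: ped_def)
  have sub: "?e \<inter> ?H \<subseteq> {par v w}"
  proof
    fix z assume z: "z \<in> ?e \<inter> ?H"
    show "z \<in> {par v w}"
    proof (cases "z = v")
      case True
      then show ?thesis using z e v w(1) Suc.prems(2) by auto
    next
      case False
      then obtain u where u: "u \<in> Q" "z \<in> ped v u" using z by auto
      then have uR: "u \<in> R" "u \<noteq> w" using R by auto
      have eu: "ped v u \<in> E" "ped v u \<inter> V = {par v u, u}"
        using ed[OF pR(1)[OF uR(1)]] by (auto simp: ped_def)
      have "ped v u \<noteq> ?e"
        using inj_onD[OF ped_inj[OF v], of u w] uR w(1) Suc.prems(2) by auto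
      then have "z \<in> V" using edges_meet[OF eu(1) e(1)] u z by auto
      then have "z \<in> {par v w, w}" "z \<in> {par v u, u}" using e eu z u by auto
      then show ?thesis using uR \<open>\<And>u. u \<in> R \<Longrightarrow> par v u \<noteq> w\<close>[OF uR(1)] by auto
    qed
  qed
  then have con: "connected (?e \<inter> ?H)"
    by (metis connected_empty connected_sing subset_singletonD)
  obtain g where "arc g" "path_image g = ?e" using edge_arc[OF e(1)] by metis
  then have ce: "connected (- ?e)" using connected_arc_complement[of g] by auto
  have "connected_component (- (?e \<union> ?H)) p q" if "p \<in> - (?e \<union> ?H)" "q \<in> - (?e \<union> ?H)" for p q
  proof (rule plane_Janiszewski[OF _ IH(2) con])
    show "compact ?e" using edge_topology e by auto
    show "connected_component (- ?e) p q" using ce that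
      unfolding connected_component_def by (intro exI[of _ "- ?e"]) auto
    show "connected_component (- ?H) p q" using IH(1) that
      unfolding connected_component_def by (intro exI[of _ "- ?H"]) auto
  qed
  then have "connected (- (?e \<union> ?H))" by (simp add: connected_iff_connected_component)
  moreover have "?e \<union> ?H = insert v (\<Union>(ped v ` R))" using R by auto
  moreover have "closed (?e \<union> ?H)" using edge_topology(2)[OF e(1)] IH(2) by (rule closed_Un)
  ultimately show ?case by simp
qed

lemma tree_complement_connected:
  assumes "v \<in> V" "n \<ge> 1" shows "connected (- \<Union>(tree v n))"
proof -
  let ?R = "ball_n V E v n - {v}"
  have "par v w \<in> insert v ?R" if "w \<in> ?R" for w
    using par[OF assms(1), of w] that nb_V[of "par v w" w] by (auto simp: ball_n_def)
  moreover have "?R \<subseteq> V - {v}" "finite ?R" using ball_V finite_ball[OF assms(1)] by auto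
  ultimately have "connected (- insert v (\<Union>(ped v ` ?R)))"
    using tree_complement_connected_aux[OF assms(1)] by meson
  moreover have "v \<in> \<Union>(tree v n)"
  proof -
    obtain x where x: "nb v x" "d v x = Suc (d v v)" using d_away[OF assms(1) assms(1)] .
    then have xV: "x \<in> V" "x \<noteq> v" "x \<in> ?R" using nb_V[OF x(1)] assms(2) by (auto simp: ball_n_def)
    have "d v (par v x) = 0" using par[OF assms(1) xV(1,2)] x by simp
    then have "par v x = v" using d_eq_0 assms(1) nb_V[OF par(1)[OF assms(1) xV(1,2)]] by auto
    then have "v \<in> ped v x" unfolding ped_def using ed(3)[OF x(1)] by simp
    then show ?thesis using xV by (auto simp: tree_def)
  qed
  ultimately show ?thesis by (simp add: tree_def insert_absorb)
qed

subsection \<open>Counting the holes of a ball\<close>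

lemma TR_path:
  assumes "successively (\<lambda>u v. (u, v) \<in> TR T) ps"
  shows "walk ps" "pedges ps \<subseteq> T"
  using assms by (induction ps rule: induct_list012) (auto simp: TR_def)

text \<open>The new edge closes up a simple path in \<open>T\<close> between its ends. That path has
  at least three vertices, as otherwise it would be the edge itself, which is not in
  \<open>T\<close>.\<close>

lemma closing_cycle:
  assumes "nb a b" "ed a b \<notin> T" "(a, b) \<in> (TR T)\<^sup>*"
  obtains vs where "cyc vs" "walk vs" "distinct vs" "pedges vs \<subseteq> T" "cedges vs = insert (ed a b) (pedges vs)"
    "length vs \<ge> 2" "{a, b} \<subseteq> set vs"
proof -
  obtain vs where vs: "vs \<noteq> []" "hd vs = a" "last vs = b" "distinct vs" "successively (\<lambda>u v. (u, v) \<in> TR T) vs"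
    using assms(3) by (rule rtrancl_distinct_path)
  note p = TR_path[OF vs(5)]
  obtain qs where qs: "vs = qs @ [b]" using vs(1,3) by (metis append_butlast_last_id)
  have ce: "cedges vs = insert (ed a b) (pedges vs)"
    unfolding cedges_def vs(2) using pedges_append[of qs b "[a]"] qs ed_sym[of a b] by auto
  have "length vs \<ge> 3"
  proof (rule ccontr)
    assume "\<not> ?thesis"
    then have "length vs \<le> 2" by simp
    moreover have "length vs \<noteq> 0" using vs(1) by simp
    ultimately consider "length vs = 1" | "length vs = 2" by linarith
    then show False
    proof cases
      case 1
      then have "a = b" using vs(2,3) by (cases vs) auto
      then show False using nb_V[OF assms(1)] by simp
    next
      case 2
      then obtain x y where "vs = [x, y]" by (auto simp: length_Suc_conv numeral_2_eq_2)
      then have "pedges vs = {ed a b}" using vs(2,3) by simp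
      then show False using p(2) assms(2) by simp
    qed
  qed
  moreover have "walk (vs @ [hd vs])"
    using p(1) vs nb_sym[OF assms(1)] by (simp add: successively_append_iff)
  ultimately have "cyc vs" using vs(4) by (simp add: cyc_def)
  moreover have "{a, b} \<subseteq> set vs" using vs(1-3) by auto
  ultimately show thesis using that[of vs] p vs(4) ce \<open>length vs \<ge> 3\<close> by auto
qed

lemma closing_cycle_meets:
  assumes "cyc vs" "walk vs" "pedges vs \<subseteq> T" "cedges vs = insert e (pedges vs)" "length vs \<ge> 2"
    "e \<in> E" "F \<subseteq> E" "T \<subseteq> F" "e \<notin> F"
  shows "cimg vs \<inter> \<Union>F = pimg vs" "cimg vs = pimg vs \<union> e"
proof -
  have pi: "pimg vs = \<Union>(pedges vs)" using pimg_eq[OF assms(2,5)] .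
  then show ci: "cimg vs = pimg vs \<union> e" unfolding cimg_def assms(4) by auto
  have "z \<in> pimg vs" if "z \<in> e" "f \<in> F" "z \<in> f" for z f
  proof -
    have "z \<in> V" using edges_meet[of e f] assms that by auto
    then have "z \<in> set vs" using cimg_V[OF assms(1)] ci that by auto
    then show ?thesis by (simp add: pimg_def)
  qed
  moreover have "pimg vs \<subseteq> \<Union>F" using pi assms(3,8) by auto
  ultimately show "cimg vs \<inter> \<Union>F = pimg vs" unfolding ci by auto
qed

text \<open>Each edge outside the tree closes a cycle, and splits the region that contains it into a part
  inside and a part outside of this cycle.\<close>

lemma enclosed_components:
  assumes "finite A" "A \<subseteq> E" "T \<subseteq> E" "T \<inter> A = {}"
    and "\<And>a b. nb a b \<Longrightarrow> ed a b \<in> A \<Longrightarrow> (a, b) \<in> (TR T)\<^sup>*"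
  shows "\<exists>S. S \<subseteq> components (- \<Union>(T \<union> A)) \<and> finite S \<and> card S = card A
    \<and> (\<forall>U\<in>S. \<exists>vs. cyc vs \<and> U \<subseteq> inside (cimg vs))"
  using assms
proof (induction A rule: finite_induct)
  case empty
  then show ?case by (intro exI[of _ "{}"]) auto
next
  case (insert e A)
  let ?F = "T \<union> A"
  obtain S where S: "S \<subseteq> components (- \<Union>?F)" "finite S" "card S = card A"
     "\<forall>U\<in>S. \<exists>vs. cyc vs \<and> U \<subseteq> inside (cimg vs)"
    using insert by auto
  have FE: "?F \<subseteq> E" "insert e ?F \<subseteq> E" "e \<in> E" "e \<notin> ?F" using insert by auto
  obtain a b where ab: "nb a b" "e = ed a b" "e \<inter> V = {a, b}" using edge_ends[OF FE(3)] .
  then have abT: "(a, b) \<in> (TR T)\<^sup>*" "ed a b \<notin> T" using insert.prems(4)[OF ab(1)] insert.prems by auto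
  obtain vs where vs: "cyc vs" "walk vs" "distinct vs" "pedges vs \<subseteq> T" "cedges vs = insert e (pedges vs)"
    "length vs \<ge> 2" "{a, b} \<subseteq> set vs"
    using closing_cycle[OF ab(1) abT(2,1)] ab(2) by metis
  note C = closing_cycle_meets[OF vs(1,2,4,5,6) FE(3,1) _ FE(4)]
  obtain y where y: "y \<in> e" "y \<notin> V" using edge_parts(4)[OF ab(1)] ab by auto
  have open_e: "(e - {a, b}) \<inter> \<Union>?F = {}"
  proof -
    have "z \<in> V" if "z \<in> e" "f \<in> ?F" "z \<in> f" for z f
    proof -
      have "f \<in> E" "e \<noteq> f" using FE that(2) by auto
      then show ?thesis using edges_meet[OF FE(3)] that by auto
    qed
    then show ?thesis using ab(3) by auto
  qed
  have "y \<in> - \<Union>?F" using open_e y ab(3) by auto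
  then obtain U where U: "U \<in> components (- \<Union>?F)" "y \<in> U" by (metis UnionE Union_components)
  have "connected (e - {a, b})" using edge_parts(2)[OF ab(1)] ab(2) by simp
  then have eU: "e - {a, b} \<subseteq> U"
  proof (rule components_maximal[OF U(1)])
    show "e - {a, b} \<subseteq> - \<Union>?F" using open_e by auto
    have "y \<in> e - {a, b}" using y ab(3) by auto
    then show "U \<inter> (e - {a, b}) \<noteq> {}" using U(2) by auto
  qed
  have abF: "{a, b} \<subseteq> \<Union>?F"
    using set_subset_pedges[OF vs(2,6)] vs(4,7) by blast
  have yC: "y \<in> cimg vs" using C(2) y by auto
  have openU: "open U" using open_component[OF FE(1) U(1)] .
  have meets: "\<exists>p. p \<in> X \<and> p \<in> U" if "y \<in> closure X" for X
  proof -
    have "U \<inter> X \<noteq> {}" using open_Int_closure_eq_empty[OF openU, of X] that U(2) by auto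
    then show ?thesis by auto
  qed
  have newc: "\<exists>W. W \<in> components (- \<Union>(insert e ?F)) \<and> W \<subseteq> U \<and> p \<in> W"
    if p: "p \<in> U" "p \<notin> cimg vs" for p
  proof -
    have "p \<notin> e" using p C(2) by auto
    then have "p \<in> - \<Union>(insert e ?F)" using p component_disjoint[OF U(1)] by auto
    then obtain W where W: "W \<in> components (- \<Union>(insert e ?F))" "p \<in> W" by (metis UnionE Union_components)
    have "W \<subseteq> - \<Union>?F" using component_disjoint[OF W(1)] by auto
    then have "W \<subseteq> U" using components_maximal[OF U(1) in_components_connected[OF W(1)]] p W by auto
    then show ?thesis using W by auto
  qed
  \<comment> \<open>The point \<open>y\<close> lies on the closing cycle, hence in the closure of
    its inside and of its outside, and \<open>U\<close> is an open neighbourhood of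
    \<open>y\<close>. So \<open>U\<close> contains points of both sides.\<close>
  obtain p1 where p1: "p1 \<in> inside (cimg vs)" "p1 \<in> U"
    using meets[of "inside (cimg vs)"] cyc_Jordan(7)[OF vs(1)] yC by auto
  obtain p2 where p2: "p2 \<in> outside (cimg vs)" "p2 \<in> U"
    using meets[of "outside (cimg vs)"] cyc_Jordan(8)[OF vs(1)] yC by auto
  have p12: "p1 \<notin> cimg vs" "p2 \<notin> cimg vs" "p2 \<notin> inside (cimg vs)"
    using p1 p2 inside_Un_outside[of "cimg vs"] inside_Int_outside[of "cimg vs"] by blast+
  obtain W1 where W1: "W1 \<in> components (- \<Union>(insert e ?F))" "W1 \<subseteq> U" "p1 \<in> W1"
    using newc[OF p1(2) p12(1)] by auto
  obtain W2 where W2: "W2 \<in> components (- \<Union>(insert e ?F))" "W2 \<subseteq> U" "p2 \<in> W2"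
    using newc[OF p2(2) p12(2)] by auto
  have "cimg vs \<subseteq> \<Union>(insert e ?F)" unfolding cimg_def vs(5) using vs(4) by auto
  then have "W1 \<inter> cimg vs = {}" using component_disjoint[OF W1(1)] by auto
  then have W1in: "W1 \<subseteq> inside (cimg vs)"
    using connected_meets_inside[OF vs(1) in_components_connected[OF W1(1)]] p1 W1 by auto
  then have "W1 \<noteq> W2" using W2(3) p12(3) by auto
  have old: "X \<in> components (- \<Union>(insert e ?F))" if X: "X \<in> components (- \<Union>?F)" "X \<noteq> U" for X
  proof -
    have "X \<inter> U = {}" using components_nonoverlap[OF X(1) U(1)] X(2) by simp
    then have "X \<inter> e = {}" using eU abF component_disjoint[OF X(1)] by blast
    then have "X \<subseteq> - \<Union>(insert e ?F)" using component_disjoint[OF X(1)] by auto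
    moreover have "- \<Union>(insert e ?F) \<subseteq> - \<Union>?F" by auto
    ultimately show ?thesis using X(1) unfolding in_components_maximal by (meson order_trans)
  qed
  have notin: "W \<notin> S - {U}" if "W \<subseteq> U" "p \<in> W" for W p
  proof
    assume "W \<in> S - {U}"
    then have "W \<in> components (- \<Union>?F)" "W \<noteq> U" using S(1) by auto
    then have "W \<inter> U = {}" using components_nonoverlap[OF _ U(1)] by simp
    then show False using that by auto
  qed
  \<comment> \<open>If \<open>U\<close> was already selected, it is enclosed by some cycle and so
    are both parts replacing it. Otherwise only the part inside the new cycle is known to be
    enclosed and is added. The selection grows by one either way.\<close>
  show ?case
  proof (cases "U \<in> S")
    case True
    define S' where "S' = insert W1 (insert W2 (S - {U}))"
    have "card S' = Suc (Suc (card (S - {U})))"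
      unfolding S'_def using S(2) notin[OF W1(2,3)] notin[OF W2(2,3)] \<open>W1 \<noteq> W2\<close> by auto
    then have "card S' = Suc (card S)" using card_Suc_Diff1[OF S(2) True] by simp
    moreover have "S' \<subseteq> components (- \<Union>(insert e ?F))"
      unfolding S'_def using W1 W2 old S(1) by auto
    moreover have "\<exists>vs. cyc vs \<and> X \<subseteq> inside (cimg vs)" if X: "X \<in> S'" for X
    proof -
      obtain ws where "cyc ws" "U \<subseteq> inside (cimg ws)" using S(4) True by auto
      then show ?thesis using X W1(2) W2(2) S(4) unfolding S'_def by auto
    qed
    ultimately show ?thesis using insert.hyps S(2,3) by (intro exI[of _ S']) (auto simp: S'_def)
  next
    case False
    define S' where "S' = insert W1 S"
    have "S - {U} = S" using False by simp
    then have "card S' = Suc (card S)" unfolding S'_def using S(2) notin[OF W1(2,3)] by simp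
    moreover have "S' \<subseteq> components (- \<Union>(insert e ?F))"
      unfolding S'_def using W1 old S(1) False by auto
    moreover have "\<exists>vs. cyc vs \<and> X \<subseteq> inside (cimg vs)" if X: "X \<in> S'" for X
      using X W1in vs(1) S(4) unfolding S'_def by auto
    ultimately show ?thesis using insert.hyps S(2,3) by (intro exI[of _ S']) (auto simp: S'_def)
  qed
qed

text \<open>Edges are added one at a time to the tree. Two points outside the closing cycle are not
  separated by it, nor by the old graph according to the induction hypothesis, and the two sets meet
  in an arc; Janiszewski then joins the points off the union.\<close>

lemma unenclosed_connected:
  assumes "finite A" "A \<subseteq> E" "T \<subseteq> E" "T \<inter> A = {}" "connected (- \<Union>T)"
    and "\<And>a b. nb a b \<Longrightarrow> ed a b \<in> A \<Longrightarrow> (a, b) \<in> (TR T)\<^sup>*"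
    and "p \<notin> \<Union>(T \<union> A)" "q \<notin> \<Union>(T \<union> A)"
    and "\<And>vs. cyc vs \<Longrightarrow> cedges vs \<subseteq> T \<union> A \<Longrightarrow> p \<notin> inside (cimg vs) \<and> q \<notin> inside (cimg vs)"
  shows "connected_component (- \<Union>(T \<union> A)) p q"
  using assms
proof (induction A rule: finite_induct)
  case empty
  then show ?case unfolding connected_component_def by (intro exI[of _ "- \<Union>T"]) auto
next
  case (insert e A)
  let ?F = "T \<union> A"
  have FE: "?F \<subseteq> E" "insert e ?F \<subseteq> E" "e \<in> E" "e \<notin> ?F" using insert by auto
  obtain a b where ab: "nb a b" "e = ed a b" "e \<inter> V = {a, b}" using edge_ends[OF FE(3)] .
  then have abT: "(a, b) \<in> (TR T)\<^sup>*" "ed a b \<notin> T" using insert.prems(5)[OF ab(1)] insert.prems by auto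
  obtain vs where vs: "cyc vs" "walk vs" "distinct vs" "pedges vs \<subseteq> T" "cedges vs = insert e (pedges vs)"
    "length vs \<ge> 2" "{a, b} \<subseteq> set vs"
    using closing_cycle[OF ab(1) abT(2,1)] ab(2) by metis
  note C = closing_cycle_meets[OF vs(1,2,4,5,6) FE(3,1) _ FE(4)]
  have "connected_component (- \<Union>?F) p q"
  proof (rule insert.IH)
    show "A \<subseteq> E" "T \<subseteq> E" "T \<inter> A = {}" "connected (- \<Union>T)" using insert.prems(1-4) by auto
    show "(a, b) \<in> (TR T)\<^sup>*" if "nb a b" "ed a b \<in> A" for a b
      using insert.prems(5)[OF that(1)] that(2) by simp
    show "p \<notin> \<Union>?F" "q \<notin> \<Union>?F" using insert.prems(6,7) by auto
    show "p \<notin> inside (cimg ws) \<and> q \<notin> inside (cimg ws)" if ws: "cyc ws" "cedges ws \<subseteq> ?F" for ws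
    proof (rule insert.prems(8)[OF ws(1)])
      show "cedges ws \<subseteq> T \<union> insert e A" using ws(2) by auto
    qed
  qed
  moreover have "connected_component (- cimg vs) p q"
  proof -
    have "cedges vs \<subseteq> T \<union> insert e A" using vs(4,5) by auto
    then have "p \<notin> inside (cimg vs)" "q \<notin> inside (cimg vs)" using insert.prems(8)[OF vs(1)] by auto
    moreover have "cimg vs \<subseteq> \<Union>(T \<union> insert e A)" unfolding cimg_def vs(5) using vs(4) by auto
    then have "p \<notin> cimg vs" "q \<notin> cimg vs" using insert.prems(6,7) by auto
    ultimately have "p \<in> outside (cimg vs)" "q \<in> outside (cimg vs)"
      using inside_Un_outside[of "cimg vs"] by blast+
    moreover have "outside (cimg vs) \<subseteq> - cimg vs" using outside_no_overlap[of "cimg vs"] by blast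
    ultimately show ?thesis
      unfolding connected_component_def using cyc_Jordan(4)[OF vs(1)]
      by (intro exI[of _ "outside (cimg vs)"]) auto
  qed
  moreover have "connected (cimg vs \<inter> \<Union>?F)"
  proof -
    obtain g where "arc g" "path_image g = pimg vs" using pimg_arc[OF vs(3,2,6)] by metis
    then show ?thesis using C(1) connected_arc_image[of g] by auto
  qed
  ultimately have "connected_component (- (cimg vs \<union> \<Union>?F)) p q"
    using cyc_Jordan(9)[OF vs(1)] closed_Union_edges[OF FE(1)] by (intro plane_Janiszewski)
  moreover have "cimg vs \<union> \<Union>?F = \<Union>(T \<union> insert e A)"
    unfolding cimg_def vs(5) using vs(4) by auto
  ultimately show ?case by (simp only:)
qed

lemma nontree_edge:
  assumes "v \<in> V" "nb a b" "ed a b \<in> Eb v n - tree v n" shows "(a, b) \<in> (TR (tree v n))\<^sup>*"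
  using assms ed_Eb[OF assms(2), of v n] nb_V[OF assms(2)]
  by (intro tree_connects) (auto simp: ball_n_def)

text \<open>One hole for each edge outside the tree, whose size is one less than that of the ball.
  The frontier of a hole lies on edges of the induced subgraph, so all vertices of the face are in
  the ball.\<close>

lemma ball_faces:
  assumes "v \<in> V" "n \<ge> 1"
  obtains F where "finite F" "card F + card (ball_n V E v n) = card (Eb v n) + 1"
    "\<And>f. f \<in> F \<Longrightarrow> (\<exists>vs. fcyc f vs) \<and> V \<inter> f \<subseteq> ball_n V E v n"
proof -
  let ?T = "tree v n" and ?A = "Eb v n - tree v n"
  have T: "?T \<subseteq> Eb v n" using tree_Eb[OF assms(1)] .
  then have TA: "?T \<union> ?A = Eb v n" "?T \<subseteq> E" "?A \<subseteq> E" using Eb_E by auto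
  obtain S where S: "S \<subseteq> components (- \<Union>(Eb v n))" "finite S" "card S = card ?A"
      "\<forall>U\<in>S. \<exists>vs. cyc vs \<and> U \<subseteq> inside (cimg vs)"
    using enclosed_components[OF _ TA(3,2) _ nontree_edge[OF assms(1)]] finite_Eb[OF assms(1), of n]
    unfolding TA(1) by (metis Diff_disjoint finite_Diff)
  have S': "U \<in> components (- \<Union>E)" "\<exists>ws. fcyc (closure U) ws" if U: "U \<in> S" for U
  proof -
    obtain vs where vs: "cyc vs" "U \<subseteq> inside (cimg vs)" using S(4) U by auto
    then have "bounded U" using cyc_Jordan(6) bounded_subset by blast
    then show c: "U \<in> components (- \<Union>E)" using bounded_component_face[OF assms] S(1) U by auto
    show "\<exists>ws. fcyc (closure U) ws" using enclosed_fcyc[OF c vs] by metis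
  qed
  define F where "F = closure ` S"
  have "inj_on closure S" using closure_component_inj S'(1) by (auto intro!: inj_onI)
  then have cF: "card F = card S" unfolding F_def by (rule card_image)
  have "card ?A + card ?T = card (Eb v n)"
    using card_Diff_subset[OF _ T] card_mono[OF finite_Eb[OF assms(1)] T] finite_subset[OF T finite_Eb[OF assms(1)]]
    by simp
  then have "card F + card (ball_n V E v n) = card (Eb v n) + 1"
    using cF S(3) card_tree[OF assms(1), of n] by simp
  moreover have "(\<exists>vs. fcyc f vs) \<and> V \<inter> f \<subseteq> ball_n V E v n" if f: "f \<in> F" for f
  proof -
    obtain U where U: "U \<in> S" "f = closure U" using f by (auto simp: F_def)
    have "f = U \<union> frontier U" using U closure_Un_frontier by auto
    moreover have "V \<inter> U = {}" using component_disjoint[OF S'(1)[OF U(1)]] V_subset by auto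
    moreover have "frontier U \<subseteq> \<Union>(Eb v n)" using frontier_component[OF Eb_E] S(1) U(1) by (metis subsetD)
    ultimately have "V \<inter> f \<subseteq> ball_n V E v n" using Eb_V[of v n] by auto
    then show ?thesis using S'(2)[OF U(1)] U(2) by auto
  qed
  ultimately show thesis using that[of F] S(2) by (auto simp: F_def)
qed

text \<open>A ball containing all vertices of the face carries the whole frontier of its component
  \<open>U\<close>, so nothing connected can leave \<open>U\<close> while avoiding the edges of the
  ball. If no cycle enclosed \<open>p\<close>, it could be joined off these edges to a vertex beyond
  the ball, and \<open>U\<close> would contain a vertex.\<close>

lemma finite_face_fcyc:
  assumes f: "f \<in> faces V E" and fin: "finite (V \<inter> f)"
  obtains vs where "fcyc f vs"
proof -
  obtain U where U: "U \<in> components (- \<Union>E)" "f = closure U" using f by (auto simp: faces_eq)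
  obtain v where v: "v \<in> V" using conn by (auto simp: graph_connected_def)
  obtain k where "\<forall>x \<in> d v ` (V \<inter> f). x \<le> k" using fin finite_nat_set_iff_bounded_le by blast
  then have k: "\<And>w. w \<in> V \<Longrightarrow> w \<in> f \<Longrightarrow> d v w \<le> k" by auto
  define n where "n = Suc k"
  have n: "n \<ge> 1" "V \<inter> f \<subseteq> ball_n V E v n" using k by (auto simp: n_def ball_n_def le_SucI)
  have fr: "frontier U \<subseteq> \<Union>(Eb v n)"
  proof
    fix x assume x: "x \<in> frontier U"
    then have xf: "x \<in> f" using U(2) by (auto simp: frontier_def)
    obtain e where e: "e \<in> E" "x \<in> e" using x frontier_component[OF order_refl U(1)] by auto
    show "x \<in> \<Union>(Eb v n)"
    proof (cases "x \<in> V")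
      case True
      then show ?thesis using xf n ball_Eb[OF v n(1)] by auto
    next
      case False
      then have "e \<subseteq> f" using closure_contains_edge[OF U(1) e] xf U(2) by simp
      then have "e \<in> Eb v n" using e n by (auto simp: Eb_def)
      then show ?thesis using e by auto
    qed
  qed
  have Udis: "U \<inter> \<Union>E = {}" using component_disjoint[OF U(1)] .
  obtain p where p: "p \<in> U" using in_components_nonempty[OF U(1)] by auto
  have closed_up: "D \<subseteq> U" if D: "connected D" "D \<subseteq> - \<Union>(Eb v n)" "p \<in> D" for D
  proof (rule ccontr)
    assume "\<not> D \<subseteq> U"
    then have "D \<inter> frontier U \<noteq> {}" using D p by (intro connected_Int_frontier) auto
    then show False using fr D by auto
  qed
  show thesis
  proof (cases "\<exists>vs. cyc vs \<and> p \<in> inside (cimg vs)")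
    case True
    then obtain vs where vs: "cyc vs" "p \<in> inside (cimg vs)" by auto
    have "U \<inter> cimg vs = {}" using cimg_E[OF vs(1)] Udis by auto
    then have "U \<subseteq> inside (cimg vs)"
      using connected_meets_inside[OF vs(1) in_components_connected[OF U(1)]] vs(2) p by auto
    then show thesis using enclosed_fcyc[OF U(1) vs(1)] U(2) that by auto
  next
    case False
    obtain r where r: "r 0 = v" "\<And>i. nb (r i) (r (Suc i))" "\<And>i. d v (r i) = d v v + i"
      using ray[OF v v] by metis
    define w where "w = r (Suc n)"
    have w: "w \<in> V" "d v w > n" using nb_V[OF r(2)] r(3) by (auto simp: w_def)
    then have wE: "w \<notin> \<Union>(Eb v n)" using Eb_V[of v n] by (auto simp: ball_n_def)
    \<comment> \<open>A cycle of the ball around \<open>w\<close> would make its component bounded,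
      but bounded components contain no vertices.\<close>
    have notw: "w \<notin> inside (cimg vs)" if vs: "cyc vs" "cedges vs \<subseteq> Eb v n" for vs
    proof
      assume wi: "w \<in> inside (cimg vs)"
      obtain W where W: "W \<in> components (- \<Union>(Eb v n))" "w \<in> W"
        using wE by (metis ComplI UnionE Union_components)
      have "cimg vs \<subseteq> \<Union>(Eb v n)" unfolding cimg_def using vs(2) by auto
      then have "W \<inter> cimg vs = {}" using component_disjoint[OF W(1)] by auto
      then have "W \<subseteq> inside (cimg vs)"
        using connected_meets_inside[OF vs(1) in_components_connected[OF W(1)]] W(2) wi by auto
      then have "bounded W" using cyc_Jordan(6)[OF vs(1)] bounded_subset by blast
      then have "V \<inter> W = {}" using bounded_component_no_vertex[OF v n(1) W(1)] by simp
      then show False using w W(2) by auto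
    qed
    let ?T = "tree v n" and ?A = "Eb v n - tree v n"
    have T: "?T \<subseteq> Eb v n" using tree_Eb[OF v] .
    then have TA: "?T \<union> ?A = Eb v n" "?T \<subseteq> E" "?A \<subseteq> E" using Eb_E by auto
    have "p \<notin> \<Union>(Eb v n)" using Udis p Eb_E[of v n] by auto
    have "connected_component (- \<Union>(?T \<union> ?A)) p w"
    proof (rule unenclosed_connected[OF _ TA(3,2) _ tree_complement_connected[OF v n(1)] nontree_edge[OF v]])
      show "finite ?A" using finite_Eb[OF v, of n] by simp
      show "?T \<inter> ?A = {}" by simp
      show "p \<notin> \<Union>(?T \<union> ?A)" "w \<notin> \<Union>(?T \<union> ?A)"
        unfolding TA(1) by fact+
      show "p \<notin> inside (cimg vs) \<and> w \<notin> inside (cimg vs)" if vs: "cyc vs" "cedges vs \<subseteq> ?T \<union> ?A" for vs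
        using False notw[of vs] vs unfolding TA(1) by simp
    qed
    then have "connected_component (- \<Union>(Eb v n)) p w" unfolding TA(1) .
    then obtain D where "connected D" "D \<subseteq> - \<Union>(Eb v n)" "p \<in> D" "w \<in> D"
      by (auto simp: connected_component_def)
    then have "w \<in> U" using closed_up by auto
    then show thesis using Udis V_subset w by auto
  qed
qed

subsection \<open>Curvature and growth\<close>

lemma finite_faceE:
  assumes "f \<in> faces V E" "finite_face V E f" obtains vs where "fcyc f vs"
proof -
  obtain ws where "closed_boundary_walk V E f ws" using assms(2) by (auto simp: finite_face_def)
  then have "V \<inter> f \<subseteq> set ws" by (simp add: closed_boundary_walk_def)
  then have "finite (V \<inter> f)" by (rule finite_subset) simp
  then show thesis using finite_face_fcyc[OF assms(1)] that by metis
qed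

lemma corner_term_nonneg: "corner_term V E v f \<ge> 0"
  by (simp add: corner_term_def)

text \<open>Makes the real supremum in \<open>graph_curv\<close> a true upper bound. At most
  \<open>degree E v\<close> faces at \<open>v\<close> contribute, each at most 1/3, so the corners
  cannot outweigh half the degree.\<close>

lemma vertex_curv_le_1: assumes "v \<in> V" shows "vertex_curv V E v \<le> 1"
proof -
  let ?A = "{e \<in> E. v \<in> e}" and ?F = "{f \<in> faces V E. v \<in> f}"
  let ?G = "{f \<in> ?F. finite_face V E f}"
  have G: "v \<in> f \<and> (\<exists>vs. fcyc f vs)" if "f \<in> ?G" for f
    using that finite_faceE[of f] by auto
  have "card ?G \<le> card ?A"
    by (rule count_faces_around_vertex(2)[OF assms order_refl G]) auto
  have "(\<Sum>f\<in>?F. corner_term V E v f) = (\<Sum>f\<in>?G. corner_term V E v f)"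
    using finite_faces_at[OF assms] by (intro sum.mono_neutral_right) (auto simp: corner_term_def)
  also have "\<dots> \<le> (\<Sum>f\<in>?G. 1/3)"
  proof (rule sum_mono)
    fix f assume f: "f \<in> ?G"
    then obtain vs where vs: "fcyc f vs" using G by blast
    have "card (V \<inter> f) \<ge> 3" using fcyc_card[OF vs] by simp
    then have "1 / real (card (V \<inter> f)) \<le> 1 / 3" by (intro divide_left_mono) auto
    then show "corner_term V E v f \<le> 1/3" using fcyc_corner(3)[OF vs assms] f by simp
  qed
  also have "\<dots> \<le> real (degree E v) / 3" using \<open>card ?G \<le> card ?A\<close> by (simp add: degree_def)
  finally show ?thesis by (simp add: vertex_curv_def)
qed

lemma vertex_curv_le: "v \<in> V \<Longrightarrow> vertex_curv V E v \<le> graph_curv V E"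
  unfolding graph_curv_def
  by (rule cSUP_upper) (use vertex_curv_le_1 in \<open>auto simp: bdd_above_def\<close>)

abbreviation deg_in :: "pt \<Rightarrow> nat \<Rightarrow> pt \<Rightarrow> nat" where
  "deg_in v n s \<equiv> card {e \<in> Eb v n. s \<in> e}"

lemma ball_decomp:
  assumes "v \<in> V" "n \<ge> 1"
  shows "ball_n V E v n = ball_n V E v (n - 1) \<union> sphere_n V E v n"
    "ball_n V E v (n - 1) \<inter> sphere_n V E v n = {}"
    "finite (ball_n V E v (n - 1))" "finite (sphere_n V E v n)"
proof -
  show 1: "ball_n V E v n = ball_n V E v (n - 1) \<union> sphere_n V E v n"
    using assms(2) by (auto simp: ball_n_def sphere_n_def)
  show "ball_n V E v (n - 1) \<inter> sphere_n V E v n = {}"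
    using assms(2) by (auto simp: ball_n_def sphere_n_def)
  show "finite (ball_n V E v (n - 1))" "finite (sphere_n V E v n)"
    using finite_ball[OF assms(1)] 1 by (auto simp: finite_Un[symmetric] intro: finite_subset[of "sphere_n V E v n" "ball_n V E v n"])
qed

text \<open>All neighbours of a vertex in \<open>B_(n-1)\<close> lie in \<open>B_n\<close>, so only
  vertices of the sphere have fewer edges in the induced subgraph than in the whole graph.\<close>

lemma handshake:
  assumes "v \<in> V" "n \<ge> 1"
  shows "(\<Sum>w\<in>ball_n V E v (n - 1). degree E w) + (\<Sum>s\<in>sphere_n V E v n. deg_in v n s) = 2 * card (Eb v n)"
proof -
  note dc = ball_decomp[OF assms]
  have "card {w \<in> ball_n V E v n. w \<in> e} = 2" if "e \<in> Eb v n" for e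
  proof -
    have "e \<in> E" "e \<inter> V \<subseteq> ball_n V E v n" using that by (auto simp: Eb_def)
    then obtain a b where ab: "nb a b" "e = ed a b" "e \<inter> V = {a, b}" by (meson edge_ends)
    have "{w \<in> ball_n V E v n. w \<in> e} = {a, b}" using ab(3) that ball_V[of v n] by (auto simp: Eb_def)
    then show ?thesis using nb_V(3)[OF ab(1)] by simp
  qed
  then have "\<forall>e\<in>Eb v n. card {w \<in> ball_n V E v n. w \<in> e} = 2" by blast
  then have "(\<Sum>w\<in>ball_n V E v n. deg_in v n w) = 2 * card (Eb v n)"
    using sum_multicount_gen[OF finite_ball[OF assms(1)] finite_Eb[OF assms(1)], of n n "(\<in>)" "\<lambda>_. 2"] by simp
  moreover have "(\<Sum>w\<in>ball_n V E v n. deg_in v n w)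
     = (\<Sum>w\<in>ball_n V E v (n - 1). deg_in v n w) + (\<Sum>s\<in>sphere_n V E v n. deg_in v n s)"
    unfolding dc(1) using dc by (intro sum.union_disjoint) auto
  moreover have "deg_in v n w = degree E w" if "w \<in> ball_n V E v (n - 1)" for w
  proof -
    have w: "w \<in> V" "d v w \<le> n - 1" using that by (auto simp: ball_n_def)
    have "e \<in> Eb v n" if e: "e \<in> E" "w \<in> e" for e
    proof -
      obtain x where x: "nb w x" "e = ed w x" using edge_at[OF e w(1)] .
      then show ?thesis using d_step[OF assms(1) x(1)] ed_Eb[OF x(1)] w assms(2) by auto
    qed
    then have "{e \<in> Eb v n. w \<in> e} = {e \<in> E. w \<in> e}" using Eb_E by auto
    then show ?thesis by (simp add: degree_def)
  qed
  then have "(\<Sum>w\<in>ball_n V E v (n - 1). deg_in v n w) = (\<Sum>w\<in>ball_n V E v (n - 1). degree E w)"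
    by (intro sum.cong) auto
  ultimately show ?thesis by simp
qed

lemma sphere_parent:
  assumes "v \<in> V" "n \<ge> 1" "s \<in> sphere_n V E v n"
  obtains w where "nb w s" "w \<in> ball_n V E v (n - 1)" "ed w s \<in> Eb v n"
proof -
  have s: "s \<in> V" "d v s = Suc (n - 1)" using assms(2,3) by (auto simp: sphere_n_def)
  obtain w where w: "nb w s" "d v w = n - 1" using d_pred[OF assms(1) s] .
  then show thesis using that[of w] nb_V[OF w(1)] s ed_Eb[OF w(1)] assms(2) by (auto simp: ball_n_def)
qed

text \<open>Sum the curvature over \<open>B_(n-1)\<close>, evaluate the degrees by
  \<open>handshake\<close> and the corners of the holes by double counting. Edge counts cancel
  against the number of holes, leaving terms of the sphere and the corners of the faces outside
  \<open>F\<close>.\<close>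

lemma curvature_ball_bound:
  assumes v: "v \<in> V" "n \<ge> 1"
  obtains F where "\<And>f. f \<in> F \<Longrightarrow> (\<exists>vs. fcyc f vs) \<and> V \<inter> f \<subseteq> ball_n V E v n"
    "- 2 * graph_curv V E * real (card (ball_n V E v (n - 1)))
      \<le> real (card (sphere_n V E v n)) - (\<Sum>s\<in>sphere_n V E v n. real (deg_in v n s) - 1) / 3
        - 2 * (\<Sum>w\<in>ball_n V E v (n - 1). \<Sum>f\<in>{f \<in> faces V E. w \<in> f \<and> f \<notin> F}. corner_term V E w f)"
proof -
  let ?B = "ball_n V E v (n - 1)" and ?S = "sphere_n V E v n" and ?Bn = "ball_n V E v n"
  note dc = ball_decomp[OF v]
  obtain F where F: "finite F" "card F + card ?Bn = card (Eb v n) + 1"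
    "\<And>f. f \<in> F \<Longrightarrow> (\<exists>vs. fcyc f vs) \<and> V \<inter> f \<subseteq> ?Bn"
    using ball_faces[OF v] by blast
  have Ff: "f \<in> faces V E" if "f \<in> F" for f using F(3)[OF that] fcyc_face by blast
  define c where "c f = 1 / real (card (V \<inter> f))" for f
  define X where "X = (\<Sum>w\<in>?B. \<Sum>f\<in>{f \<in> faces V E. w \<in> f \<and> f \<notin> F}. corner_term V E w f)"
  \<comment> \<open>The edge from \<open>s\<close> to a vertex of distance \<open>n + 1\<close> is
    not in the induced subgraph, so the strict form of the face count applies.\<close>
  have few: "real (card {f \<in> F. s \<in> f}) \<le> real (deg_in v n s) - 1" if s: "s \<in> ?S" for s
  proof -
    have sV: "s \<in> V" "d v s = n" using s by (auto simp: sphere_n_def)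
    obtain x where x: "nb s x" "d v x = Suc (d v s)" using d_away[OF v(1) sV(1)] .
    have "ed s x \<notin> Eb v n" using ed_Eb[OF x(1)] x(2) sV by auto
    obtain w where w: "nb w s" "ed w s \<in> Eb v n" using sphere_parent[OF v s] by metis
    have "card {f \<in> F. s \<in> f} < deg_in v n s"
    proof (rule count_faces_around_vertex(3)[OF sV(1), where ?e0.0 = "ed s x"])
      show "{e \<in> Eb v n. s \<in> e} \<subseteq> {e \<in> E. s \<in> e}" using Eb_E by auto
      show "{e \<in> Eb v n. s \<in> e} \<noteq> {}" using w ed(4)[OF w(1)] by auto
      show "ed s x \<in> E" "s \<in> ed s x" "ed s x \<notin> {e \<in> Eb v n. s \<in> e}"
        using ed[OF x(1)] \<open>ed s x \<notin> Eb v n\<close> by auto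
      show "s \<in> f \<and> (\<exists>vs. fcyc f vs)" if "f \<in> {f \<in> F. s \<in> f}" for f using that F(3)[of f] by auto
      show "e \<in> {e \<in> Eb v n. s \<in> e}" if "f \<in> {f \<in> F. s \<in> f}" "e \<in> E" "s \<in> e" "e \<subseteq> f" for f e
        using that F(3)[of f] by (auto simp: Eb_def)
    qed
    then show ?thesis by linarith
  qed
  \<comment> \<open>A face of \<open>F\<close> has all its vertices in the ball, so its corners
    there sum to exactly 1.\<close>
  have tot: "(\<Sum>w\<in>?Bn. \<Sum>f\<in>{f \<in> F. w \<in> f}. c f) = real (card F)"
  proof -
    have "(\<Sum>w\<in>?Bn. \<Sum>f\<in>{f \<in> F. w \<in> f}. c f) = (\<Sum>f\<in>F. \<Sum>w\<in>{w \<in> ?Bn. w \<in> f}. c f)"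
      using sum.swap_restrict[OF finite_ball[OF v(1)] F(1)] .
    also have "\<dots> = (\<Sum>f\<in>F. 1)"
    proof (rule sum.cong[OF refl])
      fix f assume f: "f \<in> F"
      then obtain vs where vs: "fcyc f vs" using F(3) by blast
      have "{w \<in> ?Bn. w \<in> f} = V \<inter> f" using F(3)[OF f] ball_V[of v n] by auto
      then show "(\<Sum>w\<in>{w \<in> ?Bn. w \<in> f}. c f) = 1" using fcyc_card[OF vs] by (auto simp: c_def)
    qed
    finally show ?thesis by simp
  qed
  have split: "(\<Sum>w\<in>?Bn. \<Sum>f\<in>{f \<in> F. w \<in> f}. c f)
    = (\<Sum>w\<in>?B. \<Sum>f\<in>{f \<in> F. w \<in> f}. c f) + (\<Sum>w\<in>?S. \<Sum>f\<in>{f \<in> F. w \<in> f}. c f)"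
    unfolding dc(1) using dc by (intro sum.union_disjoint) auto
  have sph: "(\<Sum>s\<in>?S. \<Sum>f\<in>{f \<in> F. s \<in> f}. c f) \<le> (\<Sum>s\<in>?S. (real (deg_in v n s) - 1)) / 3"
    unfolding sum_divide_distrib
  proof (rule sum_mono)
    fix s assume s: "s \<in> ?S"
    have "(\<Sum>f\<in>{f \<in> F. s \<in> f}. c f) \<le> (\<Sum>f\<in>{f \<in> F. s \<in> f}. 1/3)"
    proof (rule sum_mono)
      fix f assume "f \<in> {f \<in> F. s \<in> f}"
      then obtain vs where vs: "fcyc f vs" using F(3) by blast
      have "card (V \<inter> f) \<ge> 3" using fcyc_card[OF vs] by simp
      then show "c f \<le> 1 / 3" unfolding c_def by (intro divide_left_mono) auto
    qed
    then show "(\<Sum>f\<in>{f \<in> F. s \<in> f}. c f) \<le> (real (deg_in v n s) - 1) / 3"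
      using few[OF s] by simp
  qed
  have corner: "(\<Sum>w\<in>?B. \<Sum>f\<in>{f \<in> faces V E. w \<in> f}. corner_term V E w f)
      = (\<Sum>w\<in>?B. \<Sum>f\<in>{f \<in> F. w \<in> f}. c f) + X"
    unfolding X_def sum.distrib[symmetric]
  proof (rule sum.cong[OF refl])
    fix w assume w: "w \<in> ?B"
    then have wV: "w \<in> V" by (simp add: ball_n_def)
    have "{f \<in> faces V E. w \<in> f} = {f \<in> F. w \<in> f} \<union> {f \<in> faces V E. w \<in> f \<and> f \<notin> F}"
      using Ff by auto
    moreover have "finite {f \<in> faces V E. w \<in> f \<and> f \<notin> F}"
      by (rule finite_subset[OF _ finite_faces_at[OF wV]]) auto
    ultimately have "(\<Sum>f\<in>{f \<in> faces V E. w \<in> f}. corner_term V E w f)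
       = (\<Sum>f\<in>{f \<in> F. w \<in> f}. corner_term V E w f) + (\<Sum>f\<in>{f \<in> faces V E. w \<in> f \<and> f \<notin> F}. corner_term V E w f)"
      using F(1) by (subst sum.union_disjoint[symmetric]) auto
    moreover have "(\<Sum>f\<in>{f \<in> F. w \<in> f}. corner_term V E w f) = (\<Sum>f\<in>{f \<in> F. w \<in> f}. c f)"
      using F(3) fcyc_corner(3)[OF _ wV] by (intro sum.cong) (auto simp: c_def)
    ultimately show "(\<Sum>f\<in>{f \<in> faces V E. w \<in> f}. corner_term V E w f)
       = (\<Sum>f\<in>{f \<in> F. w \<in> f}. c f) + (\<Sum>f\<in>{f \<in> faces V E. w \<in> f \<and> f \<notin> F}. corner_term V E w f)"
      by simp
  qed
  have "(\<Sum>w\<in>?B. vertex_curv V E w) \<le> (\<Sum>w\<in>?B. graph_curv V E)"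
    by (rule sum_mono) (use vertex_curv_le in \<open>auto simp: ball_n_def\<close>)
  then have cur: "(\<Sum>w\<in>?B. vertex_curv V E w) \<le> graph_curv V E * real (card ?B)" by (simp add: mult.commute)
  have "(\<Sum>w\<in>?B. vertex_curv V E w) = real (card ?B) - (\<Sum>w\<in>?B. real (degree E w)) / 2
      + (\<Sum>w\<in>?B. \<Sum>f\<in>{f \<in> faces V E. w \<in> f}. corner_term V E w f)"
    by (simp add: vertex_curv_def sum.distrib sum_subtractf sum_divide_distrib)
  moreover have "(\<Sum>w\<in>?B. real (degree E w)) + (\<Sum>s\<in>?S. real (deg_in v n s)) = 2 * real (card (Eb v n))"
    using arg_cong[OF handshake[OF v], of real] by simp
  moreover have "real (card F) + real (card ?B) + real (card ?S) = real (card (Eb v n)) + 1"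
    using F(2) dc card_Un_disjoint[OF dc(3,4,2)] by (simp flip: of_nat_add)
  moreover have "(\<Sum>s\<in>?S. real (deg_in v n s) - 1) = (\<Sum>s\<in>?S. real (deg_in v n s)) - real (card ?S)"
    by (simp add: sum_subtractf)
  ultimately have "- 2 * graph_curv V E * real (card ?B)
      \<le> real (card ?S) - (\<Sum>s\<in>?S. real (deg_in v n s) - 1) / 3 - 2 * X"
    using cur corner tot split sph unfolding mult.assoc[of "- 2" "graph_curv V E"] by linarith
  then show thesis using that F(3) unfolding X_def by blast
qed

lemma deg_in_ge_1: assumes "v \<in> V" "n \<ge> 1" "s \<in> sphere_n V E v n" shows "deg_in v n s \<ge> 1"
proof -
  obtain w where "nb w s" "ed w s \<in> Eb v n" using sphere_parent[OF assms] by metis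
  then have "ed w s \<in> {e \<in> Eb v n. s \<in> e}" using ed(4)[of w s] by simp
  moreover have "finite {e \<in> Eb v n. s \<in> e}" using finite_Eb[OF assms(1), of n] by simp
  ultimately have "deg_in v n s \<noteq> 0" by auto
  then show ?thesis by simp
qed

lemma sphere_bound_infinite:
  assumes "v \<in> V" "n \<ge> 1"
  shows "- 2 * graph_curv V E * real (card (ball_n V E v (n - 1))) \<le> real (card (sphere_n V E v n))"
proof -
  obtain F where "\<And>f. f \<in> F \<Longrightarrow> (\<exists>vs. fcyc f vs) \<and> V \<inter> f \<subseteq> ball_n V E v n"
    and F: "- 2 * graph_curv V E * real (card (ball_n V E v (n - 1)))
      \<le> real (card (sphere_n V E v n)) - (\<Sum>s\<in>sphere_n V E v n. real (deg_in v n s) - 1) / 3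
        - 2 * (\<Sum>w\<in>ball_n V E v (n - 1). \<Sum>f\<in>{f \<in> faces V E. w \<in> f \<and> f \<notin> F}. corner_term V E w f)"
    using curvature_ball_bound[OF assms] by blast
  have "(\<Sum>w\<in>ball_n V E v (n - 1). \<Sum>f\<in>{f \<in> faces V E. w \<in> f \<and> f \<notin> F}. corner_term V E w f) \<ge> 0"
    by (intro sum_nonneg corner_term_nonneg)
  moreover have "(\<Sum>s\<in>sphere_n V E v n. real (deg_in v n s) - 1) \<ge> 0"
    using deg_in_ge_1[OF assms] by (intro sum_nonneg) (simp add: algebra_simps)
  ultimately show ?thesis using F by linarith
qed

text \<open>A sphere vertex with at least two edges in the ball saves 1/3, hence at least
  \<open>1 / q\<close>. For those with only one edge the missing \<open>1 / q\<close> comes from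
  corners outside \<open>F\<close>, whose terms are at least \<open>1 / q\<close> because all faces
  are finite of length at most \<open>q\<close>.\<close>

lemma sphere_bound_finite:
  assumes v: "v \<in> V" "n \<ge> 1" and fin: "\<And>f. f \<in> faces V E \<Longrightarrow> finite_face V E f"
    and q: "\<And>f. f \<in> faces V E \<Longrightarrow> face_len V E f \<le> q" "q \<ge> 3"
  shows "- 2 * graph_curv V E * real (card (ball_n V E v (n - 1))) \<le> (1 - 1 / real q) * real (card (sphere_n V E v n))"
proof -
  let ?B = "ball_n V E v (n - 1)" and ?S = "sphere_n V E v n"
  note dc = ball_decomp[OF v]
  obtain F where F: "\<And>f. f \<in> F \<Longrightarrow> (\<exists>vs. fcyc f vs) \<and> V \<inter> f \<subseteq> ball_n V E v n"
    "- 2 * graph_curv V E * real (card (ball_n V E v (n - 1)))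
      \<le> real (card (sphere_n V E v n)) - (\<Sum>s\<in>sphere_n V E v n. real (deg_in v n s) - 1) / 3
        - 2 * (\<Sum>w\<in>ball_n V E v (n - 1). \<Sum>f\<in>{f \<in> faces V E. w \<in> f \<and> f \<notin> F}. corner_term V E w f)"
    using curvature_ball_bound[OF v] by blast
  define P where "P = (SIGMA w:?B. {f \<in> faces V E. w \<in> f \<and> f \<notin> F})"
  have finf: "finite {f \<in> faces V E. w \<in> f \<and> f \<notin> F}" if "w \<in> ?B" for w
    by (rule finite_subset[OF _ finite_faces_at[of w]]) (use that in \<open>auto simp: ball_n_def\<close>)
  then have finP: "finite P" unfolding P_def using dc(3) by (intro finite_SigmaI) auto
  have ct: "corner_term V E w f \<ge> 1 / real q" if wf: "(w, f) \<in> P" for w f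
  proof -
    have f: "f \<in> faces V E" "w \<in> f" "w \<in> V" using wf by (auto simp: P_def ball_n_def)
    obtain vs where vs: "fcyc f vs" using finite_faceE[OF f(1) fin[OF f(1)]] .
    have "card (V \<inter> f) \<le> q" "card (V \<inter> f) \<ge> 3" using q(1)[OF f(1)] fcyc_corner(2)[OF vs] fcyc_card[OF vs] by auto
    then have "1 / real q \<le> 1 / real (card (V \<inter> f))" by (intro divide_left_mono) auto
    then show ?thesis using fcyc_corner(3)[OF vs f(3,2)] by simp
  qed
  have "(\<Sum>w\<in>?B. \<Sum>f\<in>{f \<in> faces V E. w \<in> f \<and> f \<notin> F}. corner_term V E w f) = (\<Sum>(w, f)\<in>P. corner_term V E w f)"
    unfolding P_def using dc(3) finf by (intro sum.Sigma) auto
  also have "\<dots> \<ge> (\<Sum>(w, f)\<in>P. 1 / real q)" by (rule sum_mono) (use ct in auto)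
  finally have X: "(\<Sum>w\<in>?B. \<Sum>f\<in>{f \<in> faces V E. w \<in> f \<and> f \<notin> F}. corner_term V E w f) \<ge> real (card P) / real q"
    by (simp add: case_prod_beta)
  define S1 where "S1 = {s \<in> ?S. deg_in v n s = 1}"
  have finS: "finite ?S" "S1 \<subseteq> ?S" "finite S1" using dc(4) by (auto simp: S1_def)
  \<comment> \<open>A face bounded by a cycle has only two edges at \<open>w\<close>, so a corner is
    charged by at most two sphere vertices.\<close>
  have nbf: "finite {s. nb w s \<and> ed w s \<subseteq> f}" "card {s. nb w s \<and> ed w s \<subseteq> f} \<le> 2"
    if wf: "(w, f) \<in> P" for w f
  proof -
    have f: "f \<in> faces V E" "w \<in> f" "w \<in> V" using wf by (auto simp: P_def ball_n_def)
    obtain vs where vs: "fcyc f vs" using finite_faceE[OF f(1) fin[OF f(1)]] .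
    have inj: "inj_on (ed w) {s. nb w s \<and> ed w s \<subseteq> f}" using ed_inj by (auto simp: inj_on_def)
    have sub: "ed w ` {s. nb w s \<and> ed w s \<subseteq> f} \<subseteq> {e \<in> E. w \<in> e \<and> e \<subseteq> f}" using ed by auto
    have "card {e \<in> E. w \<in> e \<and> e \<subseteq> f} = 2" using fcyc_two_edges[OF vs f(3,2)] .
    moreover have "finite {e \<in> E. w \<in> e \<and> e \<subseteq> f}"
      by (rule finite_subset[OF _ finite_edges_at[of w]]) auto
    ultimately show "finite {s. nb w s \<and> ed w s \<subseteq> f}" "card {s. nb w s \<and> ed w s \<subseteq> f} \<le> 2"
      using card_inj_on_le[OF inj sub] inj_on_finite[OF inj sub] by auto
  qed
  have cover: "S1 \<subseteq> (\<Union>(w, f)\<in>P. {s. nb w s \<and> ed w s \<subseteq> f})"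
  proof
    fix s assume s: "s \<in> S1"
    then have sS: "s \<in> ?S" "deg_in v n s = 1" by (auto simp: S1_def)
    obtain w where w: "nb w s" "w \<in> ?B" using sphere_parent[OF v sS(1)] by metis
    obtain f where f: "f \<in> faces V E" "ed w s \<subseteq> f" using edge_in_some_face[OF ed(1)[OF w(1)]] .
    \<comment> \<open>A face of \<open>F\<close> through \<open>s\<close> would have two edges at
      \<open>s\<close>, both with ends in the ball, contradicting \<open>deg_in v n s = 1\<close>.
      So the corner of \<open>f\<close> at the parent of \<open>s\<close> is in
      \<open>P\<close>.\<close>
    have "f \<notin> F"
    proof
      assume fF: "f \<in> F"
      then obtain vs where vs: "fcyc f vs" using F(1) by blast
      have "s \<in> f" "s \<in> V" using f(2) ed(4)[OF w(1)] nb_V[OF w(1)] by auto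
      then have "card {e \<in> E. s \<in> e \<and> e \<subseteq> f} = 2" using fcyc_two_edges[OF vs] by simp
      moreover have "card {e \<in> E. s \<in> e \<and> e \<subseteq> f} \<le> deg_in v n s"
      proof (rule card_mono)
        show "finite {e \<in> Eb v n. s \<in> e}" using finite_Eb[OF v(1)] by simp
        show "{e \<in> E. s \<in> e \<and> e \<subseteq> f} \<subseteq> {e \<in> Eb v n. s \<in> e}"
          using F(1)[OF fF] by (auto simp: Eb_def)
      qed
      ultimately have "2 \<le> deg_in v n s" by simp
      then show False using sS by simp
    qed
    then have "(w, f) \<in> P" using f w ed(3)[OF w(1)] by (auto simp: P_def)
    then show "s \<in> (\<Union>(w, f)\<in>P. {s. nb w s \<and> ed w s \<subseteq> f})" using w(1) f(2) by auto
  qed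
  have "card S1 \<le> card (\<Union>(w, f)\<in>P. {s. nb w s \<and> ed w s \<subseteq> f})"
    using cover finP nbf by (intro card_mono) auto
  also have "\<dots> \<le> (\<Sum>(w, f)\<in>P. card {s. nb w s \<and> ed w s \<subseteq> f})"
    using card_UN_le[OF finP, of "\<lambda>(w, f). {s. nb w s \<and> ed w s \<subseteq> f}"] by (simp add: case_prod_beta)
  also have "\<dots> \<le> (\<Sum>(w, f)\<in>P. 2)" by (rule sum_mono) (use nbf in auto)
  finally have S1: "card S1 \<le> 2 * card P" by (simp add: case_prod_beta)
  have "(\<Sum>s\<in>?S. real (deg_in v n s) - 1) \<ge> (\<Sum>s\<in>?S. of_bool (s \<notin> S1))"
  proof (rule sum_mono)
    fix s assume s: "s \<in> ?S"
    then show "of_bool (s \<notin> S1) \<le> real (deg_in v n s) - 1"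
      using deg_in_ge_1[OF v s] by (auto simp: S1_def)
  qed
  moreover have "(\<Sum>s\<in>?S. of_bool (s \<notin> S1) :: real) = real (card (?S - S1))"
    using finS by (simp add: of_bool_def sum.If_cases Diff_eq Int_def)
  ultimately have D: "(\<Sum>s\<in>?S. real (deg_in v n s) - 1) \<ge> real (card ?S) - real (card S1)"
    using finS by (simp add: card_Diff_subset of_nat_diff card_mono)
  have le: "real (card S1) \<le> real (card ?S)" using finS by (simp add: card_mono)
  have "(real (card ?S) - real (card S1)) / real q \<le> (real (card ?S) - real (card S1)) / 3"
    using q(2) le by (intro divide_left_mono) auto
  moreover have "real (card S1) / real q \<le> 2 * (real (card P) / real q)"
  proof -
    have "real (card S1) \<le> 2 * real (card P)" using S1 by linarith
    then show ?thesis using divide_right_mono[of "real (card S1)" "2 * real (card P)" "real q"] by simp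
  qed
  ultimately have h: "real (card ?S) / real q \<le> (real (card ?S) - real (card S1)) / 3 + 2 * (real (card P) / real q)"
    by (simp add: diff_divide_distrib)
  have eq: "(1 - 1 / real q) * real (card ?S) = real (card ?S) - real (card ?S) / real q"
    by (simp add: algebra_simps)
  have "L \<le> s - a" if "a \<le> (s - s1) / 3 + 2 * b" "L \<le> s - D / 3 - 2 * X" "b \<le> X" "s - s1 \<le> D"
    for L s a s1 b D X :: real using that by (simp add: field_simps)
  from this[OF h F(2) X D] show ?thesis unfolding eq .
qed

lemma sphere_bound:
  assumes v: "v \<in> V" "n \<ge> 1"
  shows "real (card (sphere_n V E v n)) \<ge> - 2 * graph_curv V E * q_factor V E * real (card (ball_n V E v (n - 1)))"
    and "q_factor V E > 0"
proof -
  let ?P = "(\<forall>f\<in>faces V E. finite_face V E f) \<and> bdd_above (face_len V E ` faces V E)"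
  have "real (card (sphere_n V E v n)) \<ge> - 2 * graph_curv V E * q_factor V E * real (card (ball_n V E v (n - 1)))
    \<and> q_factor V E > 0"
  proof (cases ?P)
    case False
    \<comment> \<open>An infinite face or unbounded face lengths both mean
      \<open>q = \<infinity>\<close>, where the bound without the extra gain is what is
      claimed.\<close>
    then have "q_factor V E = 1" unfolding q_factor_def by (rule if_not_P)
    then show ?thesis using sphere_bound_infinite[OF v] by simp
  next
    case True
    define q where "q = Sup (face_len V E ` faces V E)"
    have qf: "q_factor V E = real q / (real q - 1)" using True by (simp add: q_factor_def q_def Let_def)
    have qle: "face_len V E f \<le> q" if "f \<in> faces V E" for f
      unfolding q_def using True that by (intro cSUP_upper) auto
    obtain w where w: "nb v w" using vertex_has_nb v(1) by blast
    obtain f where f: "f \<in> faces V E" using edge_in_some_face[OF ed(1)[OF w]] by metis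
    then obtain vs where vs: "fcyc f vs" using finite_faceE True by metis
    have q3: "q \<ge> 3" using qle[OF f] fcyc_corner(2)[OF vs] fcyc_card[OF vs] by simp
    have "- 2 * graph_curv V E * real (card (ball_n V E v (n - 1))) \<le> (1 - 1 / real q) * real (card (sphere_n V E v n))"
      using sphere_bound_finite[OF v _ qle q3] True by blast
    then show ?thesis unfolding qf using q3 by (simp add: field_simps)
  qed
  then show "real (card (sphere_n V E v n)) \<ge> - 2 * graph_curv V E * q_factor V E * real (card (ball_n V E v (n - 1)))"
    "q_factor V E > 0" by auto
qed

section \<open>Exponential growth rates\<close>

lemma ball_growth:
  assumes v: "v \<in> V" and neg: "graph_curv V E < 0"
  shows "(1 - 2 * graph_curv V E * q_factor V E) ^ n \<le> real (card (ball_n V E v n))"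
proof (induction n)
  case 0
  have "v \<in> ball_n V E v 0" using v by (simp add: ball_n_def)
  then have "card (ball_n V E v 0) \<noteq> 0" using finite_ball[OF v, of 0] by auto
  then show ?case by simp
next
  case (Suc n)
  let ?c = "- 2 * graph_curv V E * q_factor V E"
  have dc: "card (ball_n V E v (Suc n)) = card (ball_n V E v n) + card (sphere_n V E v (Suc n))"
    using ball_decomp[OF v, of "Suc n"] card_Un_disjoint[of "ball_n V E v n" "sphere_n V E v (Suc n)"] by simp
  have "?c > 0" using neg sphere_bound(2)[OF v, of 1] by (simp add: mult_neg_pos)
  then have "(1 + ?c) ^ Suc n \<le> (1 + ?c) * real (card (ball_n V E v n))"
    using Suc by simp
  also have "\<dots> \<le> real (card (ball_n V E v (Suc n)))"
    using sphere_bound(1)[OF v, of "Suc n"] dc by (simp add: algebra_simps)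
  finally show ?case by simp
qed

lemma growth_lower:
  assumes v: "v \<in> V" and neg: "graph_curv V E < 0"
  shows "ereal (ln (1 - 2 * graph_curv V E * q_factor V E))
    \<le> limsup (\<lambda>n. ereal (ln (real (card (sphere_n V E v n))) / real n))"
proof -
  define c where "c = - 2 * graph_curv V E * q_factor V E"
  have c: "c > 0" unfolding c_def using neg sphere_bound(2)[OF v, of 1] by (simp add: mult_neg_pos)
  have c1: "1 - 2 * graph_curv V E * q_factor V E = 1 + c" by (simp add: c_def)
  \<comment> \<open>The normalised logarithm of the lower bound \<open>c * (1 + c) ^ (n - 1)\<close>
    for the sphere, obtained from one sphere estimate on top of the ball growth; the constant factor
    vanishes in the limit.\<close>
  define g where "g n = (ln c + (real n - 1) * ln (1 + c)) / real n" for n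
  have "g n \<le> ln (real (card (sphere_n V E v n))) / real n" if n: "n \<ge> 1" for n
  proof -
    have "c * (1 + c) ^ (n - 1) \<le> c * real (card (ball_n V E v (n - 1)))"
      using ball_growth[OF v neg, of "n - 1"] c unfolding c1 by (intro mult_left_mono) auto
    also have "\<dots> \<le> real (card (sphere_n V E v n))" using sphere_bound(1)[OF v n] unfolding c_def .
    finally have "ln (c * (1 + c) ^ (n - 1)) \<le> ln (real (card (sphere_n V E v n)))"
      using c by (intro ln_mono) auto
    moreover have "ln (c * (1 + c) ^ (n - 1)) = ln c + (real n - 1) * ln (1 + c)"
      using c n by (simp add: ln_mult ln_realpow of_nat_diff)
    ultimately show ?thesis unfolding g_def using n by (simp add: divide_right_mono)
  qed
  then have ev: "eventually (\<lambda>n. ereal (g n) \<le> ereal (ln (real (card (sphere_n V E v n))) / real n)) sequentially"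
    by (auto simp: eventually_sequentially)
  have "g \<longlonglongrightarrow> ln (1 + c)"
  proof -
    have "(\<lambda>n. (ln c - ln (1 + c)) * (1 / real n) + ln (1 + c)) \<longlonglongrightarrow> (ln c - ln (1 + c)) * 0 + ln (1 + c)"
      by (intro tendsto_intros lim_1_over_n)
    moreover have "eventually (\<lambda>n. (ln c - ln (1 + c)) * (1 / real n) + ln (1 + c) = g n) sequentially"
      using eventually_gt_at_top[of 0] by eventually_elim (simp add: g_def field_simps)
    ultimately show ?thesis using Lim_transform_eventually by force
  qed
  then have "limsup (\<lambda>n. ereal (g n)) = ereal (ln (1 + c))"
    by (intro lim_imp_Limsup) auto
  then show ?thesis using Limsup_mono[OF ev] unfolding c1 by simp
qed

lemma growth_upper:
  assumes v: "v \<in> V"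
  shows "limsup (\<lambda>n. ereal (ln (real (card (sphere_n V E v n))) / real n)) \<le> ereal_ln (max_degree V E - 1)"
proof (cases "max_degree V E = \<infinity>")
  case True
  then show ?thesis by (simp add: ereal_ln_def)
next
  case False
  have deg: "ereal (real (degree E w)) \<le> max_degree V E" if "w \<in> V" for w
    unfolding max_degree_def using that by (rule SUP_upper)
  have "max_degree V E \<noteq> - \<infinity>" using deg[OF v] by auto
  then obtain p where p: "max_degree V E = ereal p" using False by (cases "max_degree V E") auto
  have degp: "real (degree E w) \<le> p" if "w \<in> V" for w using deg[OF that] p by simp
  \<comment> \<open>One of the at most \<open>p\<close> neighbours of \<open>s\<close> is a parent.
    The root has no parent, hence \<open>n \<ge> 1\<close>.\<close>
  have fwd: "real (card {x. nb s x \<and> d v x = Suc n}) \<le> p - 1" if s: "s \<in> sphere_n V E v n" "n \<ge> 1" for s n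
  proof -
    have sV: "s \<in> V" "d v s = n" using s by (auto simp: sphere_n_def)
    obtain w where w: "nb w s" "w \<in> ball_n V E v (n - 1)" using sphere_parent[OF v s(2,1)] by metis
    have "{x. nb s x \<and> d v x = Suc n} \<subseteq> {x. nb s x} - {w}" using w(2) by (auto simp: ball_n_def)
    then have "card {x. nb s x \<and> d v x = Suc n} \<le> card ({x. nb s x} - {w})"
      using finite_nb[OF sV(1)] by (intro card_mono) auto
    moreover have "Suc (card ({x. nb s x} - {w})) = degree E s"
      using card_Suc_Diff1[OF finite_nb[OF sV(1)], of w] nb_sym[OF w(1)] card_nb[OF sV(1)] by simp
    ultimately show ?thesis using degp[OF sV(1)] by linarith
  qed
  have pos: "card (sphere_n V E v n) > 0" for n
  proof -
    obtain r where r: "r 0 = v" "\<And>i. nb (r i) (r (Suc i))" "\<And>i. d v (r i) = d v v + i"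
      using ray[OF v v] by metis
    have "r n \<in> sphere_n V E v n" using r(3)[of n] nb_V(1)[OF r(2)[of n]] by (simp add: sphere_n_def)
    moreover have "finite (sphere_n V E v n)"
      by (rule finite_subset[OF _ finite_ball[OF v, of n]]) (auto simp: sphere_n_def ball_n_def)
    ultimately show ?thesis using card_gt_0_iff by blast
  qed
  have step: "real (card (sphere_n V E v (Suc n))) \<le> (p - 1) * real (card (sphere_n V E v n))" if n: "n \<ge> 1" for n
  proof -
    have fin: "finite (sphere_n V E v n)" using ball_decomp[OF v n] by simp
    have "sphere_n V E v (Suc n) \<subseteq> (\<Union>s\<in>sphere_n V E v n. {x. nb s x \<and> d v x = Suc n})"
    proof
      fix x assume x: "x \<in> sphere_n V E v (Suc n)"
      then obtain u where u: "nb u x" "d v u = n" using d_pred[OF v, of x n] by (auto simp: sphere_n_def)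
      then show "x \<in> (\<Union>s\<in>sphere_n V E v n. {x. nb s x \<and> d v x = Suc n})"
        using x nb_V[OF u(1)] by (auto simp: sphere_n_def)
    qed
    moreover have "finite {x. nb s x \<and> d v x = Suc n}" if "s \<in> sphere_n V E v n" for s
      by (rule finite_subset[OF _ finite_nb[of s]]) (use that in \<open>auto simp: sphere_n_def\<close>)
    ultimately have "card (sphere_n V E v (Suc n)) \<le> card (\<Union>s\<in>sphere_n V E v n. {x. nb s x \<and> d v x = Suc n})"
      using fin by (intro card_mono) auto
    also have "\<dots> \<le> (\<Sum>s\<in>sphere_n V E v n. card {x. nb s x \<and> d v x = Suc n})" by (rule card_UN_le[OF fin])
    finally have "real (card (sphere_n V E v (Suc n))) \<le> (\<Sum>s\<in>sphere_n V E v n. real (card {x. nb s x \<and> d v x = Suc n}))"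
      unfolding of_nat_sum[symmetric] by (rule of_nat_mono)
    also have "\<dots> \<le> (\<Sum>s\<in>sphere_n V E v n. p - 1)" by (rule sum_mono) (use fwd n in auto)
    finally show ?thesis by (simp add: mult.commute)
  qed
  define K where "K = real (card (sphere_n V E v 1))"
  \<comment> \<open>The second sphere is nonempty, which forces \<open>p > 1\<close>; the logarithm
    of \<open>p - 1\<close> and the monotonicity of multiplication by it depend on this.\<close>
  have "(p - 1) * K \<ge> real (card (sphere_n V E v (Suc 1)))" "real (card (sphere_n V E v (Suc 1))) > 0" "K > 0"
    using step[of 1] pos[of "Suc 1"] pos[of 1] unfolding K_def by auto
  then have p1: "p - 1 > 0" by (smt (verit) zero_less_mult_pos2)
  have bound: "real (card (sphere_n V E v (Suc n))) \<le> K * (p - 1) ^ n" for n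
  proof (induction n)
    case (Suc n)
    have "real (card (sphere_n V E v (Suc (Suc n)))) \<le> (p - 1) * real (card (sphere_n V E v (Suc n)))"
      using step[of "Suc n"] by simp
    also have "\<dots> \<le> (p - 1) * (K * (p - 1) ^ n)" using Suc p1 by (intro mult_left_mono) auto
    finally show ?case by (simp add: algebra_simps)
  qed (simp add: K_def)
  define g where "g n = (ln K + (real n - 1) * ln (p - 1)) / real n" for n
  have "ln (real (card (sphere_n V E v n))) / real n \<le> g n" if n: "n \<ge> 1" for n
  proof -
    obtain m where m: "n = Suc m" using n by (cases n) auto
    have "ln (real (card (sphere_n V E v n))) \<le> ln (K * (p - 1) ^ m)"
      using bound[of m] pos[of n] m by (intro ln_mono) auto
    also have "\<dots> = ln K + (real n - 1) * ln (p - 1)"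
      using \<open>K > 0\<close> p1 m by (simp add: ln_mult ln_realpow)
    finally show ?thesis unfolding g_def using n by (simp add: divide_right_mono)
  qed
  then have ev: "eventually (\<lambda>n. ereal (ln (real (card (sphere_n V E v n))) / real n) \<le> ereal (g n)) sequentially"
    by (auto simp: eventually_sequentially)
  have "g \<longlonglongrightarrow> ln (p - 1)"
  proof -
    have "(\<lambda>n. (ln K - ln (p - 1)) * (1 / real n) + ln (p - 1)) \<longlonglongrightarrow> (ln K - ln (p - 1)) * 0 + ln (p - 1)"
      by (intro tendsto_intros lim_1_over_n)
    moreover have "eventually (\<lambda>n. (ln K - ln (p - 1)) * (1 / real n) + ln (p - 1) = g n) sequentially"
      using eventually_gt_at_top[of 0] by eventually_elim (simp add: g_def field_simps)
    ultimately show ?thesis using Lim_transform_eventually by force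
  qed
  then have "limsup (\<lambda>n. ereal (g n)) = ereal (ln (p - 1))"
    by (intro lim_imp_Limsup) auto
  moreover have "ereal_ln (max_degree V E - 1) = ereal (ln (p - 1))"
    by (simp add: p ereal_ln_def one_ereal_def)
  ultimately show ?thesis using Limsup_mono[OF ev] by simp
qed

end

theorem theorem5p3:
  fixes V :: "(real^2) set" and E :: "(real^2) set set"
  assumes "plane_graph V E"
    and "graph_connected V E"
    and "locally_finite_graph E"
    and "empty_cut_locus V E"
    and "graph_curv V E < 0"
  shows "(\<forall>v\<in>V. \<forall>n\<ge>1.
            real (card (sphere_n V E v n))
              \<ge> - 2 * graph_curv V E * q_factor V E * real (card (ball_n V E v (n - 1))))
       \<and> (\<forall>v\<in>V.
            ereal (ln (1 - 2 * graph_curv V E * q_factor V E))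
              \<le> limsup (\<lambda>n. ereal (ln (real (card (sphere_n V E v n))) / real n))
          \<and> limsup (\<lambda>n. ereal (ln (real (card (sphere_n V E v n))) / real n))
              \<le> ereal_ln (max_degree V E - 1))"
proof -
  interpret planar_graph V E using assms by unfold_locales
  show ?thesis using sphere_bound(1) growth_lower[OF _ assms(5)] growth_upper by blast
qed

end
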